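(* Let $H$ be a graph that is $3$-connected or isomorphic to $K_3$, let $q\ge 2$ be an integer, and let $F$ be a graph which is not $q$-Ramsey for $H$. Then there are infinitely many (pairwise non-isomorphic) graphs $G\in\mathcal{M}_q(H)$ such that $F$ is (isomorphic to) an induced subgraph of $G$.
   Context: All graphs are finite and simple. For an integer $q\ge 2$, a $q$-colouring of a graph $G$ is a map $E(G)\to[q]$. A graph $G$ is $q$-Ramsey for $H$, written $G\to(H)_q$, if every $q$-colouring of $E(G)$ contains a monochromatic copy of $H$. $G$ is $q$-Ramsey-minimal for $H$ if $G\to(H)_q$ but no proper subgraph of $G$ is $q$-Ramsey for $H$. $\mathcal{M}_q(H)$ denotes the set of all graphs that are $q$-Ramsey-minimal for $H$. *)

theory Defs
  imports Main "HOL-Library.FuncSet"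
begin

datatype 'a sgraph = SGraph (verts: "'a set") (edges: "'a set set")

definition simple_graph :: "'a sgraph \<Rightarrow> bool" where
  "simple_graph G \<longleftrightarrow>
     finite (verts G) \<and> (\<forall>e \<in> edges G. e \<subseteq> verts G \<and> card e = 2)"

definition subgraph :: "'a sgraph \<Rightarrow> 'a sgraph \<Rightarrow> bool" where
  "subgraph G' G \<longleftrightarrow>
     simple_graph G' \<and> simple_graph G \<and> verts G' \<subseteq> verts G \<and> edges G' \<subseteq> edges G"

definition proper_subgraph :: "'a sgraph \<Rightarrow> 'a sgraph \<Rightarrow> bool" where
  "proper_subgraph G' G \<longleftrightarrow> subgraph G' G \<and> G' \<noteq> G"

definition induced_on :: "'a sgraph \<Rightarrow> 'a set \<Rightarrow> 'a sgraph" where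
  "induced_on G U = SGraph U {e \<in> edges G. e \<subseteq> U}"

definition induced_subgraph :: "'a sgraph \<Rightarrow> 'a sgraph \<Rightarrow> bool" where
  "induced_subgraph F G \<longleftrightarrow> (\<exists>U \<subseteq> verts G. F = induced_on G U)"

definition graph_iso :: "'a sgraph \<Rightarrow> 'b sgraph \<Rightarrow> bool" where
  "graph_iso G H \<longleftrightarrow>
     (\<exists>f. bij_betw f (verts G) (verts H) \<and>
          (\<forall>u \<in> verts G. \<forall>v \<in> verts G. {u, v} \<in> edges G \<longleftrightarrow> {f u, f v} \<in> edges H))"

definition complete_graph :: "nat \<Rightarrow> nat sgraph" where
  "complete_graph n = SGraph {..<n} {e. e \<subseteq> {..<n} \<and> card e = 2}"

definition connected_graph :: "'a sgraph \<Rightarrow> bool" where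
  "connected_graph G \<longleftrightarrow>
     verts G \<noteq> {} \<and>
     (\<forall>u \<in> verts G. \<forall>v \<in> verts G. (\<lambda>x y. {x, y} \<in> edges G)\<^sup>*\<^sup>* u v)"

text \<open>
  The usual convention: a \<open>k\<close>-connected graph has more than \<open>k\<close> vertices, so the complete
  graph on three vertices is not 3-connected.
\<close>

definition k_connected :: "nat \<Rightarrow> 'a sgraph \<Rightarrow> bool" where
  "k_connected k G \<longleftrightarrow>
     card (verts G) > k \<and>
     (\<forall>X \<subseteq> verts G. card X < k \<longrightarrow> connected_graph (induced_on G (verts G - X)))"

text \<open>
  Only the values of a colouring on the edges of the graph matter, so it is not required to be
  extensional.
\<close>

definition colouring :: "nat \<Rightarrow> 'a sgraph \<Rightarrow> ('a set \<Rightarrow> nat) \<Rightarrow> bool" where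
  "colouring q G c \<longleftrightarrow> c \<in> edges G \<rightarrow> {1..q}"

definition monochromatic_copy ::
    "nat \<Rightarrow> 'b sgraph \<Rightarrow> 'a sgraph \<Rightarrow> ('a set \<Rightarrow> nat) \<Rightarrow> 'a sgraph \<Rightarrow> bool" where
  "monochromatic_copy q H G c H' \<longleftrightarrow>
     subgraph H' G \<and> graph_iso H' H \<and> (\<exists>i \<in> {1..q}. \<forall>e \<in> edges H'. c e = i)"

definition ramsey_for :: "nat \<Rightarrow> 'b sgraph \<Rightarrow> 'a sgraph \<Rightarrow> bool" where
  "ramsey_for q H G \<longleftrightarrow>
     (\<forall>c. colouring q G c \<longrightarrow> (\<exists>H'. monochromatic_copy q H G c H'))"

text \<open>
  The vertex type of the Ramsey-minimal graphs is independent of that of \<open>H\<close>; at vertex type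
  \<^typ>\<open>nat\<close> every finite graph occurs up to isomorphism.
\<close>

definition ramsey_minimal_graphs :: "nat \<Rightarrow> 'b sgraph \<Rightarrow> 'a sgraph set" where
  "ramsey_minimal_graphs q H =
     {G. simple_graph G \<and> ramsey_for q H G \<and>
         (\<forall>G'. proper_subgraph G' G \<longrightarrow> \<not> ramsey_for q H G')}"

end

theory Submission
  imports Defs Complex_Main "HOL-Library.Ramsey" "HOL-Combinatorics.Transposition"
begin

text \<open>
  Call an edge set colourable if it has a \<open>q\<close>-colouring without a monochromatic copy of \<open>H\<close>. The
  only property of \<open>H\<close> that matters is that it has no separator of at most two vertices. Hence
  graphs can be glued along an edge, along far apart edges, or along a star with far apart leaves,
  without new copies of \<open>H\<close>.

  If \<open>e\<close> is an edge at \<open>u\<close> of a minimal uncolourable graph, then in every colouring of the graph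
  without \<open>e\<close> the remaining star at \<open>u\<close> has at least two colours, since otherwise \<open>e\<close> could be
  coloured as well. Gluing copies of this graph along a large star, placed according to a hypergraph
  of large girth and chromatic number, results in an uncolourable graph. The step at which
  colourability is lost produces two edges at a common vertex that always differ. A second round with
  these produces two edges at a common vertex that always agree, and chaining the latter produces
  senders, which force two edges at large distance to agree or to differ.

  For a colourable graph \<open>F\<close> with colouring \<open>c0\<close>, senders force \<open>c0\<close> on \<open>F\<close>. Further senders
  and copies of \<open>H\<close> that act as clauses evaluate the conjunction of ``\<open>e\<close> is present'' over the edges
  of \<open>F\<close>, and a last sender contradicts it. The resulting graph is uncolourable and every edge of
  \<open>F\<close> is critical in it, so each minimal uncolourable subgraph contains \<open>F\<close>. To cover isolated
  vertices and to get arbitrarily large graphs, pendant edges and a matching are added to \<open>F\<close> first.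
\<close>

section \<open>Sparse block systems without large independent sets\<close>

text \<open>Distances are certified rather than computed: a level function is 0 at one terminal,
  exceeds the number \<open>h\<close> of vertices of \<open>H\<close> at the others, and changes by
  at most one along edges. Certificates survive gluing by extension, and \<open>h\<close> vertices
  against \<open>h\<close> levels is the pigeonhole argument that leads to a small separator. A star
  is the delicate interface, since all its leaves are joined through the centre. Distances are
  therefore taken with the centre removed, and the separators that arise consist of the centre and
  one leaf, or of the two ends of an edge. Copies attached to the same star connect its leaves
  outside the centre, which is what the girth controls; the chromatic number yields a block of
  leaves with one colour, which no attached copy tolerates. Inequality has to be forced before
  equality. A graph that avoids all colour patterns of another one is useful once these patterns are
  known; for two edges that always differ they are, up to permuting colours, all unequal pairs, and
  avoiding them means equality.\<close>

text \<open>The newest block comes first. Its points have to be pairwise at distance more than \<open>g\<close> in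
  the earlier blocks; this inductive form of large girth is what gluing one block at a time
  needs.\<close>

definition lipschitz_on_blocks :: "'v list list \<Rightarrow> ('v \<Rightarrow> nat) \<Rightarrow> bool" where
  "lipschitz_on_blocks ts l \<longleftrightarrow> (\<forall>s\<in>set ts. \<forall>x\<in>set s. \<forall>y\<in>set s. l y \<le> l x + 1)"

fun sparse_blocks :: "nat \<Rightarrow> nat \<Rightarrow> 'v set \<Rightarrow> 'v list list \<Rightarrow> bool" where
  "sparse_blocks g d X [] \<longleftrightarrow> True"
| "sparse_blocks g d X (t # ts) \<longleftrightarrow> sparse_blocks g d X ts \<and> length t = d \<and> distinct t \<and> set t \<subseteq> X \<and>
     (\<forall>a\<in>set t. \<exists>l. lipschitz_on_blocks ts l \<and> l a = 0 \<and> (\<forall>b\<in>set t - {a}. g < l b))"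

section \<open>Balls and truncated distances in a block system\<close>

definition block_rel :: "'v list list \<Rightarrow> 'v rel" where
  "block_rel ts = {(x, y). x = y \<or> (\<exists>s\<in>set ts. x \<in> set s \<and> y \<in> set s)}"

text \<open>\<open>block_rel\<close> contains the diagonal so that its powers increase: the ball
  holds the points at distance at most \<open>i\<close>, not exactly \<open>i\<close>, where two
  points of a common block are at distance at most one.\<close>

definition block_ball :: "'v list list \<Rightarrow> nat \<Rightarrow> 'v \<Rightarrow> 'v set" where
  "block_ball ts i x = (block_rel ts ^^ i) `` {x}"

lemma block_ball_0 [simp]: "block_ball ts 0 x = {x}"
  by (simp add: block_ball_def)

lemma block_ball_Suc: "block_ball ts (Suc i) x = block_rel ts `` block_ball ts i x"
  by (auto simp: block_ball_def)

lemma block_ball_mono: "i \<le> j \<Longrightarrow> block_ball ts i x \<subseteq> block_ball ts j x"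
proof (rule lift_Suc_mono_le[of "\<lambda>i. block_ball ts i x"])
  show "block_ball ts n x \<subseteq> block_ball ts (Suc n) x" for n
    by (auto simp: block_ball_Suc block_rel_def)
qed

lemma block_ball_self: "x \<in> block_ball ts i x"
  using block_ball_mono[of 0 i ts x] by simp

lemma block_ball_sym: "y \<in> block_ball ts i x \<Longrightarrow> x \<in> block_ball ts i y"
proof (induction i arbitrary: y)
  case (Suc i)
  then obtain z where z: "z \<in> block_ball ts i x" "(z, y) \<in> block_rel ts"
    by (auto simp: block_ball_Suc)
  have "(y, z) \<in> block_rel ts" using z(2) by (auto simp: block_rel_def)
  moreover have "(z, x) \<in> block_rel ts ^^ i"
    using Suc.IH[OF z(1)] by (auto simp: block_ball_def)
  ultimately have "(y, x) \<in> block_rel ts ^^ Suc i" by (rule relpow_Suc_I2)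
  then show ?case by (auto simp: block_ball_def)
qed simp

text \<open>The function is the distance from \<open>a\<close> truncated at \<open>g + 1\<close>,
  expressed as the number of radii up to \<open>g\<close> whose ball misses the point. Points that
  cannot be reached from \<open>a\<close> get the value \<open>g + 1\<close> without a case
  distinction.\<close>

lemma lipschitz_distance:
  obtains l where "lipschitz_on_blocks ts l" "l a = 0" "\<And>b. b \<notin> block_ball ts g a \<Longrightarrow> g < l b"
proof -
  define l where "l y = card {i. i \<le> g \<and> y \<notin> block_ball ts i a}" for y
  have "lipschitz_on_blocks ts l"
    unfolding lipschitz_on_blocks_def
  proof (intro ballI)
    fix s x y assume s: "s \<in> set ts" "x \<in> set s" "y \<in> set s"
    have "{i. i \<le> g \<and> y \<notin> block_ball ts i a} \<subseteq> insert 0 (Suc ` {i. i \<le> g \<and> x \<notin> block_ball ts i a})"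
    proof
      fix i assume i: "i \<in> {i. i \<le> g \<and> y \<notin> block_ball ts i a}"
      show "i \<in> insert 0 (Suc ` {i. i \<le> g \<and> x \<notin> block_ball ts i a})"
      proof (cases i)
        case (Suc j)
        have "x \<notin> block_ball ts j a"
        proof
          assume "x \<in> block_ball ts j a"
          then have "y \<in> block_ball ts i a"
            using s Suc by (auto simp: block_ball_Suc block_rel_def)
          then show False using i by simp
        qed
        then show ?thesis using i Suc by auto
      qed simp
    qed
    then have "l y \<le> card (insert 0 (Suc ` {i. i \<le> g \<and> x \<notin> block_ball ts i a}))"
      unfolding l_def by (rule card_mono[rotated]) simp
    also have "\<dots> \<le> l x + 1"
      by (simp add: l_def card_insert_if card_image)
    finally show "l y \<le> l x + 1" .
  qed
  moreover have "l a = 0"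
    using block_ball_self by (auto simp: l_def)
  moreover have "g < l b" if "b \<notin> block_ball ts g a" for b
  proof -
    have "{i. i \<le> g \<and> b \<notin> block_ball ts i a} = {..g}"
      using that by (auto dest: subsetD[OF block_ball_mono])
    then show ?thesis by (simp add: l_def)
  qed
  ultimately show thesis by (rule that)
qed

section \<open>Counting and the greedy choice of blocks\<close>

definition block_degree :: "'v list list \<Rightarrow> 'v \<Rightarrow> nat" where
  "block_degree ts x = length (filter (\<lambda>t. x \<in> set t) ts)"

lemma card_block_ball:
  assumes "\<And>x. block_degree ts x \<le> D" "\<And>t. t \<in> set ts \<Longrightarrow> length t = d"
  shows "finite (block_ball ts i x) \<and> card (block_ball ts i x) \<le> (1 + D * d) ^ i"
proof (induction i)
  case (Suc i)
  let ?B = "block_ball ts i x"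
  have nb: "finite (block_rel ts `` {y}) \<and> card (block_rel ts `` {y}) \<le> 1 + D * d" for y
  proof -
    let ?L = "filter (\<lambda>t. y \<in> set t) ts"
    have eq: "block_rel ts `` {y} = insert y (\<Union>t\<in>set ?L. set t)"
      by (auto simp: block_rel_def)
    have "card (\<Union>t\<in>set ?L. set t) \<le> (\<Sum>t\<in>set ?L. card (set t))"
      by (rule card_UN_le) simp
    also have "\<dots> \<le> (\<Sum>t\<in>set ?L. d)"
      by (rule sum_mono) (use assms(2) card_length in force)
    also have "\<dots> = card (set ?L) * d" by simp
    also have "\<dots> \<le> D * d"
      using assms(1)[of y] card_length[of ?L] by (intro mult_le_mono1) (simp add: block_degree_def)
    finally show ?thesis unfolding eq by (simp add: card_insert_if)
  qed
  have eq: "block_ball ts (Suc i) x = (\<Union>y\<in>?B. block_rel ts `` {y})"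
    by (auto simp: block_ball_Suc)
  have "card (block_ball ts (Suc i) x) \<le> (\<Sum>y\<in>?B. card (block_rel ts `` {y}))"
    unfolding eq by (rule card_UN_le) (use Suc in simp)
  also have "\<dots> \<le> (\<Sum>y\<in>?B. 1 + D * d)"
    by (rule sum_mono) (use nb in blast)
  also have "\<dots> = card ?B * (1 + D * d)" by simp
  also have "\<dots> \<le> (1 + D * d) ^ i * (1 + D * d)"
    using Suc by (intro mult_le_mono1) simp
  finally show ?case using Suc nb unfolding eq by (simp add: mult.commute)
qed simp

text \<open>Double counting of pairs of a set in \<open>\<I>\<close> and one of its points outside
  \<open>Z\<close>: there are at least \<open>r * card \<I>\<close> pairs on at most
  \<open>m * r\<close> points, so some point lies in at least the fraction \<open>1 / m\<close> of
  the sets.\<close>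

lemma popular_point:
  fixes \<I> :: "'v set set"
  assumes X: "finite X" and I: "\<And>I. I \<in> \<I> \<Longrightarrow> I \<subseteq> X" "\<I> \<noteq> {}"
    and r: "0 < r" "\<And>I. I \<in> \<I> \<Longrightarrow> r \<le> card (I - Z)" and m: "card X \<le> m * r"
  obtains x where "x \<in> X - Z" "card \<I> \<le> m * card {I \<in> \<I>. x \<in> I}"
proof -
  have fin: "finite \<I>" using X I(1) by (meson PowI finite_Pow_iff finite_subset subsetI)
  have "\<exists>x \<in> X - Z. card \<I> \<le> m * card {I \<in> \<I>. x \<in> I}"
  proof (rule ccontr)
    assume "\<not> ?thesis"
    then have less: "\<And>x. x \<in> X - Z \<Longrightarrow> m * card {I \<in> \<I>. x \<in> I} < card \<I>" by force
    obtain J where J: "J \<in> \<I>" using I(2) by blast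
    have "J - Z \<noteq> {}" using r(1) r(2)[OF J] by (metis card.empty not_le)
    then have ne: "X - Z \<noteq> {}" using I(1)[OF J] by blast
    have "card \<I> * r \<le> (\<Sum>I\<in>\<I>. card (I - Z))"
      using sum_mono[of \<I> "\<lambda>_. r" "\<lambda>I. card (I - Z)"] r(2) by simp
    also have "\<dots> = (\<Sum>I\<in>\<I>. card {x \<in> X - Z. x \<in> I})"
      by (rule sum.cong, simp) (rule arg_cong[of _ _ card], use I(1) in auto)
    also have "\<dots> = (\<Sum>x\<in>X - Z. card {I \<in> \<I>. x \<in> I})"
      using sum_multicount_gen[of \<I> "X - Z" "\<lambda>I x. x \<in> I" "\<lambda>x. card {I \<in> \<I>. x \<in> I}"] fin X by simp
    finally have "m * (card \<I> * r) \<le> (\<Sum>x\<in>X - Z. m * card {I \<in> \<I>. x \<in> I})"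
      by (simp add: sum_distrib_left[symmetric])
    also have "\<dots> < (\<Sum>x\<in>X - Z. card \<I>)"
      by (rule sum_strict_mono) (use X ne less in auto)
    also have "\<dots> \<le> card X * card \<I>"
      using X by (simp add: card_mono)
    also have "\<dots> \<le> m * r * card \<I>" using m by (rule mult_le_mono1)
    finally show False by (simp add: mult_ac)
  qed
  then show thesis using that by blast
qed

text \<open>The points are chosen one at a time, each popular among the sets that contain all
  earlier ones. In the size bound, \<open>s\<close> pays for the forbidden set \<open>S\<close>,
  \<open>d * K\<close> for the balls around the earlier points, and \<open>r\<close> is left for the
  averaging; each point costs a factor \<open>m\<close>.\<close>

lemma popular_far_tuple:
  fixes \<I> :: "'v set set"
  assumes X: "finite X" and I: "\<And>I. I \<in> \<I> \<Longrightarrow> I \<subseteq> X" "\<I> \<noteq> {}"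
    and r: "0 < r" "card X \<le> m * r" "\<And>I. I \<in> \<I> \<Longrightarrow> r + s + d * K \<le> card I"
    and S: "finite S" "card S \<le> s"
    and B: "\<And>x. finite (B x) \<and> card (B x) \<le> K" "\<And>x. x \<in> B x" "\<And>x y. y \<in> B x \<Longrightarrow> x \<in> B y"
    and "j \<le> d"
  shows "\<exists>t. length t = j \<and> distinct t \<and> set t \<subseteq> X - S \<and>
           (\<forall>a\<in>set t. \<forall>b\<in>set t - {a}. b \<notin> B a) \<and> card \<I> \<le> m ^ j * card {I \<in> \<I>. set t \<subseteq> I}"
  using \<open>j \<le> d\<close>
proof (induction j)
  case (Suc j)
  then obtain t where t: "length t = j" "distinct t" "set t \<subseteq> X - S"
      "\<forall>a\<in>set t. \<forall>b\<in>set t - {a}. b \<notin> B a" "card \<I> \<le> m ^ j * card {I \<in> \<I>. set t \<subseteq> I}"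
    by auto
  let ?J = "{I \<in> \<I>. set t \<subseteq> I}" and ?Z = "S \<union> (\<Union>a\<in>set t. B a)"
  have fin: "finite \<I>" using X I(1) by (meson PowI finite_Pow_iff finite_subset subsetI)
  have "card \<I> > 0" using fin I(2) by (simp add: card_gt_0_iff)
  then have Jne: "?J \<noteq> {}" using t(5) by (metis card.empty mult_0_right not_le)
  have "card (\<Union>a\<in>set t. B a) \<le> (\<Sum>a\<in>set t. card (B a))" by (rule card_UN_le) simp
  also have "\<dots> \<le> (\<Sum>a\<in>set t. K)" by (rule sum_mono) (use B(1) in blast)
  also have "\<dots> \<le> d * K" using t(1,2) Suc.prems by (simp add: distinct_card)
  finally have "card ?Z \<le> s + d * K" using card_Un_le[of S "\<Union>a\<in>set t. B a"] S(2) by linarith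
  moreover have finZ: "finite ?Z" using S(1) B(1) by auto
  ultimately have rJ: "r \<le> card (I - ?Z)" if "I \<in> ?J" for I
    using r(3)[of I] that diff_card_le_card_Diff[OF finZ, of I] by force
  obtain x where x: "x \<in> X - ?Z" "card ?J \<le> m * card {I \<in> ?J. x \<in> I}"
    by (rule popular_point[OF X _ Jne r(1) rJ r(2)]) (use I(1) in auto)
  have sub: "{I \<in> ?J. x \<in> I} = {I \<in> \<I>. set (x # t) \<subseteq> I}" by auto
  have "card \<I> \<le> m ^ j * (m * card {I \<in> \<I>. set (x # t) \<subseteq> I})"
    using t(5) x(2) unfolding sub by (meson le_trans mult_le_mono2)
  moreover have "x \<notin> set t" using x B(2) by blast
  moreover have "\<forall>a\<in>set (x # t). \<forall>b\<in>set (x # t) - {a}. b \<notin> B a"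
    using t(4) x(1) B(3) by auto
  ultimately show ?case
    using t x by (intro exI[of _ "x # t"]) (auto simp: mult_ac)
qed (use I X in auto)

text \<open>By Bernoulli's inequality \<open>(1 + 1 / C) ^ (C + 1)\<close> exceeds 2. Hence
  \<open>C + 1\<close> successive losses of the fraction \<open>1 / (C + 1)\<close> leave less than
  half of a family.\<close>

lemma power_decay: "2 * C ^ (Suc C) < (Suc C) ^ (Suc C)" if "0 < C" for C :: nat
proof -
  have "real C ^ Suc C * 2 < (real C + 1) ^ Suc C"
  proof -
    have "1 + real (Suc C) * (1 / real C) \<le> (1 + 1 / real C) ^ Suc C"
      by (rule Bernoulli_inequality) (simp add: le_divide_eq that)
    moreover have "2 < 1 + real (Suc C) * (1 / real C)"
      using that by (simp add: field_simps)
    ultimately have "2 < (1 + 1 / real C) ^ Suc C" by linarith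
    moreover have "1 + 1 / real C = (real C + 1) / real C"
      using that by (simp add: field_simps)
    ultimately have "2 < ((real C + 1) / real C) ^ Suc C" by simp
    then show ?thesis
      using that by (simp add: power_divide field_simps del: power_Suc)
  qed
  then have "real (2 * C ^ Suc C) < real (Suc C ^ Suc C)" by (simp add: algebra_simps)
  then show ?thesis by (simp only: of_nat_less_iff)
qed

lemma sum_block_degree:
  assumes "finite X" "\<And>t. t \<in> set ts \<Longrightarrow> length t = d"
  shows "(\<Sum>x\<in>X. block_degree ts x) \<le> d * length ts"
  using assms(2)
proof (induction ts)
  case (Cons t ts)
  have "(\<Sum>x\<in>X. block_degree (t # ts) x) = (\<Sum>x\<in>X. block_degree ts x + (if x \<in> set t then 1 else 0))"
    by (rule sum.cong) (auto simp: block_degree_def)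
  also have "\<dots> = (\<Sum>x\<in>X. block_degree ts x) + card (X \<inter> set t)"
    using assms(1) by (simp add: sum.distrib sum.If_cases)
  also have "card (X \<inter> set t) \<le> d"
    using Cons.prems[of t] card_mono[of "set t" "X \<inter> set t"] card_length[of t] by auto
  finally show ?case using Cons by simp
qed (simp add: block_degree_def)

text \<open>A greedy derandomisation: every new block is contained in a fixed proportion of the large
  sets that contain no block so far, and far apart, unsaturated blocks suffice for this.\<close>

lemma sparse_blocks_exist:
  fixes d g q :: nat
  assumes d: "1 \<le> d" and q: "1 \<le> q"
  shows "\<exists>N (ts :: nat list list). sparse_blocks g d {..<N} ts \<and>
    (\<forall>c. c ` {..<N} \<subseteq> {1..q} \<longrightarrow> (\<exists>t\<in>set ts. \<exists>i. \<forall>x\<in>set t. c x = i))"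
proof -
  \<comment> \<open>Some colour class has at least \<open>N / q = 2 * p\<close> points. Of so many
    points at most \<open>p\<close> are saturated and at most \<open>d * K\<close> lie in balls
    around earlier points of the new block, so at least \<open>d * K\<close> remain. As
    \<open>N = 4 * q * (d * K)\<close>, each point of a block costs a factor \<open>4 * q\<close>,
    and a block costs \<open>C\<close>. With at most \<open>C * N\<close> blocks, the degree
    \<open>D\<close> is reached by at most \<open>d * C * N / D = p\<close> points.\<close>
  define C where "C = (4 * q) ^ d"
  define D where "D = 2 * q * d * C"
  define K where "K = (1 + D * d) ^ g"
  define p where "p = 2 * d * K"
  define N where "N = 2 * q * p"
  have K: "1 \<le> K" by (simp add: K_def)
  have C4: "4 \<le> C" unfolding C_def
    using d q power_increasing[of 1 d "4 * q"] by simp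
  have D0: "0 < D" using d q C4 by (simp add: D_def)
  have p0: "0 < p" using d K by (simp add: p_def)
  define indep where "indep ts = {I. I \<subseteq> {..<N} \<and> 2 * p \<le> card I \<and> (\<forall>t\<in>set ts. \<not> set t \<subseteq> I)}"
    for ts :: "nat list list"
  have finind: "finite (indep ts)" for ts
    by (rule finite_subset[of _ "Pow {..<N}"]) (auto simp: indep_def)
  \<comment> \<open>With denominators cleared, the bound is \<open>2 ^ N * (1 - 1 / C) ^ n\<close>
    after \<open>n\<close> blocks. The process may stop early, once no large block-free set is left
    to guide the choice of a block.\<close>
  have main: "\<exists>ts. sparse_blocks g d {..<N} ts \<and> (\<forall>t\<in>set ts. length t = d) \<and> (\<forall>x. block_degree ts x \<le> D) \<and>
      (indep ts = {} \<or> length ts = n \<and> card (indep ts) * C ^ n \<le> 2 ^ N * (C - 1) ^ n)"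
    if "n \<le> C * N" for n
    using that
  proof (induction n)
    case 0
    have "card (indep []) \<le> card (Pow {..<N})"
      by (rule card_mono) (auto simp: indep_def)
    then show ?case by (intro exI[of _ "[]"]) (auto simp: block_degree_def card_Pow)
  next
    case (Suc n)
    then obtain ts where ts: "sparse_blocks g d {..<N} ts" "\<forall>t\<in>set ts. length t = d"
        "\<forall>x. block_degree ts x \<le> D"
        "indep ts = {} \<or> length ts = n \<and> card (indep ts) * C ^ n \<le> 2 ^ N * (C - 1) ^ n"
      by auto
    show ?case
    proof (cases "indep ts = {}")
      case True
      then show ?thesis using ts by blast
    next
      case False
      then have len: "length ts = n" and bd: "card (indep ts) * C ^ n \<le> 2 ^ N * (C - 1) ^ n"
        using ts(4) by auto
      define S where "S = {x \<in> {..<N}. D \<le> block_degree ts x}"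
      have "card S * D \<le> (\<Sum>x\<in>S. block_degree ts x)"
        using sum_mono[of S "\<lambda>_. D" "block_degree ts"] by (simp add: S_def)
      also have "\<dots> \<le> d * n"
        using sum_block_degree[of S ts d] ts(2) len by (simp add: S_def)
      also have "\<dots> \<le> d * (C * N)" using Suc.prems by simp
      also have "\<dots> = p * D" by (simp add: N_def D_def)
      finally have Sp: "card S \<le> p" using D0 by simp
      have "\<exists>t. length t = d \<and> distinct t \<and> set t \<subseteq> {..<N} - S \<and>
           (\<forall>a\<in>set t. \<forall>b\<in>set t - {a}. b \<notin> block_ball ts g a) \<and>
           card (indep ts) \<le> (4 * q) ^ d * card {I \<in> indep ts. set t \<subseteq> I}"
      proof (rule popular_far_tuple[where r = "d * K" and s = p and d = d and K = K])
        show "card {..<N} \<le> 4 * q * (d * K)" by (simp add: N_def p_def)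
        show "d * K + p + d * K \<le> card I" if "I \<in> indep ts" for I
        proof -
          have "d * K + p + d * K = 2 * p" by (simp add: p_def)
          then show ?thesis using that by (simp add: indep_def)
        qed
        show "finite (block_ball ts g x) \<and> card (block_ball ts g x) \<le> K" for x
          unfolding K_def by (rule card_block_ball) (use ts in auto)
      qed (use False d K Sp in \<open>auto simp: indep_def S_def block_ball_self block_ball_sym\<close>)
      then obtain t where t: "length t = d" "distinct t" "set t \<subseteq> {..<N} - S"
          "\<forall>a\<in>set t. \<forall>b\<in>set t - {a}. b \<notin> block_ball ts g a"
          "card (indep ts) \<le> C * card {I \<in> indep ts. set t \<subseteq> I}"
        unfolding C_def by blast
      have "sparse_blocks g d {..<N} (t # ts)"
      proof -
        have "\<exists>l. lipschitz_on_blocks ts l \<and> l a = 0 \<and> (\<forall>b\<in>set t - {a}. g < l b)" if "a \<in> set t" for a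
        proof -
          obtain l where "lipschitz_on_blocks ts l" "l a = 0" "\<And>b. b \<notin> block_ball ts g a \<Longrightarrow> g < l b"
            by (rule lipschitz_distance[of ts a g]) blast
          then show ?thesis using t(4) that by (intro exI[of _ l]) simp
        qed
        then show ?thesis using ts(1) t(1-3) by auto
      qed
      moreover have "block_degree (t # ts) x \<le> D" for x
        using ts(3) t(3) by (auto simp: block_degree_def S_def Suc_le_eq not_le subset_iff)
      moreover have "card (indep (t # ts)) * C ^ Suc n \<le> 2 ^ N * (C - 1) ^ Suc n"
      proof -
        let ?J = "{I \<in> indep ts. set t \<subseteq> I}"
        have "indep (t # ts) = indep ts - ?J" by (auto simp: indep_def)
        then have "card (indep (t # ts)) = card (indep ts) - card ?J"
          using finind[of ts] by (simp add: card_Diff_subset)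
        then have "card (indep (t # ts)) * C \<le> card (indep ts) * (C - 1)"
          using t(5) by (simp add: algebra_simps diff_mult_distrib diff_mult_distrib2)
        then have "card (indep (t # ts)) * C * C ^ n \<le> card (indep ts) * (C - 1) * C ^ n"
          by (rule mult_le_mono1)
        also have "\<dots> = card (indep ts) * C ^ n * (C - 1)" by simp
        also have "\<dots> \<le> 2 ^ N * (C - 1) ^ n * (C - 1)" using bd by (rule mult_le_mono1)
        finally show ?thesis by (simp add: mult_ac)
      qed
      ultimately show ?thesis using ts(2) t(1) len by (intro exI[of _ "t # ts"]) auto
    qed
  qed
  obtain ts where ts: "sparse_blocks g d {..<N} ts"
      "indep ts = {} \<or> card (indep ts) * C ^ (C * N) \<le> 2 ^ N * (C - 1) ^ (C * N)"
    using main[of "C * N"] by auto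
  have "indep ts = {}"
  proof (rule ccontr)
    assume ne: "indep ts \<noteq> {}"
    then have "1 \<le> card (indep ts)" using finind by (simp add: Suc_le_eq card_gt_0_iff)
    then have "C ^ (C * N) \<le> card (indep ts) * C ^ (C * N)" by simp
    also have "\<dots> \<le> 2 ^ N * (C - 1) ^ (C * N)" using ts(2) ne by simp
    also have "\<dots> = (2 * (C - 1) ^ C) ^ N" by (simp add: power_mult power_mult_distrib)
    also have "\<dots> < (C ^ C) ^ N"
    proof (rule power_strict_mono)
      show "2 * (C - 1) ^ C < C ^ C"
        using power_decay[of "C - 1"] C4 by simp
      show "0 < N" using p0 q by (simp add: N_def)
    qed simp
    also have "\<dots> = C ^ (C * N)" by (simp add: power_mult)
    finally show False by simp
  qed
  moreover have "\<exists>t\<in>set ts. \<exists>i. \<forall>x\<in>set t. c x = i" if c: "c ` {..<N} \<subseteq> {1..q}" "indep ts = {}" for c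
  proof -
    have "\<exists>i\<in>{1..q}. 2 * p \<le> card {x \<in> {..<N}. c x = i}"
    proof (rule ccontr)
      assume "\<not> ?thesis"
      then have lt: "\<And>i. i \<in> {1..q} \<Longrightarrow> card {x \<in> {..<N}. c x = i} < 2 * p" by force
      have "N = card (\<Union>i\<in>{1..q}. {x \<in> {..<N}. c x = i})"
      proof -
        have "(\<Union>i\<in>{1..q}. {x \<in> {..<N}. c x = i}) = {..<N}" using c(1) by auto
        then show ?thesis by simp
      qed
      also have "\<dots> \<le> (\<Sum>i\<in>{1..q}. card {x \<in> {..<N}. c x = i})" by (rule card_UN_le) simp
      also have "\<dots> < (\<Sum>i\<in>{1..q}. 2 * p)" by (rule sum_strict_mono) (use lt q in auto)
      also have "\<dots> = N" by (simp add: N_def)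
      finally show False by simp
    qed
    then obtain i where i: "2 * p \<le> card {x \<in> {..<N}. c x = i}" by blast
    have "{x \<in> {..<N}. c x = i} \<notin> indep ts" using c(2) by simp
    then obtain t where "t \<in> set ts" "set t \<subseteq> {x \<in> {..<N}. c x = i}"
      using i by (auto simp: indep_def)
    then show ?thesis by blast
  qed
  ultimately show ?thesis using ts(1) by blast
qed

section \<open>Colourings without a monochromatic copy, and gluing\<close>

text \<open>A graph is reduced to its edge set, with vertex set \<open>\<Union>E\<close>. Copies of
  \<open>H\<close> are not affected, since every vertex of \<open>H\<close> lies on an edge.\<close>

definition edge_graph :: "'v set set \<Rightarrow> bool" where
  "edge_graph E \<longleftrightarrow> finite E \<and> (\<forall>e \<in> E. card e = 2)"

lemma edge_graph_mono: "edge_graph E \<Longrightarrow> D \<subseteq> E \<Longrightarrow> edge_graph D"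
  by (auto simp: edge_graph_def intro: finite_subset)

lemma edge_graph_Un: "edge_graph E \<Longrightarrow> edge_graph D \<Longrightarrow> edge_graph (E \<union> D)"
  by (auto simp: edge_graph_def)

lemma finite_Union_edge_graph: "edge_graph E \<Longrightarrow> finite (\<Union>E)"
  by (rule finite_Union) (auto simp: edge_graph_def intro: card_ge_0_finite)

lemma edge_graphD:
  assumes "edge_graph E" "e \<in> E"
  obtains x y where "e = {x, y}" "x \<noteq> y"
  using assms by (auto simp: edge_graph_def card_2_iff)

lemma edge_graph_image:
  assumes "edge_graph E" "inj_on f (\<Union>E)"
  shows "edge_graph ((`) f ` E)"
proof -
  have "card (f ` e) = 2" if "e \<in> E" for e
  proof -
    have "inj_on f e"
      using assms(2) that by (meson Union_upper inj_on_subset)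
    then show ?thesis
      using assms(1) that by (simp add: card_image edge_graph_def)
  qed
  then show ?thesis
    using assms(1) by (auto simp: edge_graph_def)
qed

text \<open>This prepares the gluings: terminals go to prescribed numbers and all other vertices to
  numbers outside \<open>A\<close>, so that nothing but terminals is identified with vertices in
  \<open>A\<close>.\<close>

lemma fresh_extension:
  fixes as :: "'v list" and bs :: "nat list"
  assumes "finite V" "finite A" "distinct as" "distinct bs" "length as = length bs" "set as \<subseteq> V"
  obtains f where "inj_on f V" "map f as = bs" "f ` (V - set as) \<inter> A = {}"
proof -
  obtain g :: "'v \<Rightarrow> nat" where g: "inj_on g V"
    using finite_imp_inj_to_nat_seg[OF assms(1)] by blast
  define M where "M = Suc (Max (insert 0 (A \<union> set bs)))"
  have M: "x < M" if "x \<in> A \<union> set bs" for x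
    using that assms(2) by (simp add: M_def less_Suc_eq_le)
  define f where "f v = (if v \<in> set as then the (map_of (zip as bs) v) else M + g v)" for v
  have nth: "f (as ! i) = bs ! i" if "i < length as" for i
    using that assms(3,5) by (simp add: f_def map_of_zip_nth)
  have mp: "map f as = bs" using nth assms(5) by (intro nth_equalityI) auto
  then have img: "f ` set as = set bs" by (metis set_map)
  have "inj_on f (set as)"
    using mp assms(3,4) by (metis distinct_map)
  moreover have "inj_on f (V - set as)"
    using g by (auto simp: f_def inj_on_def)
  moreover have "f ` (set as) \<inter> f ` (V - set as) = {}"
    using img M by (force simp: f_def)
  ultimately have "inj_on f (set as \<union> (V - set as))"
    unfolding inj_on_Un using assms(6) by blast
  then have "inj_on f V" using assms(6) by (simp add: Un_absorb1)
  moreover have "f ` (V - set as) \<inter> A = {}" using M by (force simp: f_def)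
  ultimately show thesis using that mp by blast
qed

lemma relabel_two:
  fixes a b c d :: nat
  assumes "a \<noteq> b" "c \<noteq> d" "{a, b, c, d} \<subseteq> S"
  obtains \<pi> where "inj_on \<pi> S" "\<pi> ` S \<subseteq> S" "\<pi> a = c" "\<pi> b = d"
proof
  let ?s = "transpose a c"
  \<comment> \<open>\<open>?s\<close> sends \<open>a\<close> to \<open>c\<close>. The second
    transposition leaves \<open>c\<close> in place, since both \<open>?s b\<close> and
    \<open>d\<close> differ from \<open>c\<close>.\<close>
  let ?\<pi> = "transpose (?s b) d \<circ> ?s"
  show "inj_on ?\<pi> S"
    by (rule inj_on_subset[OF bij_is_inj]) (auto intro: bij_comp)
  show "?\<pi> ` S \<subseteq> S" using assms by (auto simp: transpose_def)
  show "?\<pi> a = c" "?\<pi> b = d" using assms by (auto simp: transpose_def)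
qed

text \<open>A level function of this kind certifies distances after deletion of \<open>U\<close>,
  which will be the centre of a star or empty. Edges are unordered, so the inequality bounds the
  change in both directions.\<close>

definition lipschitz_off :: "'v set \<Rightarrow> 'v set set \<Rightarrow> ('v \<Rightarrow> nat) \<Rightarrow> bool" where
  "lipschitz_off U E l \<longleftrightarrow> (\<forall>x y. {x, y} \<in> E \<longrightarrow> x \<notin> U \<longrightarrow> y \<notin> U \<longrightarrow> l y \<le> l x + 1)"

lemma lipschitz_off_image:
  assumes C: "edge_graph C" and l: "lipschitz_off {} C l" and eq: "\<And>w. w \<in> \<Union>C \<Longrightarrow> l' (f w) = l w"
  shows "lipschitz_off {} ((`) f ` C) l'"
  unfolding lipschitz_off_def
proof (intro allI impI)
  fix v w assume "{v, w} \<in> (`) f ` C"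
  then obtain x where x: "x \<in> C" "{v, w} = f ` x" by blast
  obtain v' w' where x': "x = {v', w'}" using edge_graphD[OF C x(1)] by metis
  have C': "{v', w'} \<in> C" "{w', v'} \<in> C" "v' \<in> \<Union>C" "w' \<in> \<Union>C"
    using x(1) x' by (auto simp: insert_commute)
  have "l w' \<le> l v' + 1" "l v' \<le> l w' + 1" using l C' unfolding lipschitz_off_def by blast+
  moreover have "(v = f v' \<and> w = f w') \<or> (v = f w' \<and> w = f v')"
    using x(2) x' by (auto simp: doubleton_eq_iff)
  ultimately show "l' w \<le> l' v + 1" using eq[OF C'(3)] eq[OF C'(4)] by auto
qed

lemma lipschitz_off_cong:
  assumes "lipschitz_off {} E l" "\<And>v. v \<in> \<Union>E \<Longrightarrow> l' v = l v"
  shows "lipschitz_off {} E l'"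
  unfolding lipschitz_off_def
proof (intro allI impI)
  fix x y assume xy: "{x, y} \<in> E"
  then have "x \<in> \<Union>E" "y \<in> \<Union>E" by blast+
  then show "l' y \<le> l' x + 1" using assms xy unfolding lipschitz_off_def by simp
qed

lemma lipschitz_off_Un: "lipschitz_off U E l \<Longrightarrow> lipschitz_off U D l \<Longrightarrow> lipschitz_off U (E \<union> D) l"
  unfolding lipschitz_off_def by blast

text \<open>A separator is described by two overlapping sides \<open>X\<close> and \<open>Y\<close>.
  In this form a complete graph qualifies, because a vertex of \<open>X - Y\<close> and one of
  \<open>Y - X\<close> would span an edge inside neither side; \<open>K3\<close> and 3-connected
  graphs are thus treated alike.\<close>

locale two_cut_free =
  fixes HV :: "'a set" and HE :: "'a set set" and q :: nat
  assumes finite_HV: "finite HV"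
    and card_HV: "3 \<le> card HV"
    and HE_edges: "\<And>e. e \<in> HE \<Longrightarrow> e \<subseteq> HV \<and> card e = 2"
    and no_small_cut: "\<And>X Y. \<lbrakk>X \<union> Y = HV; \<forall>e\<in>HE. e \<subseteq> X \<or> e \<subseteq> Y; card (X \<inter> Y) \<le> 2\<rbrakk>
                         \<Longrightarrow> X \<subseteq> Y \<or> Y \<subseteq> X"
    and q_ge_2: "2 \<le> q"
begin

abbreviation "h \<equiv> card HV"

definition copy :: "('a \<Rightarrow> 'v) \<Rightarrow> 'v set set \<Rightarrow> bool" where
  "copy \<phi> E \<longleftrightarrow> inj_on \<phi> HV \<and> (\<forall>e\<in>HE. \<phi> ` e \<in> E)"

definition valid :: "'v set set \<Rightarrow> ('v set \<Rightarrow> nat) \<Rightarrow> bool" where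
  "valid E c \<longleftrightarrow> c ` E \<subseteq> {1..q} \<and>
     (\<forall>\<phi>. copy \<phi> E \<longrightarrow> \<not> (\<exists>i. \<forall>e\<in>HE. c (\<phi> ` e) = i))"

definition colourable :: "'v set set \<Rightarrow> bool" where
  "colourable E \<longleftrightarrow> (\<exists>c. valid E c)"

lemma finite_HE: "finite HE"
  using finite_HV HE_edges by (meson PowI finite_Pow_iff finite_subset subsetI)

text \<open>The neighbours of \<open>p\<close> separate it from all vertices not adjacent to it.
  With at most one neighbour this is a forbidden cut unless \<open>H\<close> has at most two
  vertices.\<close>

lemma two_neighbours:
  assumes "p \<in> HV"
  obtains x y where "x \<noteq> y" "{p, x} \<in> HE" "{p, y} \<in> HE"
proof -
  define N where "N = {x. {p, x} \<in> HE}"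
  have N: "N \<subseteq> HV" "p \<notin> N"
    using HE_edges by (auto simp: N_def) force
  then have finN: "finite N"
    using finite_HV finite_subset by blast
  have "\<not> card N \<le> 1"
  proof
    assume le: "card N \<le> 1"
    have ed: "\<forall>e\<in>HE. e \<subseteq> insert p N \<or> e \<subseteq> HV - {p}"
    proof
      fix e assume e: "e \<in> HE"
      then obtain a b where ab: "e = {a, b}" "a \<noteq> b"
        using HE_edges by (meson card_2_iff)
      show "e \<subseteq> insert p N \<or> e \<subseteq> HV - {p}"
        using e ab HE_edges[OF e] by (auto simp: N_def insert_commute)
    qed
    have "insert p N \<inter> (HV - {p}) = N" using N by auto
    moreover have "insert p N \<union> (HV - {p}) = HV" using N assms by auto
    ultimately have "insert p N \<subseteq> HV - {p} \<or> HV - {p} \<subseteq> insert p N"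
      using no_small_cut[OF _ ed] le by simp
    then have "HV \<subseteq> insert p N" by auto
    then have "card HV \<le> card (insert p N)"
      using finN by (simp add: card_mono)
    also have "\<dots> \<le> 2" using le finN by (simp add: card_insert_if)
    finally show False using card_HV by simp
  qed
  then obtain x y where "x \<in> N" "y \<in> N" "x \<noteq> y"
    by (metis card_le_Suc0_iff_eq finN One_nat_def)
  then show thesis using that by (auto simp: N_def)
qed

lemma in_some_edge:
  assumes "p \<in> HV" obtains e where "e \<in> HE" "p \<in> e"
  using two_neighbours[OF assms] by (metis insertI1)

lemma HE_nonempty: "HE \<noteq> {}"
proof -
  have "HV \<noteq> {}" using card_HV by auto
  then show ?thesis using in_some_edge by blast
qed

lemma HV_eq: "HV = \<Union>HE"
  using in_some_edge HE_edges by blast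

text \<open>A clause made from a copy of \<open>H\<close> needs three distinct edges, two for its
  inputs and at least one for its output.\<close>

lemma card_HE_ge_3: "3 \<le> card HE"
proof -
  obtain p where p: "p \<in> HV" using card_HV by fastforce
  then obtain x y where xy: "x \<noteq> y" "{p, x} \<in> HE" "{p, y} \<in> HE"
    by (rule two_neighbours)
  have nex: "p \<noteq> x" "p \<noteq> y" "x \<in> HV"
    using HE_edges[OF xy(2)] HE_edges[OF xy(3)] by auto
  obtain z where z: "{x, z} \<in> HE" "z \<noteq> p"
    using two_neighbours[OF nex(3)] by metis
  have d: "{p, x} \<noteq> {p, y}" "{p, x} \<noteq> {x, z}" "{p, y} \<noteq> {x, z}"
    using xy z nex by (auto simp: doubleton_eq_iff)
  have "card {{p, x}, {p, y}, {x, z}} = 3"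
    using d by simp
  moreover have "card {{p, x}, {p, y}, {x, z}} \<le> card HE"
    by (rule card_mono) (use finite_HE xy z in auto)
  ultimately show ?thesis by simp
qed

section \<open>Copies of \<open>H\<close> and valid colourings under relabelling\<close>

lemma copy_mono: "copy \<phi> E \<Longrightarrow> E \<subseteq> E' \<Longrightarrow> copy \<phi> E'"
  by (auto simp: copy_def)

lemma copy_vertices: "copy \<phi> E \<Longrightarrow> \<phi> ` HV \<subseteq> \<Union>E"
  unfolding copy_def by (metis UnionI image_eqI image_subsetI in_some_edge)

lemma valid_range: "valid E c \<Longrightarrow> e \<in> E \<Longrightarrow> c e \<in> {1..q}"
  by (auto simp: valid_def)

lemma valid_mono: "valid E c \<Longrightarrow> D \<subseteq> E \<Longrightarrow> valid D c"
  unfolding valid_def by (meson copy_mono image_mono order_trans)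

lemma colourable_mono: "colourable E \<Longrightarrow> D \<subseteq> E \<Longrightarrow> colourable D"
  unfolding colourable_def using valid_mono by blast

lemma valid_cong:
  assumes "valid E c" "\<And>e. e \<in> E \<Longrightarrow> d e = c e"
  shows "valid E d"
proof -
  have "\<not> (\<exists>i. \<forall>e\<in>HE. d (\<phi> ` e) = i)" if "copy \<phi> E" for \<phi>
  proof -
    have "\<forall>e\<in>HE. d (\<phi> ` e) = c (\<phi> ` e)" using that assms(2) by (auto simp: copy_def)
    then show ?thesis using assms(1) that unfolding valid_def by metis
  qed
  moreover have "d ` E \<subseteq> {1..q}" using assms by (auto simp: valid_def)
  ultimately show ?thesis unfolding valid_def by blast
qed

lemma valid_permute:
  assumes "valid E c" "inj_on \<pi> {1..q}" "\<pi> ` {1..q} \<subseteq> {1..q}"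
  shows "valid E (\<pi> \<circ> c)"
proof -
  have "\<not> (\<exists>i. \<forall>e\<in>HE. (\<pi> \<circ> c) (\<phi> ` e) = i)" if cp: "copy \<phi> E" for \<phi>
  proof
    assume "\<exists>i. \<forall>e\<in>HE. (\<pi> \<circ> c) (\<phi> ` e) = i"
    then obtain i where i: "\<forall>e\<in>HE. \<pi> (c (\<phi> ` e)) = i" by auto
    have "\<forall>e\<in>HE. c (\<phi> ` e) \<in> {1..q}"
      using cp valid_range[OF assms(1)] by (auto simp: copy_def)
    then have "\<forall>e\<in>HE. \<forall>e'\<in>HE. c (\<phi> ` e) = c (\<phi> ` e')"
      using i assms(2) by (metis inj_onD)
    then have "\<exists>i. \<forall>e\<in>HE. c (\<phi> ` e) = i" using HE_nonempty by blast
    then show False using assms(1) cp by (auto simp: valid_def)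
  qed
  moreover have "(\<pi> \<circ> c) ` E \<subseteq> {1..q}"
    using assms(1,3) by (auto simp: valid_def image_comp[symmetric])
  ultimately show ?thesis unfolding valid_def by blast
qed

lemma valid_image:
  assumes "inj_on f (\<Union>E)"
  shows "valid ((`) f ` E) c \<longleftrightarrow> valid E (\<lambda>e. c (f ` e))"
proof
  assume v: "valid ((`) f ` E) c"
  have "\<not> (\<exists>i. \<forall>e\<in>HE. c (f ` \<phi> ` e) = i)" if cp: "copy \<phi> E" for \<phi>
  proof -
    have "inj_on f (\<phi> ` HV)"
      using assms copy_vertices[OF cp] inj_on_subset by blast
    then have "copy (f \<circ> \<phi>) ((`) f ` E)"
      using cp by (auto simp: copy_def comp_inj_on image_comp[symmetric])
    then show ?thesis using v unfolding valid_def by (auto simp: image_comp)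
  qed
  then show "valid E (\<lambda>e. c (f ` e))"
    using v by (auto simp: valid_def)
next
  assume v: "valid E (\<lambda>e. c (f ` e))"
  define g where "g = inv_into (\<Union>E) f"
  have "\<not> (\<exists>i. \<forall>e\<in>HE. c (\<phi> ` e) = i)" if cp: "copy \<phi> ((`) f ` E)" for \<phi>
  proof -
    have im: "\<phi> ` HV \<subseteq> f ` \<Union>E" using copy_vertices[OF cp] by (simp add: image_Union)
    have gE: "g ` f ` e = e" if "e \<in> E" for e
      unfolding g_def using that assms by (meson Union_upper inv_into_image_cancel)
    have fg: "f ` g ` \<phi> ` e = \<phi> ` e" if "e \<in> HE" for e
    proof -
      have "\<phi> ` e \<in> (`) f ` E" using cp that by (auto simp: copy_def)
      then obtain x where "x \<in> E" "\<phi> ` e = f ` x" by blast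
      then show ?thesis using gE by simp
    qed
    have "inj_on g (\<phi> ` HV)"
      unfolding g_def using im by (rule inj_on_inv_into)
    moreover have "(g \<circ> \<phi>) ` e \<in> E" if "e \<in> HE" for e
    proof -
      have "\<phi> ` e \<in> (`) f ` E" using cp that by (simp add: copy_def)
      then obtain x where "x \<in> E" "\<phi> ` e = f ` x" by blast
      then show ?thesis using gE by (simp only: image_comp[symmetric])
    qed
    ultimately have "copy (g \<circ> \<phi>) E"
      using cp by (simp add: copy_def comp_inj_on)
    then have "\<not> (\<exists>i. \<forall>e\<in>HE. c (f ` (g \<circ> \<phi>) ` e) = i)"
      using v unfolding valid_def by blast
    then show ?thesis unfolding image_comp[symmetric] using fg by simp
  qed
  then show "valid ((`) f ` E) c"
    using v by (auto simp: valid_def)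
qed

lemma valid_push:
  assumes "inj_on f (\<Union>E)" "valid E c"
  obtains d where "valid ((`) f ` E) d" "\<And>e. e \<in> E \<Longrightarrow> d (f ` e) = c e"
proof -
  define d where "d = (\<lambda>e. c (inv_into (\<Union>E) f ` e))"
  have d: "d (f ` e) = c e" if "e \<in> E" for e
    unfolding d_def using that assms(1) by (simp add: Union_upper inv_into_image_cancel)
  have "valid E (\<lambda>e. d (f ` e))"
    using valid_cong[OF assms(2)] d by auto
  then show thesis using that d valid_image[OF assms(1)] by blast
qed

text \<open>Terminals are far apart if a function that changes by at most one along edges separates
  their values; a copy of \<open>H\<close> has too few vertices to occupy all levels in between, and at an
  empty level it could be cut along at most two vertices.\<close>

lemma copy_in_glued:
  fixes E1 E2 :: "'v set set" and U :: "'v set" and T :: "'i \<Rightarrow> 'v set"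
  assumes gr: "edge_graph E1" "edge_graph E2"
    and meet: "\<Union>E1 \<inter> \<Union>E2 \<subseteq> U \<union> (\<Union>i\<in>I. T i)"
    and U: "finite U" "card U \<le> 1"
    and T: "\<And>i. i \<in> I \<Longrightarrow> finite (T i) \<and> card (U \<union> T i) \<le> 2"
    and common: "\<And>i e. i \<in> I \<Longrightarrow> e \<subseteq> U \<union> T i \<Longrightarrow> e \<in> E1 \<longleftrightarrow> e \<in> E2"
    and far: "\<And>i. i \<in> I \<Longrightarrow> \<exists>l::'v \<Rightarrow> nat. (\<forall>v\<in>T i. l v = 0) \<and>
                 (\<forall>j\<in>I - {i}. \<forall>v\<in>T j. h < l v) \<and>
                 (\<forall>x y. {x, y} \<in> E2 \<longrightarrow> x \<notin> U \<longrightarrow> y \<notin> U \<longrightarrow> l y \<le> l x + 1)"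
    and cp: "copy \<phi> (E1 \<union> E2)"
  shows "copy \<phi> E1 \<or> copy \<phi> E2"
proof -
  obtain lam :: "'i \<Rightarrow> 'v \<Rightarrow> nat" where
    lam0: "\<And>i v. i \<in> I \<Longrightarrow> v \<in> T i \<Longrightarrow> lam i v = 0" and
    lamfar: "\<And>i j v. i \<in> I \<Longrightarrow> j \<in> I \<Longrightarrow> j \<noteq> i \<Longrightarrow> v \<in> T j \<Longrightarrow> h < lam i v" and
    lip: "\<And>i x y. i \<in> I \<Longrightarrow> {x, y} \<in> E2 \<Longrightarrow> x \<notin> U \<Longrightarrow> y \<notin> U \<Longrightarrow> lam i y \<le> lam i x + 1"
  proof -
    have "\<exists>l. \<forall>i\<in>I. (\<forall>v\<in>T i. l i v = 0) \<and>
                 (\<forall>j\<in>I - {i}. \<forall>v\<in>T j. h < l i v) \<and>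
                 (\<forall>x y. {x, y} \<in> E2 \<longrightarrow> x \<notin> U \<longrightarrow> y \<notin> U \<longrightarrow> l i y \<le> l i x + 1)"
      by (rule bchoice, rule ballI, rule far)
    then obtain l where l: "\<forall>i\<in>I. (\<forall>v\<in>T i. l i v = 0) \<and>
                 (\<forall>j\<in>I - {i}. \<forall>v\<in>T j. h < l i v) \<and>
                 (\<forall>x y. {x, y} \<in> E2 \<longrightarrow> x \<notin> U \<longrightarrow> y \<notin> U \<longrightarrow> l i y \<le> l i x + 1)" ..
    show thesis
      by (rule that[of l]) (use l in simp_all)
  qed
  have inj: "inj_on \<phi> HV" and ed: "\<And>e. e \<in> HE \<Longrightarrow> \<phi> ` e \<in> E1 \<union> E2"
    using cp by (auto simp: copy_def)
  have all1: "copy \<phi> E1" if sub: "\<And>x y. {x, y} \<in> E2 \<Longrightarrow> {x, y} \<subseteq> \<phi> ` HV \<Longrightarrow> x \<noteq> y \<Longrightarrow> {x, y} \<in> E1"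
  proof -
    have "\<phi> ` e \<in> E1" if e: "e \<in> HE" for e
    proof (cases "\<phi> ` e \<in> E1")
      case False
      then have "\<phi> ` e \<in> E2" using ed[OF e] by auto
      then obtain x y where "\<phi> ` e = {x, y}" "x \<noteq> y" using gr(2) by (meson edge_graphD)
      then show ?thesis
        using \<open>\<phi> ` e \<in> E2\<close> e HE_edges sub by (metis image_mono)
    qed
    then show ?thesis using inj by (auto simp: copy_def)
  qed
  have all2: "copy \<phi> E2" if sub: "\<And>x y. {x, y} \<in> E1 \<Longrightarrow> {x, y} \<subseteq> \<phi> ` HV \<Longrightarrow> x \<noteq> y \<Longrightarrow> {x, y} \<in> E2"
  proof -
    have "\<phi> ` e \<in> E2" if e: "e \<in> HE" for e
    proof (cases "\<phi> ` e \<in> E2")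
      case False
      then have "\<phi> ` e \<in> E1" using ed[OF e] by auto
      then obtain x y where "\<phi> ` e = {x, y}" "x \<noteq> y" using gr(1) by (meson edge_graphD)
      then show ?thesis
        using \<open>\<phi> ` e \<in> E1\<close> e HE_edges sub by (metis image_mono)
    qed
    then show ?thesis using inj by (auto simp: copy_def)
  qed
  \<comment> \<open>The absence of small separators in \<open>H\<close> is transported along
    \<open>\<phi>\<close>: two sets that cover the copy, split its edges and overlap in at most two
    vertices must be nested on the copy.\<close>
  have cut: "(\<forall>p\<in>HV. \<phi> p \<in> A \<longrightarrow> \<phi> p \<in> B) \<or> (\<forall>p\<in>HV. \<phi> p \<in> B \<longrightarrow> \<phi> p \<in> A)"
    if cov: "\<And>p. p \<in> HV \<Longrightarrow> \<phi> p \<in> A \<or> \<phi> p \<in> B"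
      and e: "\<And>x y. {x, y} \<in> E1 \<union> E2 \<Longrightarrow> {x, y} \<subseteq> \<phi> ` HV \<Longrightarrow> x \<noteq> y \<Longrightarrow> {x, y} \<subseteq> A \<or> {x, y} \<subseteq> B"
      and sm: "A \<inter> B \<subseteq> C" "finite C" "card C \<le> 2" for A B C
  proof -
    let ?X = "{p\<in>HV. \<phi> p \<in> A}" and ?Y = "{p\<in>HV. \<phi> p \<in> B}"
    have "card (?X \<inter> ?Y) \<le> card C"
      by (rule card_inj_on_le[of \<phi>]) (use inj sm in \<open>auto simp: inj_on_def\<close>)
    moreover have "?X \<union> ?Y = HV" using cov by auto
    moreover have "\<forall>e\<in>HE. e \<subseteq> ?X \<or> e \<subseteq> ?Y"
    proof
      fix e0 assume e0: "e0 \<in> HE"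
      have sub: "e0 \<subseteq> HV" using HE_edges[OF e0] by simp
      have eg: "\<phi> ` e0 \<in> E1 \<union> E2" using ed[OF e0] .
      obtain x y where xy: "\<phi> ` e0 = {x, y}" "x \<noteq> y"
        using eg gr by (meson edge_graphD edge_graph_Un)
      have "{x, y} \<subseteq> \<phi> ` HV" using xy sub by (metis image_mono)
      then have "\<phi> ` e0 \<subseteq> A \<or> \<phi> ` e0 \<subseteq> B" using e[of x y] xy eg by simp
      then show "e0 \<subseteq> ?X \<or> e0 \<subseteq> ?Y" using sub by blast
    qed
    ultimately have "?X \<subseteq> ?Y \<or> ?Y \<subseteq> ?X"
      using no_small_cut[of ?X ?Y] sm(3) by linarith
    then show ?thesis by blast
  qed
  show ?thesis
  proof (cases "\<exists>i\<in>I. \<forall>k\<in>{1..h}. \<exists>p\<in>HV. \<phi> p \<in> \<Union>E2 - U \<and> lam i (\<phi> p) = k")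
    case True
    then obtain i where i: "i \<in> I"
      and ex: "\<forall>k\<in>{1..h}. \<exists>p\<in>HV. \<phi> p \<in> \<Union>E2 - U \<and> lam i (\<phi> p) = k" by blast
    \<comment> \<open>All \<open>h\<close> levels are occupied, and there are only \<open>h\<close>
      vertices, so the whole copy lies strictly between the terminals. Vertices shared with
      \<open>E1\<close> have level 0 or above \<open>h\<close>, or lie in \<open>U\<close>; hence
      the copy avoids \<open>E1\<close>.\<close>
    define P where "P = {p\<in>HV. \<phi> p \<in> \<Union>E2 - U \<and> lam i (\<phi> p) \<in> {1..h}}"
    have "{1..h} \<subseteq> (\<lambda>p. lam i (\<phi> p)) ` P"
      using ex by (fastforce simp: P_def)
    then have "h \<le> card P"
      using surj_card_le[of P "{1..h}"] finite_HV by (simp add: P_def)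
    moreover have "P \<subseteq> HV" by (auto simp: P_def)
    ultimately have PH: "P = HV"
      using finite_HV by (simp add: card_seteq)
    have notV1: "\<phi> p \<notin> \<Union>E1" if "p \<in> HV" for p
    proof
      assume "\<phi> p \<in> \<Union>E1"
      have pP: "\<phi> p \<in> \<Union>E2 - U" "lam i (\<phi> p) \<in> {1..h}" using that PH by (auto simp: P_def)
      then obtain j where j: "j \<in> I" "\<phi> p \<in> T j" using meet \<open>\<phi> p \<in> \<Union>E1\<close> by blast
      show False
      proof (cases "j = i")
        case True then show False using lam0 j pP by force
      next
        case False then show False using lamfar[OF i j(1) False j(2)] pP by simp
      qed
    qed
    have "copy \<phi> E2"
    proof (rule all2)
      fix x y assume xy: "{x, y} \<in> E1" "{x, y} \<subseteq> \<phi> ` HV"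
      then obtain p where "p \<in> HV" "\<phi> p = x" by blast
      then show "{x, y} \<in> E2" using notV1 xy(1) by blast
    qed
    then show ?thesis ..
  next
    case False
    then have "\<forall>i\<in>I. \<exists>k\<in>{1..h}. \<forall>p\<in>HV. \<phi> p \<in> \<Union>E2 - U \<longrightarrow> lam i (\<phi> p) \<noteq> k" by blast
    then obtain k where k: "\<And>i. i \<in> I \<Longrightarrow> k i \<in> {1..h}"
      and miss: "\<And>i p. i \<in> I \<Longrightarrow> p \<in> HV \<Longrightarrow> \<phi> p \<in> \<Union>E2 - U \<Longrightarrow> lam i (\<phi> p) \<noteq> k i" by metis
    \<comment> \<open>\<open>k i\<close> is a level that the copy misses. Within \<open>E2\<close>
      and outside \<open>U\<close>, the copy therefore has no edge leaving the part below it, where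
      the only vertices shared with \<open>E1\<close> are those of \<open>T i\<close>.\<close>
    define low where "low i = {v \<in> \<Union>E2 - U. lam i v < k i}" for i
    have low_step: "y \<in> low i" if "i \<in> I" "x \<in> low i" "{x, y} \<in> E2" "{x, y} \<subseteq> \<phi> ` HV" "y \<notin> U" for i x y
    proof -
      have "lam i y \<le> lam i x + 1" using lip that by (auto simp: low_def)
      moreover have "lam i y \<noteq> k i"
      proof -
        have "y \<in> \<phi> ` HV" "y \<in> \<Union>E2 - U" using that by auto
        then show ?thesis using miss[OF that(1)] by blast
      qed
      ultimately show ?thesis using that by (auto simp: low_def)
    qed
    have low_T: "x \<in> T i" if "i \<in> I" "x \<in> low i" "x \<in> \<Union>E1" for i x
    proof -
      have "x \<in> \<Union>E1 \<inter> \<Union>E2" "x \<notin> U" using that by (auto simp: low_def)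
      then obtain j where j: "j \<in> I" "x \<in> T j" using meet by blast
      have "j = i"
      proof (rule ccontr)
        assume "j \<noteq> i"
        then have "h < lam i x" using lamfar that(1) j by blast
        then show False using that k[OF that(1)] by (auto simp: low_def)
      qed
      then show ?thesis using j by simp
    qed
    have T_low: "x \<in> low i" if "i \<in> I" "x \<in> T i" "x \<in> \<Union>E2" "x \<notin> U" for i x
      using that k[of i] lam0[of i x] by (auto simp: low_def)
    \<comment> \<open>The cut is along \<open>U \<union> T i\<close>. If the copy lies in
      \<open>?A\<close>, its edges from \<open>E1\<close> lie in \<open>U \<union> T i\<close>,
      where \<open>E1\<close> and \<open>E2\<close> coincide. Otherwise its vertices in
      \<open>low i\<close> are terminals.\<close>
    have step: "copy \<phi> E2 \<or> (\<forall>p\<in>HV. \<phi> p \<in> low i \<longrightarrow> \<phi> p \<in> \<Union>E1)" if i: "i \<in> I" for i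
    proof -
      let ?A = "low i \<union> U" and ?B = "(- low i) \<union> (T i \<inter> \<Union>E1) \<union> U"
      have edges: "{x, y} \<subseteq> ?A \<or> {x, y} \<subseteq> ?B"
        if xy: "{x, y} \<in> E1 \<union> E2" "{x, y} \<subseteq> \<phi> ` HV" "x \<noteq> y" for x y
      proof (cases "{x, y} \<in> E2")
        case True
        then show ?thesis using low_step[OF i, of x y] low_step[OF i, of y x] xy
          by (auto simp: insert_commute)
      next
        case False
        then have "x \<in> \<Union>E1" "y \<in> \<Union>E1" using xy by auto
        then show ?thesis using low_T[OF i] by blast
      qed
      have c: "?A \<inter> ?B \<subseteq> U \<union> T i" by auto
      consider "\<forall>p\<in>HV. \<phi> p \<in> ?A \<longrightarrow> \<phi> p \<in> ?B" | "\<forall>p\<in>HV. \<phi> p \<in> ?B \<longrightarrow> \<phi> p \<in> ?A"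
        using cut[of ?A ?B "U \<union> T i", OF _ edges c] T[OF i] U(1) by blast
      then show ?thesis
      proof cases
        case 1
        have "\<phi> p \<in> \<Union>E1" if "p \<in> HV" "\<phi> p \<in> low i" for p
          using 1 that by (auto simp: low_def)
        then show ?thesis by blast
      next
        case 2
        then have im: "\<And>p. p \<in> HV \<Longrightarrow> \<phi> p \<in> low i \<union> U" by blast
        have "copy \<phi> E2"
        proof (rule all2)
          fix x y assume xy: "{x, y} \<in> E1" "{x, y} \<subseteq> \<phi> ` HV"
          have "z \<in> U \<union> T i" if "z \<in> {x, y}" for z
          proof -
            have "z \<in> \<phi> ` HV" "z \<in> \<Union>E1" using xy that by blast+
            then show ?thesis using im low_T[OF i] by blast
          qed
          then have "{x, y} \<subseteq> U \<union> T i" by blast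
          then show "{x, y} \<in> E2" using common i xy by blast
        qed
        then show ?thesis ..
      qed
    qed
    show ?thesis
    proof (cases "copy \<phi> E2")
      case False
      then have lowE1: "\<phi> p \<in> \<Union>E1" if "i \<in> I" "p \<in> HV" "\<phi> p \<in> low i" for i p
        using step that by blast
      \<comment> \<open>As the copy has no private vertices of \<open>E2\<close> in any
        \<open>low i\<close>, its private vertices of \<open>E2\<close> have no neighbours in
        \<open>E1\<close> outside \<open>U\<close>. So \<open>U\<close> alone separates the two
        parts.\<close>
      let ?A = "- \<Union>E1 \<union> U" and ?B = "\<Union>E1 \<union> U"
      have nU: "\<not> {x, y} \<subseteq> U" if "x \<noteq> y" for x y
      proof
        assume "{x, y} \<subseteq> U"
        then have "card {x, y} \<le> card U" using U(1) by (rule card_mono[rotated])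
        then show False using that U(2) by simp
      qed
      have cross: "False" if "{x, y} \<in> E2" "{x, y} \<subseteq> \<phi> ` HV" "x \<notin> \<Union>E1" "x \<notin> U" "y \<in> \<Union>E1" "y \<notin> U" for x y
      proof -
        have "y \<in> \<Union>E2" "y \<in> \<Union>E1" "y \<notin> U" using that by auto
        then obtain i where i: "i \<in> I" "y \<in> T i" using meet by blast
        have "y \<in> low i" using T_low i that \<open>y \<in> \<Union>E2\<close> by blast
        then have "x \<in> low i" using low_step[OF i(1), of y x] that by (simp add: insert_commute)
        then show False using lowE1[OF i(1)] that by auto
      qed
      have edges: "{x, y} \<subseteq> ?A \<or> {x, y} \<subseteq> ?B"
        if xy: "{x, y} \<in> E1 \<union> E2" "{x, y} \<subseteq> \<phi> ` HV" "x \<noteq> y" for x y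
      proof (cases "{x, y} \<in> E1")
        case True
        then show ?thesis by auto
      next
        case False
        then have e2: "{x, y} \<in> E2" "{y, x} \<in> E2" using xy by (auto simp: insert_commute)
        then show ?thesis
          using cross[OF e2(1)] cross[OF e2(2)] xy(2) by blast
      qed
      have "?A \<inter> ?B \<subseteq> U" by auto
      moreover have "card U \<le> 2" using U by simp
      ultimately consider "\<forall>p\<in>HV. \<phi> p \<in> ?A \<longrightarrow> \<phi> p \<in> ?B" | "\<forall>p\<in>HV. \<phi> p \<in> ?B \<longrightarrow> \<phi> p \<in> ?A"
        using cut[of ?A ?B U, OF _ edges] U(1) by blast
      then show ?thesis
      proof cases
        case 1
        \<comment> \<open>The copy has all its vertices in \<open>\<Union>E1 \<union> U\<close>.
          Each of its edges from \<open>E2\<close> starts at a terminal in some \<open>T i\<close>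
          and stays in \<open>low i\<close>, hence lies in \<open>U \<union> T i\<close> and belongs
          to \<open>E1\<close> as well.\<close>
        then have im: "\<And>x. x \<in> \<phi> ` HV \<Longrightarrow> x \<in> \<Union>E1 \<union> U" by blast
        have "copy \<phi> E1"
        proof (rule all1)
          fix x y assume xy: "{x, y} \<in> E2" "{x, y} \<subseteq> \<phi> ` HV" "x \<noteq> y"
          have *: "{x, y} \<in> E1" if xy: "{x, y} \<in> E2" "{x, y} \<subseteq> \<phi> ` HV" "x \<notin> U" for x y
          proof -
            have "x \<in> \<Union>E1" using im xy by blast
            then obtain i where i: "i \<in> I" "x \<in> T i" using meet xy by blast
            have "x \<in> low i" using T_low i xy by blast
            have "y \<in> U \<union> T i"
            proof (cases "y \<in> U")
              case False
              then have "y \<in> low i" using low_step[OF i(1) \<open>x \<in> low i\<close>] xy by blast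
              moreover have "y \<in> \<Union>E1" using im xy False by blast
              ultimately show ?thesis using low_T[OF i(1)] by blast
            qed simp
            then show ?thesis using common[OF i(1), of "{x, y}"] i xy by auto
          qed
          show "{x, y} \<in> E1"
            using *[of x y] *[of y x] nU[OF xy(3)] xy by (auto simp: insert_commute)
        qed
        then show ?thesis ..
      next
        case 2
        \<comment> \<open>The copy meets \<open>\<Union>E1\<close> inside \<open>U\<close>, which
          has at most one vertex and so contains no edge.\<close>
        then have im: "\<And>x. x \<in> \<phi> ` HV \<Longrightarrow> x \<in> \<Union>E1 \<Longrightarrow> x \<in> U" by blast
        have "copy \<phi> E2"
        proof (rule all2)
          fix x y assume xy: "{x, y} \<in> E1" "{x, y} \<subseteq> \<phi> ` HV" "x \<noteq> y"
          then have "x \<in> \<Union>E1" "y \<in> \<Union>E1" by blast+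
          then have "{x, y} \<subseteq> U" using im xy(2) by simp
          then show "{x, y} \<in> E2" using nU[OF xy(3)] by simp
        qed
        then show ?thesis ..
      qed
    qed simp
  qed
qed

lemma valid_glue:
  assumes split: "\<And>\<phi>. copy \<phi> (E1 \<union> E2) \<Longrightarrow> copy \<phi> E1 \<or> copy \<phi> E2"
    and c1: "valid E1 c1" and c2: "valid E2 c2"
    and agree: "\<And>e. e \<in> E1 \<Longrightarrow> e \<in> E2 \<Longrightarrow> c1 e = c2 e"
  shows "valid (E1 \<union> E2) (\<lambda>e. if e \<in> E1 then c1 e else c2 e)" (is "valid _ ?c")
proof -
  have v: "valid E1 ?c" "valid E2 ?c"
    using valid_cong[OF c1] valid_cong[OF c2] agree by auto
  have "?c ` (E1 \<union> E2) \<subseteq> {1..q}"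
    using v unfolding valid_def image_Un by blast
  moreover have "\<not> (\<exists>i. \<forall>e\<in>HE. ?c (\<phi> ` e) = i)" if "copy \<phi> (E1 \<union> E2)" for \<phi>
    using split[OF that] v unfolding valid_def by blast
  ultimately show ?thesis unfolding valid_def by blast
qed

section \<open>Senders\<close>

text \<open>The members of \<open>xs\<close> will be leaves at \<open>z\<close>, at distance at most
  two through \<open>z\<close>; only after deletion of \<open>z\<close> can they be far
  apart.\<close>

definition spread :: "'v \<Rightarrow> 'v list \<Rightarrow> 'v set set \<Rightarrow> bool" where
  "spread z xs W \<longleftrightarrow> (\<forall>a\<in>set xs. \<exists>l. l a = 0 \<and> (\<forall>b\<in>set xs - {a}. h < l b) \<and> lipschitz_off {z} W l)"

lemma spread_subset: "spread z xs W \<Longrightarrow> set ys \<subseteq> set xs \<Longrightarrow> spread z ys W"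
  unfolding spread_def by (intro ballI) (drule bspec, blast+)

text \<open>In the gluing criterion the centre is \<open>U\<close> and each leaf is a terminal set
  of its own. No edge of \<open>W\<close> joins two leaves, as their levels differ by more than one,
  so the common edges are the star edges, on which the two colourings agree by assumption.\<close>

lemma star_attach:
  fixes W :: "nat set set" and A :: "'v set set"
  assumes W: "edge_graph W" "valid W c" and A: "edge_graph A" "valid A c'"
    and ys: "distinct (u # ys)" "\<And>y. y \<in> set ys \<Longrightarrow> {u, y} \<in> A" "u \<in> \<Union>A"
    and xs: "distinct (z # xs)" "\<And>x. x \<in> set xs \<Longrightarrow> {z, x} \<in> W"
    and sp: "spread z xs W"
    and eq: "map (\<lambda>x. c {z, x}) xs = map (\<lambda>y. c' {u, y}) ys"
  obtains f where "inj_on f (\<Union>A)" "map f (u # ys) = z # xs"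
    "f ` (\<Union>A - set (u # ys)) \<inter> \<Union>W = {}" "colourable (W \<union> (`) f ` A)"
proof -
  have len: "length xs = length ys" using eq by (metis length_map)
  have sub: "set (u # ys) \<subseteq> \<Union>A" using ys(2,3) by auto
  obtain f where f: "inj_on f (\<Union>A)" "map f (u # ys) = z # xs" "f ` (\<Union>A - set (u # ys)) \<inter> \<Union>W = {}"
    by (rule fresh_extension[OF finite_Union_edge_graph[OF A(1)] finite_Union_edge_graph[OF W(1)] ys(1) xs(1) _ sub])
      (simp add: len)
  let ?A = "(`) f ` A"
  have grA: "edge_graph ?A" using A(1) f(1) by (rule edge_graph_image)
  obtain d where d: "valid ?A d" "\<And>e. e \<in> A \<Longrightarrow> d (f ` e) = c' e"
    using valid_push[OF f(1) A(2)] by blast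
  have fset: "f ` set (u # ys) = set (z # xs)" using f(2) by (metis set_map)
  have meet: "\<Union>?A \<inter> \<Union>W \<subseteq> {z} \<union> set xs"
  proof
    fix v assume v: "v \<in> \<Union>?A \<inter> \<Union>W"
    then obtain w where w: "w \<in> \<Union>A" "v = f w" by auto
    then have "w \<in> set (u # ys)" using f(3) v by blast
    then have "v \<in> set (z # xs)" using fset w(2) by blast
    then show "v \<in> {z} \<union> set xs" by simp
  qed
  have star: "{z, x} \<in> ?A \<and> {z, x} \<in> W \<and> d {z, x} = c {z, x}" if "x \<in> set xs" for x
  proof -
    from that obtain i where i: "i < length xs" "x = xs ! i" by (metis in_set_conv_nth)
    have mp: "map f ys = xs" and fu: "f u = z" using f(2) by simp_all
    have fy: "f (ys ! i) = x" using nth_map[of i ys f] i len unfolding mp by simp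
    have y: "ys ! i \<in> set ys" using i len by simp
    have "f ` {u, ys ! i} = {z, x}" using fy fu by simp
    moreover have "c {z, x} = c' {u, ys ! i}"
      using arg_cong[OF eq, of "\<lambda>l. l ! i"] i len by simp
    ultimately show ?thesis using ys(2)[OF y] d(2)[OF ys(2)[OF y]] xs(2)[OF that] by (metis imageI)
  qed
  have small: "e = {z, a}" if "e \<subseteq> {z} \<union> {a}" "card e = 2" for e a
  proof (rule card_seteq)
    show "card {z, a} \<le> card e" using that(2) by (simp add: card_insert_if)
  qed (use that in auto)
  have split: "copy \<phi> ?A \<or> copy \<phi> W" if "copy \<phi> (?A \<union> W)" for \<phi> :: "'a \<Rightarrow> nat"
  proof (rule copy_in_glued[where U = "{z}" and I = "set xs" and T = "\<lambda>a. {a}", OF grA W(1)])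
    show "\<Union> ?A \<inter> \<Union> W \<subseteq> {z} \<union> (\<Union>i\<in>set xs. {i})" using meet by simp
    show "e \<in> ?A \<longleftrightarrow> e \<in> W" if "i \<in> set xs" "e \<subseteq> {z} \<union> {i}" for i e
    proof
      assume "e \<in> ?A"
      then have "card e = 2" using grA unfolding edge_graph_def by blast
      then have "e = {z, i}" by (rule small[OF that(2)])
      then show "e \<in> W" using star[OF that(1)] by simp
    next
      assume "e \<in> W"
      then have "e = {z, i}" using small[OF that(2)] W(1) by (simp add: edge_graph_def)
      then show "e \<in> ?A" using star[OF that(1)] by simp
    qed
    show "\<exists>l. (\<forall>v\<in>{i}. l v = 0) \<and> (\<forall>j\<in>set xs - {i}. \<forall>v\<in>{j}. h < l v) \<and>
         (\<forall>x y. {x, y} \<in> W \<longrightarrow> x \<notin> {z} \<longrightarrow> y \<notin> {z} \<longrightarrow> l y \<le> l x + 1)" if "i \<in> set xs" for i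
    proof -
      obtain l where "l i = 0" "\<forall>b\<in>set xs - {i}. h < l b" "lipschitz_off {z} W l"
        using bspec[OF sp[unfolded spread_def] \<open>i \<in> set xs\<close>] by blast
      then show ?thesis unfolding lipschitz_off_def by (intro exI[of _ l]) simp
    qed
  qed (use that in \<open>auto simp: card_insert_if\<close>)
  have agree: "d e = c e" if e: "e \<in> ?A" "e \<in> W" for e
  proof -
    obtain v w where vw: "e = {v, w}" "v \<noteq> w" using W(1) e(2) by (rule edge_graphD)
    have in3: "v \<in> {z} \<union> set xs" "w \<in> {z} \<union> set xs" using meet e vw by blast+
    have "v = z \<or> w = z"
    proof (rule ccontr)
      assume n: "\<not> (v = z \<or> w = z)"
      then have "v \<in> set xs" "w \<in> set xs - {v}" using in3 vw(2) by auto
      then obtain l where l: "l v = 0" "h < l w" "lipschitz_off {z} W l"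
        using sp unfolding spread_def by blast
      have "{v, w} \<in> W" "v \<notin> {z}" "w \<notin> {z}" using n e(2) vw(1) by auto
      then have "l w \<le> l v + 1" using l(3) unfolding lipschitz_off_def by blast
      then have "h < 1" using l(1,2) by simp
      then show False using card_HV by simp
    qed
    then obtain x where "x \<in> set xs" "e = {z, x}" using vw in3 by (auto simp: insert_commute)
    then show ?thesis using star by simp
  qed
  have "valid (?A \<union> W) (\<lambda>e. if e \<in> ?A then d e else c e)"
    by (rule valid_glue) (use split d(1) W(2) agree in auto)
  then have "colourable (W \<union> ?A)" unfolding colourable_def by (metis Un_commute)
  then show thesis by (rule that[OF f])
qed

lemma valid_attached:
  assumes "inj_on f (\<Union>A)" "valid (W \<union> (`) f ` A) c"
  shows "valid W c" "valid A (\<lambda>e. c (f ` e))"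
proof -
  show "valid W c" using assms(2) by (rule valid_mono) simp
  have "valid ((`) f ` A) c" using assms(2) by (rule valid_mono) simp
  then show "valid A (\<lambda>e. c (f ` e))" using valid_image[OF assms(1)] by blast
qed

text \<open>A copy of \<open>H\<close> does not fit into a star: a vertex placed away from
  \<open>z\<close> has two neighbours, and both would have to be placed at \<open>z\<close>.\<close>

lemma star_colourable:
  assumes "\<And>e. e \<in> E \<Longrightarrow> z \<in> e"
  shows "valid E (\<lambda>_. 1)"
proof -
  have False if cp: "copy \<phi> E" for \<phi>
  proof -
    obtain p p' where p: "p \<in> HV" "p' \<in> HV" "p \<noteq> p'"
      using card_HV by (metis card_le_Suc0_iff_eq finite_HV not_less_eq_eq numeral_3_eq_3 le_SucI)
    have inj: "inj_on \<phi> HV" using cp by (simp add: copy_def)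
    obtain r where r: "r \<in> HV" "\<phi> r \<noteq> z" using p inj by (metis inj_onD)
    obtain x y where xy: "x \<noteq> y" "{r, x} \<in> HE" "{r, y} \<in> HE" using two_neighbours[OF r(1)] by blast
    have "z \<in> \<phi> ` {r, x}" "z \<in> \<phi> ` {r, y}" using cp xy assms unfolding copy_def by blast+
    then have "\<phi> x = \<phi> y" using r(2) by auto
    then show False using inj xy HE_edges by (meson inj_onD insert_subset)
  qed
  then show ?thesis using q_ge_2 unfolding valid_def by auto
qed

text \<open>Attaching copies of \<open>A\<close> to a large star one after the other must at some moment stop
  being colourable, for a star coloured by majority; \<open>W\<close> is the graph just before that.\<close>

lemma star_dual:
  fixes A :: "'v set set"
  assumes A: "edge_graph A" and ys: "distinct (u # ys)" "ys \<noteq> []" "\<And>y. y \<in> set ys \<Longrightarrow> {u, y} \<in> A"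
    and nonconst: "\<And>c i. valid A c \<Longrightarrow> \<exists>y\<in>set ys. c {u, y} \<noteq> i"
  obtains W :: "nat set set" and z xs where "edge_graph W" "colourable W" "distinct (z # xs)"
    "length xs = length ys" "\<And>x. x \<in> set xs \<Longrightarrow> {z, x} \<in> W" "spread z xs W"
    "\<And>c c'. valid W c \<Longrightarrow> valid A c' \<Longrightarrow> map (\<lambda>x. c {z, x}) xs \<noteq> map (\<lambda>y. c' {u, y}) ys"
proof -
  define d where "d = length ys"
  have u: "u \<in> \<Union>A" using ys(2,3) by (cases ys) auto
  obtain N and ts :: "nat list list" where ts: "sparse_blocks h d {..<N} ts"
      and mono: "\<And>c. c ` {..<N} \<subseteq> {1..q} \<Longrightarrow> \<exists>t\<in>set ts. \<exists>i. \<forall>x\<in>set t. c x = i"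
  proof -
    have "1 \<le> d" "1 \<le> q" using ys(2) q_ge_2 by (simp_all add: d_def Suc_le_eq)
    then show thesis using that sparse_blocks_exist[of d q h] by blast
  qed
  define dual where "dual W z xs \<longleftrightarrow> edge_graph W \<and> colourable W \<and> distinct (z # xs) \<and>
      length xs = length ys \<and> (\<forall>x\<in>set xs. {z, x} \<in> W) \<and> spread z xs W \<and>
      (\<forall>c c'. valid W c \<longrightarrow> valid A c' \<longrightarrow> map (\<lambda>x. c {z, x}) xs \<noteq> map (\<lambda>y. c' {u, y}) ys)"
    for W :: "nat set set" and z xs
  \<comment> \<open>The centre is \<open>0\<close> and the point \<open>j\<close> becomes the leaf
    \<open>Suc j\<close>. The clause on \<open>l\<close> is how sparseness is inherited: levels on
    the points that change by at most one within each block extend to \<open>W\<close> without its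
    centre, so the leaves of the next block are far apart there.\<close>
  have "(\<exists>W z xs. dual W z xs) \<or> (\<exists>W :: nat set set. edge_graph W \<and> colourable W \<and> (\<forall>j<N. {0, Suc j} \<in> W) \<and>
      (\<forall>l. lipschitz_on_blocks ts l \<longrightarrow> (\<exists>l'. (\<forall>j<N. l' (Suc j) = l j) \<and> lipschitz_off {0} W l')) \<and>
      (\<forall>c. valid W c \<longrightarrow> (\<forall>t\<in>set ts. \<exists>c'. valid A c' \<and> map (\<lambda>x. c {0, Suc x}) t = map (\<lambda>y. c' {u, y}) ys)))"
    using ts
  proof (induction ts)
    case Nil
    let ?W = "(\<lambda>j. {0, Suc j}) ` {..<N}"
    have "edge_graph ?W" by (auto simp: edge_graph_def)
    moreover have "colourable ?W"
      unfolding colourable_def using star_colourable[of ?W 0] by blast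
    moreover have "\<exists>l'. (\<forall>j<N. l' (Suc j) = l j) \<and> lipschitz_off {0} ?W l'" for l
      by (rule exI[of _ "\<lambda>v. l (v - 1)"]) (auto simp: lipschitz_off_def doubleton_eq_iff)
    ultimately show ?case by (intro disjI2 exI[of _ ?W]) auto
  next
    case (Cons t ts)
    show ?case
    proof (cases "\<exists>W z xs. dual W z xs")
      case False
      have t: "length t = d" "distinct t" "set t \<subseteq> {..<N}"
        and far: "\<And>a. a \<in> set t \<Longrightarrow> \<exists>l. lipschitz_on_blocks ts l \<and> l a = 0 \<and> (\<forall>b\<in>set t - {a}. h < l b)"
        and sparse: "sparse_blocks h d {..<N} ts"
        using Cons.prems by auto
      obtain W :: "nat set set" where W: "edge_graph W" "colourable W" "\<And>j. j < N \<Longrightarrow> {0, Suc j} \<in> W"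
        and ext: "\<And>l. lipschitz_on_blocks ts l \<Longrightarrow> \<exists>l'. (\<forall>j<N. l' (Suc j) = l j) \<and> lipschitz_off {0} W l'"
        and forced: "\<And>c t. valid W c \<Longrightarrow> t \<in> set ts \<Longrightarrow>
           \<exists>c'. valid A c' \<and> map (\<lambda>x. c {0, Suc x}) t = map (\<lambda>y. c' {u, y}) ys"
        using Cons.IH[OF sparse] False by blast
      let ?xs = "map Suc t"
      have dist: "distinct (0 # ?xs)" using t(2) by (auto simp: distinct_map)
      have edges: "{0, x} \<in> W" if "x \<in> set ?xs" for x using that t(3) W(3) by auto
      have "spread 0 ?xs W"
        unfolding spread_def
      proof
        fix a assume "a \<in> set ?xs"
        then obtain a' where a': "a = Suc a'" "a' \<in> set t" by auto
        obtain l where l: "lipschitz_on_blocks ts l" "l a' = 0" "\<forall>b\<in>set t - {a'}. h < l b"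
          using far[OF a'(2)] by blast
        obtain l' where l': "\<forall>j<N. l' (Suc j) = l j" "lipschitz_off {0} W l'" using ext[OF l(1)] by blast
        have "l' (Suc b) = l b" if "b \<in> set t" for b using that t(3) l'(1) by auto
        then show "\<exists>l. l a = 0 \<and> (\<forall>b\<in>set ?xs - {a}. h < l b) \<and> lipschitz_off {0} W l"
          using l a' l'(2) by (intro exI[of _ l']) auto
      qed
      note sp = this
      \<comment> \<open>As \<open>W\<close> with this block is not dual to \<open>A\<close>, the two
        graphs have valid colourings that agree along the block, which is what attaching
        \<open>A\<close> requires.\<close>
      obtain c c' where cc: "valid W c" "valid A c'" "map (\<lambda>x. c {0, x}) ?xs = map (\<lambda>y. c' {u, y}) ys"
      proof -
        have "\<not> dual W 0 ?xs" using False by blast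
        then show thesis
          using that W(1,2) dist edges sp t(1) unfolding dual_def by (auto simp: d_def)
      qed
      obtain f where f: "inj_on f (\<Union>A)" "map f (u # ys) = 0 # ?xs"
          "f ` (\<Union>A - set (u # ys)) \<inter> \<Union>W = {}" "colourable (W \<union> (`) f ` A)"
        using star_attach[OF W(1) cc(1) A cc(2) ys(1,3) u dist edges sp cc(3)] by blast
      let ?W = "W \<union> (`) f ` A"
      have "\<exists>l'. (\<forall>j<N. l' (Suc j) = l j) \<and> lipschitz_off {0} ?W l'"
        if l: "lipschitz_on_blocks (t # ts) l" for l
      proof -
        have "lipschitz_on_blocks ts l" using l by (auto simp: lipschitz_on_blocks_def)
        then obtain l' where l': "\<And>j. j < N \<Longrightarrow> l' (Suc j) = l j" "lipschitz_off {0} W l'"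
          using ext by blast
        \<comment> \<open>On the new block \<open>l\<close> takes only the values \<open>m\<close>
          and \<open>m + 1\<close>. With \<open>m\<close> at all fresh vertices, every edge of the
          attached copy away from the centre changes the level by at most one.\<close>
        define m where "m = Min (l ` set t)"
        have tne: "set t \<noteq> {}" using t(1) ys(2) by (auto simp: d_def)
        have m: "m \<le> l x \<and> l x \<le> m + 1" if "x \<in> set t" for x
        proof -
          have "m \<in> l ` set t" unfolding m_def using tne by (intro Min_in) auto
          then obtain y where "y \<in> set t" "m = l y" by blast
          then have "l x \<le> m + 1" using that l by (simp add: lipschitz_on_blocks_def)
          moreover have "m \<le> l x" unfolding m_def using that by (intro Min_le) auto
          ultimately show ?thesis by simp
        qed
        define l2 where "l2 v = (if v \<in> \<Union>W then l' v else m)" for v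
        have bounds: "m \<le> l2 v \<and> l2 v \<le> m + 1" if "v \<in> \<Union>((`) f ` A)" "v \<noteq> 0" for v
        proof (cases "v \<in> \<Union>W")
          case True
          from that(1) obtain w where w: "w \<in> \<Union>A" "v = f w" by auto
          then have "w \<in> set (u # ys)" using f(3) True by blast
          then have "v \<in> set (0 # ?xs)" using f(2) w(2) by (metis imageI set_map)
          with that(2) obtain x where x: "x \<in> set t" "v = Suc x" by auto
          then have "l2 v = l x" using True l'(1) t(3) by (auto simp: l2_def)
          then show ?thesis using m[OF x(1)] by simp
        qed (simp add: l2_def)
        have "lipschitz_off {0} ?W l2"
          unfolding lipschitz_off_def
        proof (intro allI impI)
          fix x y assume xy: "{x, y} \<in> ?W" "x \<notin> {0}" "y \<notin> {0}"
          show "l2 y \<le> l2 x + 1"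
          proof (cases "{x, y} \<in> W")
            case True
            then have "x \<in> \<Union>W" "y \<in> \<Union>W" by auto
            then show ?thesis using l'(2) xy True by (auto simp: lipschitz_off_def l2_def)
          next
            case False
            then have "{x, y} \<in> (`) f ` A" using xy by simp
            then have "x \<in> \<Union>((`) f ` A)" "y \<in> \<Union>((`) f ` A)" by blast+
            then show ?thesis using bounds[of x] bounds[of y] xy(2,3) by simp
          qed
        qed
        moreover have "l2 (Suc j) = l j" if "j < N" for j
        proof -
          have "Suc j \<in> \<Union>W" using W(3)[OF that] by blast
          then show ?thesis using l'(1)[OF that] by (simp add: l2_def)
        qed
        ultimately show ?thesis by blast
      qed
      moreover have "\<exists>c'. valid A c' \<and> map (\<lambda>x. c {0, Suc x}) s = map (\<lambda>y. c' {u, y}) ys"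
        if c: "valid ?W c" and s: "s \<in> set (t # ts)" for c s
      proof (cases "s \<in> set ts")
        case True
        then show ?thesis using forced valid_attached(1)[OF f(1) c] by blast
      next
        case False
        then have "s = t" using s by simp
        have "map f ys = ?xs" and fu: "f u = 0" using f(2) by simp_all
        then have "map (\<lambda>x. c {0, Suc x}) t = map (\<lambda>x. c {0, x}) (map f ys)" by (simp add: comp_def)
        also have "map (\<lambda>x. c {0, x}) (map f ys) = map (\<lambda>y. c (f ` {u, y})) ys" using fu by simp
        finally show ?thesis
          using valid_attached(2)[OF f(1) c] \<open>s = t\<close> by (intro exI[of _ "\<lambda>e. c (f ` e)"]) simp
      qed
      moreover have "edge_graph ?W" using W(1) edge_graph_image[OF A f(1)] by (rule edge_graph_Un)
      moreover have "\<forall>j<N. {0, Suc j} \<in> ?W" using W(3) by simp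
      ultimately show ?thesis using f(4) by (intro disjI2 exI[of _ ?W]) blast
    qed simp
  qed
  then show thesis
  proof (elim disjE exE conjE)
    fix W :: "nat set set" and z xs assume "dual W z xs"
    then show thesis by (intro that[of W z xs]) (simp_all add: dual_def)
  next
    fix W :: "nat set set"
    assume W: "\<forall>j<N. {0, Suc j} \<in> W" and col: "colourable W"
      and all: "\<forall>c. valid W c \<longrightarrow> (\<forall>t\<in>set ts. \<exists>c'. valid A c' \<and> map (\<lambda>x. c {0, Suc x}) t = map (\<lambda>y. c' {u, y}) ys)"
    obtain c where c: "valid W c" using col by (auto simp: colourable_def)
    note forced = all[rule_format, OF c]
    have "(\<lambda>j. c {0, Suc j}) ` {..<N} \<subseteq> {1..q}" using W valid_range[OF c] by auto
    then have "\<exists>t\<in>set ts. \<exists>i. \<forall>x\<in>set t. c {0, Suc x} = i" by (rule mono)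
    then obtain t i where t: "t \<in> set ts" "\<And>x. x \<in> set t \<Longrightarrow> c {0, Suc x} = i" by blast
    obtain c' where c': "valid A c'" "map (\<lambda>x. c {0, Suc x}) t = map (\<lambda>y. c' {u, y}) ys"
      using forced[OF t(1)] by blast
    have "(\<lambda>y. c' {u, y}) ` set ys = (\<lambda>x. c {0, Suc x}) ` set t" using c'(2) by (metis set_map)
    also have "\<dots> \<subseteq> {i}" using t(2) by auto
    finally have "\<forall>y\<in>set ys. c' {u, y} = i" by auto
    then show thesis using nonconst[OF c'(1), of i] by blast
  qed
qed

section \<open>From Ramsey's theorem to adjacent edges of unequal and of equal colours\<close>

lemma ramsey_graph_exists: "\<exists>E :: nat set set. edge_graph E \<and> \<not> colourable E"
proof -
  obtain N :: nat where N: "partn_lst {..<N} (replicate q h) 2" using ramsey_full by blast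
  let ?E = "nsets {..<N} 2"
  have "edge_graph ?E"
    by (simp add: edge_graph_def finite_imp_finite_nsets) (simp add: nsets_def)
  moreover have "\<not> valid ?E c" for c
  proof
    assume v: "valid ?E c"
    \<comment> \<open>The partition theorem numbers its colours from 0. A monochromatic clique on
      \<open>h\<close> vertices contains a copy of \<open>H\<close>.\<close>
    have "(\<lambda>e. c e - 1) \<in> ?E \<rightarrow> {..<length (replicate q h)}"
      using valid_range[OF v] by (fastforce simp: Pi_iff)
    then obtain i where "i < q" "monochromatic {..<N} h 2 (\<lambda>e. c e - 1) i"
      using N unfolding partn_lst_def by force
    then obtain S where S: "S \<in> nsets {..<N} h" "(\<lambda>e. c e - 1) ` nsets S 2 \<subseteq> {i}"
      unfolding monochromatic_def by blast
    then have "finite S" "card S = h" by (auto simp: nsets_def)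
    then obtain \<phi> where \<phi>: "bij_betw \<phi> HV S" using finite_HV finite_same_card_bij by metis
    have e: "\<phi> ` e \<in> nsets S 2" if "e \<in> HE" for e
    proof -
      have "inj_on \<phi> e" using \<phi> HE_edges[OF that] inj_on_subset by (metis bij_betw_def)
      moreover have "\<phi> ` e \<subseteq> S" using \<phi> HE_edges[OF that] by (metis bij_betw_def image_mono)
      ultimately show ?thesis
        using HE_edges[OF that] finite_subset[OF _ finite_HV] by (simp add: nsets_def card_image)
    qed
    have SN: "nsets S 2 \<subseteq> ?E" using S(1) by (intro nsets_mono) (auto simp: nsets_def)
    have "copy \<phi> ?E" using \<phi> e SN by (auto simp: copy_def bij_betw_def)
    moreover have "c (\<phi> ` e) = Suc i" if "e \<in> HE" for e
    proof -
      have "c (\<phi> ` e) - 1 = i" using S(2) e[OF that] by blast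
      moreover have "1 \<le> c (\<phi> ` e)" using valid_range[OF v] e[OF that] SN by fastforce
      ultimately show ?thesis by simp
    qed
    ultimately show False using v unfolding valid_def by blast
  qed
  ultimately show ?thesis unfolding colourable_def by blast
qed

lemma minimal_uncolourable:
  assumes "finite E" "\<not> colourable E"
  obtains M where "M \<subseteq> E" "\<not> colourable M" "\<And>D. D \<subset> M \<Longrightarrow> colourable D"
proof -
  obtain M where M: "M \<subseteq> E \<and> \<not> colourable M" "\<forall>D. D \<subseteq> E \<and> \<not> colourable D \<longrightarrow> card M \<le> card D"
    using ex_has_least_nat[of "\<lambda>M. M \<subseteq> E \<and> \<not> colourable M" E card] assms by blast
  have "colourable D" if D: "D \<subset> M" for D
  proof (rule ccontr)
    assume "\<not> colourable D"
    then have "card M \<le> card D" using M D by blast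
    moreover have "card D < card M"
      using D M(1) assms(1) by (meson finite_subset psubset_card_mono)
    ultimately show False by simp
  qed
  then show thesis using that M(1) by blast
qed

text \<open>If all edges at \<open>u\<close> other than \<open>e\<close> had the same colour, then \<open>e\<close> could be given another
  colour, as every copy of \<open>H\<close> through \<open>e\<close> has a further edge at \<open>u\<close>.\<close>

lemma nonconstant_star:
  obtains A :: "nat set set" and u ys where "edge_graph A" "colourable A" "distinct (u # ys)" "ys \<noteq> []"
    "\<And>y. y \<in> set ys \<Longrightarrow> {u, y} \<in> A"
    "\<And>c i. valid A c \<Longrightarrow> \<exists>y\<in>set ys. c {u, y} \<noteq> i"
proof -
  obtain E0 :: "nat set set" where E0: "edge_graph E0" "\<not> colourable E0" using ramsey_graph_exists by blast
  have finE0: "finite E0" using E0(1) by (simp add: edge_graph_def)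
  obtain E where E: "E \<subseteq> E0" "\<not> colourable E" "\<And>D. D \<subset> E \<Longrightarrow> colourable D"
    by (rule minimal_uncolourable[OF finE0 E0(2)]) blast
  have gE: "edge_graph E" using E0(1) E(1) by (rule edge_graph_mono)
  have "colourable {}" unfolding colourable_def using star_colourable[of "{}"] by auto
  then obtain e where e: "e \<in> E" using E(2) by force
  obtain u v where uv: "e = {u, v}" "u \<noteq> v" using gE e by (rule edge_graphD)
  let ?A = "E - {e}"
  have gA: "edge_graph ?A" using gE by (rule edge_graph_mono) simp
  have colA: "colourable ?A" using E(3) e by blast
  have finY: "finite {y. {u, y} \<in> ?A}"
    by (rule finite_subset[OF _ finite_Union_edge_graph[OF gA]]) auto
  then obtain ys where ys: "set ys = {y. {u, y} \<in> ?A}" "distinct ys"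
    using finite_distinct_list[OF finY] by auto
  have "u \<notin> set ys" 
  proof
    assume "u \<in> set ys"
    then have "{u} \<in> ?A" using ys(1) by simp
    then have "card {u} = 2" using gA unfolding edge_graph_def by blast
    then show False by simp
  qed
  have nonconst: "\<exists>y\<in>set ys. c {u, y} \<noteq> i" if c: "valid ?A c" for c i
  proof (rule ccontr)
    assume "\<not> ?thesis"
    then have const: "\<And>y. {u, y} \<in> ?A \<Longrightarrow> c {u, y} = i" using ys(1) by blast
    obtain j where j: "j \<in> {1..q}" "j \<noteq> i" using q_ge_2 by (cases "i = 1") (use that[of 1] that[of 2] in simp_all)
    let ?c = "c(e := j)"
    have "\<not> (\<exists>k. \<forall>e\<in>HE. ?c (\<phi> ` e) = k)" if cp: "copy \<phi> E" for \<phi>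
    proof (cases "\<exists>e'\<in>HE. \<phi> ` e' = e")
      case False
      then have "copy \<phi> ?A" using cp by (auto simp: copy_def)
      then have "\<not> (\<exists>k. \<forall>e\<in>HE. c (\<phi> ` e) = k)" using c unfolding valid_def by blast
      then show ?thesis using False by auto
    next
      case True
      then obtain e' where e': "e' \<in> HE" "\<phi> ` e' = e" by blast
      have inj: "inj_on \<phi> HV" and im: "\<And>e. e \<in> HE \<Longrightarrow> \<phi> ` e \<in> E" using cp by (auto simp: copy_def)
      have "u \<in> \<phi> ` e'" using e'(2) uv(1) by simp
      then obtain p where p: "p \<in> e'" "\<phi> p = u" by (metis imageE)
      have pH: "p \<in> HV" using p(1) HE_edges[OF e'(1)] by blast
      obtain x y where xy: "x \<noteq> y" "{p, x} \<in> HE" "{p, y} \<in> HE" by (rule two_neighbours[OF pH])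
      then have "{p, x} \<noteq> {p, y}" by (simp add: doubleton_eq_iff)
      then obtain w where w: "{p, w} \<in> HE" "{p, w} \<noteq> e'" using xy(2,3) by metis
      have "\<phi> ` {p, w} \<noteq> e"
        using inj_on_image_eq_iff[OF inj] HE_edges w e' by metis
      then have "{u, \<phi> w} \<in> ?A" using im[OF w(1)] p(2) by simp
      then have "?c (\<phi> ` {p, w}) = i" using const p(2) \<open>\<phi> ` {p, w} \<noteq> e\<close> by simp
      moreover have "?c (\<phi> ` e') = j" using e' by simp
      ultimately show ?thesis using w(1) e'(1) j(2) by metis
    qed
    moreover have "?c ` E \<subseteq> {1..q}"
    proof (rule image_subsetI)
      fix x assume "x \<in> E"
      then show "?c x \<in> {1..q}" using j(1) valid_range[OF c, of x] by (cases "x = e") auto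
    qed
    ultimately have "valid E ?c" unfolding valid_def by blast
    then show False using E(2) unfolding colourable_def by blast
  qed
  moreover have "ys \<noteq> []" using nonconst colA unfolding colourable_def by fastforce
  ultimately show thesis
    using that[OF gA colA, of u ys] ys \<open>u \<notin> set ys\<close> by auto
qed

text \<open>The stars of \<open>W\<close> and \<open>A\<close> can show the same colours on an empty
  list of leaves, but never on all leaves. At a threshold \<open>i\<close>, agreement is possible on
  \<open>i\<close> leaves and impossible on \<open>i + 1\<close>; after gluing along the first
  \<open>i\<close> leaves, the next star edges of the two graphs can never have equal
  colours.\<close>

lemma unequal_cherry:
  obtains B :: "nat set set" and u a b where "edge_graph B" "colourable B" "distinct [u, a, b]"
    "{u, a} \<in> B" "{u, b} \<in> B" "\<And>c. valid B c \<Longrightarrow> c {u, a} \<noteq> c {u, b}"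
proof -
  obtain A :: "nat set set" and u ys where A: "edge_graph A" "colourable A" and ys: "distinct (u # ys)" "ys \<noteq> []"
    "\<And>y. y \<in> set ys \<Longrightarrow> {u, y} \<in> A"
    and nonconst: "\<And>c i. valid A c \<Longrightarrow> \<exists>y\<in>set ys. c {u, y} \<noteq> i"
    by (rule nonconstant_star) blast
  have u: "u \<in> \<Union>A" using ys(2,3) by (cases ys) auto
  obtain W :: "nat set set" and z xs where W: "edge_graph W" "colourable W" and xs: "distinct (z # xs)"
    "length xs = length ys" "\<And>x. x \<in> set xs \<Longrightarrow> {z, x} \<in> W" "spread z xs W"
    and clash: "\<And>c c'. valid W c \<Longrightarrow> valid A c' \<Longrightarrow> map (\<lambda>x. c {z, x}) xs \<noteq> map (\<lambda>y. c' {u, y}) ys"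
    by (rule star_dual[OF A(1) ys nonconst]) blast+
  define P where "P i \<longleftrightarrow> (\<exists>c c'. valid W c \<and> valid A c' \<and>
      map (\<lambda>x. c {z, x}) (take i xs) = map (\<lambda>y. c' {u, y}) (take i ys))" for i
  have "P 0" using W(2) A(2) by (auto simp: P_def colourable_def)
  moreover have "\<not> P (length ys)" using clash xs(2) by (auto simp: P_def)
  ultimately obtain i where i: "P i" "\<not> P (Suc i)" "i < length ys"
    using ex_least_nat_less[of "\<lambda>i. \<not> P i" "length ys"] by auto
  obtain c c' where cc: "valid W c" "valid A c'"
      "map (\<lambda>x. c {z, x}) (take i xs) = map (\<lambda>y. c' {u, y}) (take i ys)"
    using i(1) by (auto simp: P_def)
  have "spread z (take i xs) W" using xs(4) set_take_subset by (rule spread_subset)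
  then obtain f where f: "inj_on f (\<Union>A)" "map f (u # take i ys) = z # take i xs"
      "f ` (\<Union>A - set (u # take i ys)) \<inter> \<Union>W = {}" "colourable (W \<union> (`) f ` A)"
    using star_attach[OF W(1) cc(1) A(1) cc(2) _ _ u _ _ _ cc(3)] ys xs
    by (metis distinct.simps(2) distinct_take in_set_takeD)
  let ?B = "W \<union> (`) f ` A"
  let ?x = "xs ! i" and ?y = "ys ! i"
  have mem: "?x \<in> set xs" "?y \<in> set ys" using i(3) xs(2) by auto
  have fu: "f u = z" using f(2) by simp
  have ysA: "?y \<in> \<Union>A" using ys(3)[OF mem(2)] by blast
  have "?y \<notin> set (u # take i ys)"
  proof -
    have "distinct (u # take (Suc i) ys)" using ys(1) by (metis distinct_take take_Suc_Cons)
    moreover have "u \<noteq> ?y" using ys(1) mem(2) by auto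
    ultimately show ?thesis using i(3) by (simp add: take_Suc_conv_app_nth)
  qed
  then have fW: "f ?y \<notin> \<Union>W" using f(3) ysA by blast
  show thesis
  proof (rule that[of ?B z ?x "f ?y"])
    show "edge_graph ?B" using W(1) edge_graph_image[OF A(1) f(1)] by (rule edge_graph_Un)
    show "colourable ?B" by (rule f(4))
    show zx: "{z, ?x} \<in> ?B" using xs(3)[OF mem(1)] by simp
    have "f ` {u, ?y} \<in> (`) f ` A" using ys(3)[OF mem(2)] by (rule imageI)
    then show "{z, f ?y} \<in> ?B" using fu by simp
    have "z \<in> \<Union>W" "?x \<in> \<Union>W" using xs(3)[OF mem(1)] by auto
    then show "distinct [z, ?x, f ?y]" using fW xs(1) mem(1) by auto
    show "c {z, ?x} \<noteq> c {z, f ?y}" if c: "valid ?B c" for c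
    proof
      assume eq: "c {z, ?x} = c {z, f ?y}"
      note v = valid_attached[OF f(1) c]
      have "map (\<lambda>x. c {z, x}) (take i xs) = map (\<lambda>x. c {z, x}) (map f (take i ys))" using f(2) by simp
      also have "\<dots> = map (\<lambda>y. c (f ` {u, y})) (take i ys)" using fu by simp
      finally have "map (\<lambda>x. c {z, x}) (take (Suc i) xs) = map (\<lambda>y. c (f ` {u, y})) (take (Suc i) ys)"
        using eq fu i(3) xs(2) by (simp add: take_Suc_conv_app_nth)
      then have "P (Suc i)" unfolding P_def using v by blast
      then show False using i(2) by blast
    qed
  qed
qed

text \<open>The dual \<open>W\<close> of the unequal cherry never shows a pair of colours that the
  cherry can show. Permuting colours lets the cherry show every pair of distinct colours, so only
  equal pairs are left for \<open>W\<close>.\<close>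

lemma equal_cherry:
  obtains C :: "nat set set" and z x y where "edge_graph C" "colourable C" "distinct [z, x, y]"
    "{z, x} \<in> C" "{z, y} \<in> C" "spread z [x, y] C" "\<And>c. valid C c \<Longrightarrow> c {z, x} = c {z, y}"
proof -
  obtain B :: "nat set set" and u a b where B: "edge_graph B" "colourable B" "distinct [u, a, b]"
    "{u, a} \<in> B" "{u, b} \<in> B" and ne: "\<And>c. valid B c \<Longrightarrow> c {u, a} \<noteq> c {u, b}"
    by (rule unequal_cherry) blast
  have nonconst: "\<exists>y\<in>set [a, b]. c {u, y} \<noteq> i" if "valid B c" for c i
    using ne[OF that] by auto
  obtain W :: "nat set set" and z xs where W: "edge_graph W" "colourable W" and xs: "distinct (z # xs)"
    "length xs = length [a, b]" "\<And>x. x \<in> set xs \<Longrightarrow> {z, x} \<in> W" "spread z xs W"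
    and clash: "\<And>c c'. valid W c \<Longrightarrow> valid B c' \<Longrightarrow> map (\<lambda>x. c {z, x}) xs \<noteq> map (\<lambda>y. c' {u, y}) [a, b]"
    by (rule star_dual[OF B(1), of u "[a, b]"]) (use B nonconst in auto)
  obtain x y where xy: "xs = [x, y]" using xs(2) by (auto simp: length_Suc_conv numeral_2_eq_2)
  have "c {z, x} = c {z, y}" if c: "valid W c" for c
  proof (rule ccontr)
    assume n: "c {z, x} \<noteq> c {z, y}"
    obtain d where d: "valid B d" using B(2) by (auto simp: colourable_def)
    have "{d {u, a}, d {u, b}, c {z, x}, c {z, y}} \<subseteq> {1..q}"
      using valid_range[OF d B(4)] valid_range[OF d B(5)] valid_range[OF c] xs(3) xy by auto
    then obtain \<pi> where "inj_on \<pi> {1..q}" "\<pi> ` {1..q} \<subseteq> {1..q}"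
      "\<pi> (d {u, a}) = c {z, x}" "\<pi> (d {u, b}) = c {z, y}"
      using relabel_two[OF ne[OF d] n] by blast
    then show False using clash[OF c, of "\<pi> \<circ> d"] valid_permute[OF d] xy by simp
  qed
  then show thesis using that[OF W] xs xy by auto
qed

section \<open>Gluing along an edge and the construction of senders\<close>

lemma valid_recolour:
  assumes "valid E c" "\<alpha> \<in> {1..q}" "e \<in> E"
  obtains d where "valid E d" "d e = \<alpha>" "\<And>x y. x \<in> E \<Longrightarrow> y \<in> E \<Longrightarrow> d x = d y \<longleftrightarrow> c x = c y"
proof -
  let ?\<pi> = "transpose (c e) \<alpha>"
  have "valid E (?\<pi> \<circ> c)"
  proof (rule valid_permute[OF assms(1)])
    show "?\<pi> ` {1..q} \<subseteq> {1..q}"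
      using assms(2) valid_range[OF assms(1,3)] by (auto simp: transpose_def)
  qed simp
  moreover have "(?\<pi> \<circ> c) x = (?\<pi> \<circ> c) y \<longleftrightarrow> c x = c y" for x y
    by simp (metis transpose_involutory)
  ultimately show thesis using that[of "?\<pi> \<circ> c"] by simp
qed

text \<open>Colours can be permuted in \<open>A\<close> until the common edge has the same colour on
  both sides. Its two ends form a single terminal set, so nothing has to be far apart and the
  constant level function serves.\<close>

lemma edge_attach:
  fixes E :: "nat set set" and A :: "'v set set"
  assumes E: "edge_graph E" "colourable E" "{a, b} \<in> E" "a \<noteq> b"
    and A: "edge_graph A" "colourable A" "{x, z} \<in> A" "x \<noteq> z"
  obtains f where "inj_on f (\<Union>A)" "f x = a" "f z = b"
    "f ` (\<Union>A - {x, z}) \<inter> \<Union>E = {}" "colourable (E \<union> (`) f ` A)"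
proof -
  have sub: "set [x, z] \<subseteq> \<Union>A" using A(3) by auto
  obtain f where f: "inj_on f (\<Union>A)" "map f [x, z] = [a, b]" "f ` (\<Union>A - set [x, z]) \<inter> \<Union>E = {}"
    by (rule fresh_extension[OF finite_Union_edge_graph[OF A(1)] finite_Union_edge_graph[OF E(1)] _ _ _ sub,
          of "[a, b]"]) (use E(4) A(4) in auto)
  let ?A = "(`) f ` A"
  have grA: "edge_graph ?A" using A(1) f(1) by (rule edge_graph_image)
  obtain c where c: "valid E c" using E(2) by (auto simp: colourable_def)
  obtain c' where "valid A c'" using A(2) by (auto simp: colourable_def)
  then obtain d0 where d0: "valid A d0" "d0 {x, z} = c {a, b}"
    using valid_recolour[OF _ valid_range[OF c E(3)] A(3)] by metis
  obtain d where d: "valid ?A d" "\<And>e. e \<in> A \<Longrightarrow> d (f ` e) = d0 e"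
    using valid_push[OF f(1) d0(1)] by blast
  have fab: "f ` {x, z} = {a, b}" using f(2) by simp
  have ab: "{a, b} \<in> ?A" "d {a, b} = c {a, b}"
    using imageI[OF A(3), of "(`) f"] d(2)[OF A(3)] d0(2) unfolding fab by auto
  have meet: "\<Union>?A \<inter> \<Union>E \<subseteq> {a, b}"
  proof
    fix v assume v: "v \<in> \<Union>?A \<inter> \<Union>E"
    then obtain w where w: "w \<in> \<Union>A" "v = f w" by auto
    then have "w \<in> {x, z}" using f(3) v by auto
    then show "v \<in> {a, b}" using w(2) f(2) by auto
  qed
  have only: "e = {a, b}" if "e \<subseteq> {a, b}" "e \<in> ?A \<or> e \<in> E" for e
  proof (rule card_seteq)
    have "card e = 2" using that(2) grA E(1) unfolding edge_graph_def by blast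
    then show "card {a, b} \<le> card e" by (simp add: card_insert_if)
  qed (use that in auto)
  have split: "copy \<phi> ?A \<or> copy \<phi> E" if "copy \<phi> (?A \<union> E)" for \<phi> :: "'a \<Rightarrow> nat"
  proof (rule copy_in_glued[where U = "{}" and I = "{()}" and T = "\<lambda>_. {a, b}", OF grA E(1)])
    show "e \<in> ?A \<longleftrightarrow> e \<in> E" if "e \<subseteq> {} \<union> {a, b}" for e
      using only[of e] that ab(1) E(3) by auto
    show "\<exists>l. (\<forall>v\<in>{a, b}. l v = 0) \<and> (\<forall>j\<in>{()} - {i}. \<forall>v\<in>{a, b}. h < l v) \<and>
         (\<forall>x y. {x, y} \<in> E \<longrightarrow> x \<notin> {} \<longrightarrow> y \<notin> {} \<longrightarrow> l y \<le> l x + 1)" if "i \<in> {()}" for i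
      by (rule exI[of _ "\<lambda>_. 0"]) auto
  qed (use that meet in \<open>auto simp: card_insert_if\<close>)
  have agree: "d e = c e" if e: "e \<in> ?A" "e \<in> E" for e
  proof -
    have "e \<subseteq> {a, b}" using meet e by blast
    then show ?thesis using only e ab(2) by metis
  qed
  have "valid (?A \<union> E) (\<lambda>e. if e \<in> ?A then d e else c e)"
    by (rule valid_glue) (use split d(1) c agree in auto)
  then have "colourable (E \<union> ?A)" unfolding colourable_def by (metis Un_commute)
  then show thesis using that[of f] f by auto
qed

text \<open>These are the positive (\<open>s\<close> true) and negative (\<open>s\<close> false)
  signal senders of Ramsey theory; the level function expresses that the signal edges are at
  distance more than \<open>h\<close>.\<close>

definition sender :: "bool \<Rightarrow> 'v set set \<Rightarrow> 'v set \<Rightarrow> 'v set \<Rightarrow> bool" where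
  "sender s S e f \<longleftrightarrow> edge_graph S \<and> colourable S \<and> e \<in> S \<and> f \<in> S \<and>
     (\<exists>l. (\<forall>v\<in>e. l v = 0) \<and> (\<forall>v\<in>f. h < l v) \<and> lipschitz_off {} S l) \<and>
     (\<forall>c. valid S c \<longrightarrow> (c e = c f \<longleftrightarrow> s))"

text \<open>Each step glues an equal cherry with one of its edges onto the last edge of the chain;
  the other edge becomes the last one, and the forced equality is passed on. The far apart leaves of
  the cherry prevent shortcuts, so the level rises by one.\<close>

lemma equal_chain:
  "\<exists>(P :: nat set set) v0 v1 a b l. edge_graph P \<and> colourable P \<and> {v0, v1} \<in> P \<and> {a, b} \<in> P \<and> a \<noteq> b \<and>
     lipschitz_off {} P l \<and> l v0 = 0 \<and> l v1 = 1 \<and> l a = n \<and> l b = n + 1 \<and>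
     (\<forall>c. valid P c \<longrightarrow> c {v0, v1} = c {a, b})"
proof (induction n)
  case 0
  let ?P = "{{0, 1 :: nat}}"
  have "edge_graph ?P" by (simp add: edge_graph_def)
  moreover have "colourable ?P"
    unfolding colourable_def using star_colourable[of ?P 0] by auto
  moreover have "lipschitz_off {} ?P (\<lambda>v. v)" by (auto simp: lipschitz_off_def doubleton_eq_iff)
  ultimately show ?case
    by (intro exI[of _ ?P] exI[of _ "0 :: nat"] exI[of _ "1 :: nat"] exI[of _ "\<lambda>v. v"]) auto
next
  case (Suc n)
  then obtain P :: "nat set set" and v0 v1 a b l where P: "edge_graph P" "colourable P" "{v0, v1} \<in> P"
      "{a, b} \<in> P" "a \<noteq> b" and l: "lipschitz_off {} P l" "l v0 = 0" "l v1 = 1" "l a = n" "l b = n + 1"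
    and eqP: "\<And>c. valid P c \<Longrightarrow> c {v0, v1} = c {a, b}" by blast
  obtain C :: "nat set set" and z x y where C: "edge_graph C" "colourable C" "distinct [z, x, y]"
    "{z, x} \<in> C" "{z, y} \<in> C" "spread z [x, y] C" and eqC: "\<And>c. valid C c \<Longrightarrow> c {z, x} = c {z, y}"
    by (rule equal_cherry) blast
  have xz: "{x, z} \<in> C" "x \<noteq> z" using C(3,4) by (auto simp: insert_commute)
  obtain f where f: "inj_on f (\<Union>C)" "f x = a" "f z = b" "f ` (\<Union>C - {x, z}) \<inter> \<Union>P = {}"
      "colourable (P \<union> (`) f ` C)"
    by (rule edge_attach[OF P(1,2,4,5) C(1,2) xz]) blast
  let ?P = "P \<union> (`) f ` C"
  obtain m where m: "m x = 0" "h < m y" "lipschitz_off {z} C m"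
    using C(3,6) unfolding spread_def by fastforce
  define k where "k w = (if w = z then 1 else min 2 (m w))" for w
  have kx: "k x = 0" "k z = 1" "k y = 2" using m C(3) card_HV by (auto simp: k_def)
  have klip: "k w' \<le> k w + 1" if "{w, w'} \<in> C" for w w'
  proof (cases "w = z \<or> w' = z")
    case True
    then show ?thesis by (auto simp: k_def)
  next
    case False
    then have "m w' \<le> m w + 1" using m(3) that unfolding lipschitz_off_def by auto
    then show ?thesis using False by (auto simp: k_def)
  qed
  define l' where "l' v = (if v \<in> \<Union>P then l v else n + k (inv_into (\<Union>C) f v))" for v
  have l'f: "l' (f w) = n + k w" if w: "w \<in> \<Union>C" for w
  proof (cases "f w \<in> \<Union>P")
    case True
    then have "w = x \<or> w = z" using f(4) w by blast
    then show ?thesis using True l(4,5) kx f(2,3) by (auto simp: l'_def)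
  next
    case False
    then show ?thesis using inv_into_f_f[OF f(1) w] by (simp add: l'_def)
  qed
  have y: "y \<in> \<Union>C" using C(5) by auto
  have l'P: "l' v = l v" if "v \<in> \<Union>P" for v using that by (simp add: l'_def)
  have "lipschitz_off {} C k" using klip by (simp add: lipschitz_off_def)
  then have "lipschitz_off {} C (\<lambda>w. n + k w)" by (simp add: lipschitz_off_def)
  then have "lipschitz_off {} ((`) f ` C) l'" using lipschitz_off_image[OF C(1)] l'f by blast
  then have "lipschitz_off {} ?P l'"
    using lipschitz_off_cong[OF l(1)] l'P by (blast intro: lipschitz_off_Un)
  moreover have "edge_graph ?P" using P(1) edge_graph_image[OF C(1) f(1)] by (rule edge_graph_Un)
  moreover have "{b, f y} \<in> ?P" using imageI[OF C(5), of "(`) f"] f(3) by simp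
  moreover have "v0 \<in> \<Union>P" "v1 \<in> \<Union>P" "b \<in> \<Union>P" using P(3,4) by auto
  then have "l' v0 = 0" "l' v1 = 1" "l' b = Suc n" using l l'P by simp_all
  moreover have "l' (f y) = Suc n + 1" using l'f[OF y] kx by simp
  moreover have "c {v0, v1} = c {b, f y}" if c: "valid ?P c" for c
  proof -
    note v = valid_attached[OF f(1) c]
    have "c (f ` {z, x}) = c (f ` {z, y})" using eqC[OF v(2)] .
    then have "c {a, b} = c {b, f y}" using f(2,3) by (simp add: insert_commute)
    then show ?thesis using eqP[OF v(1)] by simp
  qed
  moreover have "b \<noteq> f y" using \<open>l' b = Suc n\<close> \<open>l' (f y) = Suc n + 1\<close> by auto
  ultimately show ?case using P(3) f(5)
    by (intro exI[of _ ?P] exI[of _ v0] exI[of _ v1] exI[of _ b] exI[of _ "f y"] exI[of _ l']) simp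
qed

lemma positive_sender: "\<exists>(S :: nat set set) e f. sender True S e f"
proof -
  obtain P :: "nat set set" and v0 v1 a b l where P: "edge_graph P" "colourable P" "{v0, v1} \<in> P"
      "{a, b} \<in> P" and l: "lipschitz_off {} P l" "l v0 = 0" "l v1 = 1" "l a = h + 2" "l b = h + 2 + 1"
    and eqP: "\<And>c. valid P c \<Longrightarrow> c {v0, v1} = c {a, b}"
    using equal_chain[of "h + 2"] by blast
  \<comment> \<open>Truncated subtraction moves both ends of the first edge to level 0. The last
    edge ends up at the levels \<open>h + 1\<close> and \<open>h + 2\<close>, which accounts for the
    length \<open>h + 2\<close> of the chain.\<close>
  have "l w - 1 \<le> l v - 1 + 1" if "{v, w} \<in> P" for v w
  proof -
    have "l w \<le> l v + 1" using l(1) that unfolding lipschitz_off_def by blast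
    then show ?thesis by simp
  qed
  then have "lipschitz_off {} P (\<lambda>v. l v - 1)" by (simp add: lipschitz_off_def)
  then have "\<exists>l. (\<forall>v\<in>{v0, v1}. l v = 0) \<and> (\<forall>v\<in>{a, b}. h < l v) \<and> lipschitz_off {} P l"
    using l by (intro exI[of _ "\<lambda>v. l v - 1"]) auto
  then show ?thesis unfolding sender_def using P eqP
    by (intro exI[of _ P] exI[of _ "{v0, v1}"] exI[of _ "{a, b}"]) simp
qed

text \<open>One inequality at the start of a positive sender suffices: its first edge is glued onto
  one edge of an unequal cherry, and the other edge of the cherry takes over as first edge.\<close>

lemma negative_sender: "\<exists>(S :: nat set set) e f. sender False S e f"
proof -
  obtain S :: "nat set set" and e f where S: "edge_graph S" "colourable S" "e \<in> S" "f \<in> S"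
    and eq: "\<And>c. valid S c \<Longrightarrow> c e = c f"
    and "\<exists>l. (\<forall>v\<in>e. l v = 0) \<and> (\<forall>v\<in>f. h < l v) \<and> lipschitz_off {} S l"
    using positive_sender unfolding sender_def by blast
  then obtain l where l: "\<forall>v\<in>e. l v = 0" "\<forall>v\<in>f. h < l v" "lipschitz_off {} S l" by blast
  obtain B :: "nat set set" and u a b where B: "edge_graph B" "colourable B" "distinct [u, a, b]"
    "{u, a} \<in> B" "{u, b} \<in> B" and ne: "\<And>c. valid B c \<Longrightarrow> c {u, a} \<noteq> c {u, b}"
    by (rule unequal_cherry) blast
  obtain e1 e2 where e: "e = {e1, e2}" "e1 \<noteq> e2" using S(1,3) by (rule edge_graphD)
  have "u \<noteq> a" "{e1, e2} \<in> S" using B(3) S(3) e by auto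
  then obtain g where g: "inj_on g (\<Union>S)" "g e1 = u" "g e2 = a" "g ` (\<Union>S - {e1, e2}) \<inter> \<Union>B = {}"
      "colourable (B \<union> (`) g ` S)"
    using edge_attach[OF B(1,2,4) _ S(1,2) _ e(2)] by blast
  let ?N = "B \<union> (`) g ` S"
  \<comment> \<open>The whole cherry graph is put at level 0, which fits the sender because they
    share only the vertices of \<open>e\<close>.\<close>
  define l' where "l' v = (if v \<in> \<Union>B then 0 else l (inv_into (\<Union>S) g v))" for v
  have l'g: "l' (g w) = l w" if w: "w \<in> \<Union>S" for w
  proof (cases "g w \<in> \<Union>B")
    case True
    then have "w \<in> e" using g(4) w e(1) by blast
    then show ?thesis using True l(1) by (simp add: l'_def)
  next
    case False
    then show ?thesis using inv_into_f_f[OF g(1) w] by (simp add: l'_def)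
  qed
  have "lipschitz_off {} B (\<lambda>_. 0)" by (simp add: lipschitz_off_def)
  then have "lipschitz_off {} B l'" by (rule lipschitz_off_cong) (simp add: l'_def)
  moreover have "lipschitz_off {} ((`) g ` S) l'" using lipschitz_off_image[OF S(1) l(3)] l'g by blast
  ultimately have "lipschitz_off {} ?N l'" by (rule lipschitz_off_Un)
  moreover have "u \<in> \<Union>B" "b \<in> \<Union>B" using B(5) by auto
  then have "\<forall>v\<in>{u, b}. l' v = 0" by (simp add: l'_def)
  moreover have "\<forall>v\<in>g ` f. h < l' v"
  proof
    fix v assume "v \<in> g ` f"
    then obtain w where w: "w \<in> f" "v = g w" by blast
    then have "w \<in> \<Union>S" using S(4) by blast
    then show "h < l' v" using l'g l(2) w by simp
  qed
  ultimately have far: "\<exists>l. (\<forall>v\<in>{u, b}. l v = 0) \<and> (\<forall>v\<in>g ` f. h < l v) \<and> lipschitz_off {} ?N l" by blast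
  have "c {u, b} \<noteq> c (g ` f)" if c: "valid ?N c" for c
  proof -
    note v = valid_attached[OF g(1) c]
    have "c (g ` e) = c (g ` f)" using eq[OF v(2)] .
    then show ?thesis using ne[OF v(1)] e(1) g(2,3) by simp
  qed
  moreover have "edge_graph ?N" using B(1) edge_graph_image[OF S(1) g(1)] by (rule edge_graph_Un)
  moreover have "g ` f \<in> ?N" using S(4) by blast
  ultimately show ?thesis unfolding sender_def using far g(5) B(5)
    by (intro exI[of _ ?N] exI[of _ "{u, b}"] exI[of _ "g ` f"]) simp
qed

lemma sender_exists: "\<exists>(S :: nat set set) e f. sender s S e f"
  using positive_sender negative_sender by (cases s) auto

text \<open>A sender constrains nothing but equality: permuting colours turns one valid colouring
  into one with any pair of signal colours that is equal or unequal as \<open>s\<close>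
  demands.\<close>

lemma sender_colouring:
  assumes "sender s S e f" "\<alpha> \<in> {1..q}" "\<beta> \<in> {1..q}" "\<alpha> = \<beta> \<longleftrightarrow> s"
  obtains c where "valid S c" "c e = \<alpha>" "c f = \<beta>"
proof -
  have S: "e \<in> S" "f \<in> S" and eq: "\<And>c. valid S c \<Longrightarrow> c e = c f \<longleftrightarrow> s"
    using assms(1) by (auto simp: sender_def)
  obtain c where c: "valid S c" using assms(1) by (auto simp: sender_def colourable_def)
  show thesis
  proof (cases s)
    case True
    obtain d where "valid S d" "d e = \<alpha>" using valid_recolour[OF c assms(2) S(1)] by metis
    then show thesis using that eq True assms(4) by metis
  next
    case False
    then have "c e \<noteq> c f" "\<alpha> \<noteq> \<beta>" using eq[OF c] assms(4) by auto
    moreover have "{c e, c f, \<alpha>, \<beta>} \<subseteq> {1..q}"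
      using valid_range[OF c] S assms(2,3) by auto
    ultimately obtain \<pi> where "inj_on \<pi> {1..q}" "\<pi> ` {1..q} \<subseteq> {1..q}" "\<pi> (c e) = \<alpha>" "\<pi> (c f) = \<beta>"
      by (rule relabel_two)
    then show thesis using that[of "\<pi> \<circ> c"] valid_permute[OF c] by simp
  qed
qed

lemma other_colour:
  obtains \<beta> where "\<beta> \<in> {1..q}" "\<beta> \<noteq> \<alpha>"
proof (cases "\<alpha> = 1")
  case True
  then show thesis using that[of 2] q_ge_2 by simp
next
  case False
  then show thesis using that[of 1] q_ge_2 by simp
qed

text \<open>\<open>D\<close> is a set of edges that may be deleted; deleting \<open>a\<close> or \<open>b\<close> switches the constraint
  off.\<close>

lemma attach_sender:
  fixes E :: "nat set set"
  assumes E: "edge_graph E" and a: "a \<in> E" and b: "b \<in> E" and ab: "a \<inter> b = {}"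
  obtains E' where "E \<subseteq> E'" "edge_graph E'" "\<And>x. x \<in> E' \<Longrightarrow> x \<subseteq> \<Union>E \<Longrightarrow> x \<in> E"
    "\<And>c. valid E' c \<Longrightarrow> c a = c b \<longleftrightarrow> s"
    "\<And>D c. D \<subseteq> E \<Longrightarrow> valid (E - D) c \<Longrightarrow> (a \<notin> D \<Longrightarrow> b \<notin> D \<Longrightarrow> c a = c b \<longleftrightarrow> s) \<Longrightarrow>
       \<exists>c'. valid (E' - D) c' \<and> (\<forall>x\<in>E - D. c' x = c x)"
proof -
  obtain S :: "nat set set" and e f where send: "sender s S e f" using sender_exists by blast
  then have S: "edge_graph S" "e \<in> S" "f \<in> S" and eq: "\<And>c. valid S c \<Longrightarrow> c e = c f \<longleftrightarrow> s"
    by (auto simp: sender_def)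
  obtain l where l: "\<And>v. v \<in> e \<Longrightarrow> l v = 0" "\<And>v. v \<in> f \<Longrightarrow> h < l v" "lipschitz_off {} S l"
    using send unfolding sender_def by blast
  have ef: "e \<inter> f = {}" using l(1,2) by fastforce
  obtain e1 e2 where e: "e = {e1, e2}" "e1 \<noteq> e2" using S(1,2) by (rule edge_graphD)
  obtain f1 f2 where f: "f = {f1, f2}" "f1 \<noteq> f2" using S(1,3) by (rule edge_graphD)
  obtain a1 a2 where a': "a = {a1, a2}" "a1 \<noteq> a2" using E a by (rule edge_graphD)
  obtain b1 b2 where b': "b = {b1, b2}" "b1 \<noteq> b2" using E b by (rule edge_graphD)
  have sub: "set [e1, e2, f1, f2] \<subseteq> \<Union>S" using S(2,3) e f by auto
  have dist: "distinct [e1, e2, f1, f2]" "distinct [a1, a2, b1, b2]"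
    using e f a' b' ef ab by auto
  obtain g where g: "inj_on g (\<Union>S)" "map g [e1, e2, f1, f2] = [a1, a2, b1, b2]"
      "g ` (\<Union>S - set [e1, e2, f1, f2]) \<inter> \<Union>E = {}"
    by (rule fresh_extension[OF finite_Union_edge_graph[OF S(1)] finite_Union_edge_graph[OF E] dist _ sub]) simp
  let ?S = "(`) g ` S"
  have grS: "edge_graph ?S" using S(1) g(1) by (rule edge_graph_image)
  have ge: "g ` e = a" and gf: "g ` f = b" using g(2) e f a' b' by auto
  define m where "m v = l (inv_into (\<Union>S) g v)" for v
  have mg: "m (g w) = l w" if "w \<in> \<Union>S" for w
    unfolding m_def using inv_into_f_f[OF g(1) that] by simp
  have ma: "m v = 0" if "v \<in> a" for v
  proof -
    from that ge obtain w where w: "w \<in> e" "v = g w" by blast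
    then have "w \<in> \<Union>S" using S(2) by blast
    then show ?thesis using mg l(1) w by simp
  qed
  have mb: "h < m v" if "v \<in> b" for v
  proof -
    from that gf obtain w where w: "w \<in> f" "v = g w" by blast
    then have "w \<in> \<Union>S" using S(3) by blast
    then show ?thesis using mg l(2) w by simp
  qed
  have mlip: "m w \<le> m v + 1" if "{v, w} \<in> ?S" for v w
    using lipschitz_off_image[OF S(1) l(3), of m g] mg that unfolding lipschitz_off_def by blast
  have meet: "\<Union>?S \<inter> \<Union>E \<subseteq> a \<union> b"
  proof
    fix v assume v: "v \<in> \<Union>?S \<inter> \<Union>E"
    then obtain w where w: "w \<in> \<Union>S" "v = g w" by auto
    then have "w \<in> set [e1, e2, f1, f2]" using g(3) v by blast
    then have "w \<in> e \<union> f" using e f by auto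
    then show "v \<in> a \<union> b" using w(2) ge gf by blast
  qed
  have small: "x = y" if "x \<subseteq> y" "card x = 2" "card y = 2" for x y :: "nat set"
    using that by (metis card_subset_eq card.infinite zero_neq_numeral)
  have card2: "card a = 2" "card b = 2" using E a b by (auto simp: edge_graph_def)
  have only: "x = a \<or> x = b" if x: "x \<in> ?S" "x \<subseteq> a \<union> b" for x
  proof -
    obtain v w where vw: "x = {v, w}" using grS x(1) by (rule edge_graphD)
    have "{v, w} \<in> ?S" "{w, v} \<in> ?S" using x vw by (auto simp: insert_commute)
    then have "m w \<le> m v + 1" "m v \<le> m w + 1" using mlip by auto
    then have "x \<subseteq> a \<or> x \<subseteq> b"
      using x(2) vw ma[of v] ma[of w] mb[of v] mb[of w] card_HV by fastforce
    moreover have "card x = 2" using grS x(1) by (auto simp: edge_graph_def)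
    ultimately show ?thesis using small card2 by blast
  qed
  have aS: "a \<in> ?S" "b \<in> ?S" using S(2,3) ge gf by blast+
  show thesis
  proof (rule that[of "E \<union> ?S"])
    show "edge_graph (E \<union> ?S)" using E grS by (rule edge_graph_Un)
    show "x \<in> E" if "x \<in> E \<union> ?S" "x \<subseteq> \<Union>E" for x
    proof (cases "x \<in> E")
      case False
      then have xS: "x \<in> ?S" using that(1) by blast
      then have "x \<subseteq> \<Union>?S \<inter> \<Union>E" using that(2) by blast
      then show ?thesis using only[OF xS] meet a b by blast
    qed
    show "c a = c b \<longleftrightarrow> s" if "valid (E \<union> ?S) c" for c
      using eq[OF valid_attached(2)[OF g(1) that]] ge gf by simp
    show "\<exists>c'. valid (E \<union> ?S - D) c' \<and> (\<forall>x\<in>E - D. c' x = c x)"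
      if D: "D \<subseteq> E" and c: "valid (E - D) c" and cs: "a \<notin> D \<Longrightarrow> b \<notin> D \<Longrightarrow> c a = c b \<longleftrightarrow> s" for D c
    proof -
      have rng: "a \<notin> D \<Longrightarrow> c a \<in> {1..q}" "b \<notin> D \<Longrightarrow> c b \<in> {1..q}"
        using valid_range[OF c] a b by auto
      have one: "\<exists>\<beta>\<in>{1..q}. \<alpha> = \<beta> \<longleftrightarrow> s" if "\<alpha> \<in> {1..q}" for \<alpha>
      proof (cases s)
        case True
        then show ?thesis using that by blast
      next
        case False
        obtain \<beta> where "\<beta> \<in> {1..q}" "\<beta> \<noteq> \<alpha>" by (rule other_colour)
        then show ?thesis using False by metis
      qed
      \<comment> \<open>A deleted signal edge has no colour to respect, so the sender may give it
        any colour that meets its own constraint.\<close>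
      have "\<exists>\<alpha>\<in>{1..q}. \<exists>\<beta>\<in>{1..q}. (\<alpha> = \<beta> \<longleftrightarrow> s) \<and> (a \<notin> D \<longrightarrow> \<alpha> = c a) \<and> (b \<notin> D \<longrightarrow> \<beta> = c b)"
      proof (cases "a \<in> D")
        case True
        define \<beta> where "\<beta> = (if b \<in> D then 1 else c b)"
        have "\<beta> \<in> {1..q}" using rng(2) q_ge_2 by (auto simp: \<beta>_def)
        then obtain \<alpha> where "\<alpha> \<in> {1..q}" "\<beta> = \<alpha> \<longleftrightarrow> s" using one by blast
        then show ?thesis using True \<open>\<beta> \<in> {1..q}\<close> by (intro bexI[of _ \<alpha>] bexI[of _ \<beta>]) (auto simp: \<beta>_def)
      next
        case False
        then have ca: "c a \<in> {1..q}" using rng(1) by blast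
        show ?thesis
        proof (cases "b \<in> D")
          case True
          then show ?thesis using one[OF ca] ca by blast
        next
          case nb: False
          then show ?thesis using cs[OF False nb] ca rng(2)[OF nb] by blast
        qed
      qed
      then obtain \<alpha> \<beta> where col: "\<alpha> \<in> {1..q}" "\<beta> \<in> {1..q}" "\<alpha> = \<beta> \<longleftrightarrow> s"
        and \<alpha>\<beta>: "a \<notin> D \<longrightarrow> \<alpha> = c a" "b \<notin> D \<longrightarrow> \<beta> = c b" by blast
      obtain d0 where d0: "valid S d0" "d0 e = \<alpha>" "d0 f = \<beta>"
        using sender_colouring[OF send col] by blast
      obtain d where d: "valid ?S d" "\<And>e. e \<in> S \<Longrightarrow> d (g ` e) = d0 e"
        using valid_push[OF g(1) d0(1)] by blast
      have dab: "d a = \<alpha>" "d b = \<beta>" using d(2)[OF S(2)] d(2)[OF S(3)] d0 ge gf by auto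
      \<comment> \<open>\<open>D\<close> may contain \<open>a\<close> or \<open>b\<close>, which
        belong to both sides, so it is removed from the sender as well.\<close>
      let ?E1 = "E - D" and ?E2 = "?S - D"
      have gr: "edge_graph ?E1" "edge_graph ?E2" using E grS by (auto intro: edge_graph_mono)
      have meet': "\<Union>?E1 \<inter> \<Union>?E2 \<subseteq> a \<union> b" using meet by blast
      define T where "T i = (if i then a else b)" for i :: bool
      have split: "copy \<phi> ?E1 \<or> copy \<phi> ?E2" if "copy \<phi> (?E1 \<union> ?E2)" for \<phi> :: "'a \<Rightarrow> nat"
      proof (rule copy_in_glued[where U = "{}" and I = UNIV and T = T, OF gr])
        show "\<Union>?E1 \<inter> \<Union>?E2 \<subseteq> {} \<union> (\<Union>i\<in>UNIV. T i)" using meet' by (auto simp: T_def UNIV_bool)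
        show "finite (T i) \<and> card ({} \<union> T i) \<le> 2" for i
          using card2 a' b' by (simp add: T_def)
        show "x \<in> ?E1 \<longleftrightarrow> x \<in> ?E2" if "x \<subseteq> {} \<union> T i" for x i
        proof -
          have "x = T i" if "card x = 2" using small[of x "T i"] \<open>x \<subseteq> {} \<union> T i\<close> card2 that by (auto simp: T_def)
          moreover have "x \<in> E \<Longrightarrow> card x = 2" "x \<in> ?S \<Longrightarrow> card x = 2"
            using E grS unfolding edge_graph_def by blast+
          moreover have "T i \<in> E" "T i \<in> ?S" using a b aS by (auto simp: T_def)
          ultimately show ?thesis by (metis DiffD1 DiffD2 DiffI)
        qed
        show "\<exists>l. (\<forall>v\<in>T i. l v = 0) \<and> (\<forall>j\<in>UNIV - {i}. \<forall>v\<in>T j. h < l v) \<and>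
            (\<forall>x y. {x, y} \<in> ?E2 \<longrightarrow> x \<notin> {} \<longrightarrow> y \<notin> {} \<longrightarrow> l y \<le> l x + 1)" for i
        proof (cases i)
          case True
          then show ?thesis using ma mb mlip by (intro exI[of _ m]) (auto simp: T_def UNIV_bool)
        next
          case False
          \<comment> \<open>Levels seen from \<open>b\<close> are obtained by reversal: truncated
            subtraction gives 0 on \<open>b\<close>, where \<open>m\<close> exceeds
            \<open>h\<close>, and \<open>h + 1\<close> on \<open>a\<close>.\<close>
          have "(h + 1) - m y \<le> (h + 1) - m x + 1" if "{x, y} \<in> ?S" for x y
            using mlip[of y x] that by (simp add: insert_commute)
          then show ?thesis using ma mb False
            by (intro exI[of _ "\<lambda>v. (h + 1) - m v"]) (force simp: T_def UNIV_bool)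
        qed
      qed (use that in auto)
      have agree: "c x = d x" if x: "x \<in> ?E1" "x \<in> ?E2" for x
      proof -
        have "x \<subseteq> a \<union> b" using x meet by blast
        then have "x = a \<or> x = b" using only x(2) by blast
        then show ?thesis using x \<alpha>\<beta> dab by auto
      qed
      have "valid (?E1 \<union> ?E2) (\<lambda>x. if x \<in> ?E1 then c x else d x)"
        by (rule valid_glue) (use split c valid_mono[OF d(1), of ?E2] agree in auto)
      moreover have "?E1 \<union> ?E2 = E \<union> ?S - D" by blast
      ultimately show ?thesis by (intro exI[of _ "\<lambda>x. if x \<in> ?E1 then c x else d x"]) simp
    qed
  qed simp
qed

definition obeys :: "(nat set \<times> nat set \<times> bool) set \<Rightarrow> nat set set \<Rightarrow> (nat set \<Rightarrow> nat) \<Rightarrow> bool" where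
  "obeys K D c \<longleftrightarrow> (\<forall>a b s. (a, b, s) \<in> K \<longrightarrow> a \<notin> D \<longrightarrow> b \<notin> D \<longrightarrow> (c a = c b \<longleftrightarrow> s))"

text \<open>No new edge falls inside the old vertex set; this is what later keeps \<open>F\<close>
  induced. Deletions are restricted to \<open>E\<close>, so all senders remain intact except
  possibly for their signal edges.\<close>

lemma attach_senders:
  fixes E :: "nat set set"
  assumes E: "edge_graph E" and "finite K"
    and "\<And>a b s. (a, b, s) \<in> K \<Longrightarrow> a \<in> E \<and> b \<in> E \<and> a \<inter> b = {}"
  obtains E' where "E \<subseteq> E'" "edge_graph E'" "\<And>x. x \<in> E' \<Longrightarrow> x \<subseteq> \<Union>E \<Longrightarrow> x \<in> E"
    "\<And>c. valid E' c \<Longrightarrow> obeys K {} c"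
    "\<And>D c. D \<subseteq> E \<Longrightarrow> valid (E - D) c \<Longrightarrow> obeys K D c \<Longrightarrow>
       \<exists>c'. valid (E' - D) c' \<and> (\<forall>x\<in>E - D. c' x = c x)"
proof -
  define good where "good K E' \<longleftrightarrow> E \<subseteq> E' \<and> edge_graph E' \<and> (\<forall>x\<in>E'. x \<subseteq> \<Union>E \<longrightarrow> x \<in> E) \<and>
      (\<forall>c. valid E' c \<longrightarrow> obeys K {} c) \<and>
      (\<forall>D c. D \<subseteq> E \<longrightarrow> valid (E - D) c \<longrightarrow> obeys K D c \<longrightarrow>
         (\<exists>c'. valid (E' - D) c' \<and> (\<forall>x\<in>E - D. c' x = c x)))" for K E'
  have "\<exists>E'. good K E'"
    using assms(2,3)
  proof (induction K rule: finite_induct)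
    case empty
    show ?case using E by (intro exI[of _ E]) (auto simp: obeys_def good_def)
  next
    case (insert k K)
    obtain a b s where k: "k = (a, b, s)" by (cases k)
    have "\<exists>E'. good K E'" by (rule insert.IH) (use insert.prems in blast)
    then obtain E1 where gE1: "good K E1" by blast
    have E1: "E \<subseteq> E1" "edge_graph E1" "\<And>x. x \<in> E1 \<Longrightarrow> x \<subseteq> \<Union>E \<Longrightarrow> x \<in> E"
      "\<And>c. valid E1 c \<Longrightarrow> obeys K {} c"
      "\<And>D c. D \<subseteq> E \<Longrightarrow> valid (E - D) c \<Longrightarrow> obeys K D c \<Longrightarrow>
         \<exists>c'. valid (E1 - D) c' \<and> (\<forall>x\<in>E - D. c' x = c x)"
      using gE1 by (auto simp: good_def)
    have ab: "a \<in> E" "b \<in> E" "a \<inter> b = {}" using insert.prems[of a b s] k by auto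
    then have "a \<in> E1" "b \<in> E1" using E1(1) by auto
    then obtain E2 where E2: "E1 \<subseteq> E2" "edge_graph E2" "\<And>x. x \<in> E2 \<Longrightarrow> x \<subseteq> \<Union>E1 \<Longrightarrow> x \<in> E1"
      "\<And>c. valid E2 c \<Longrightarrow> c a = c b \<longleftrightarrow> s"
      "\<And>D c. D \<subseteq> E1 \<Longrightarrow> valid (E1 - D) c \<Longrightarrow> (a \<notin> D \<Longrightarrow> b \<notin> D \<Longrightarrow> c a = c b \<longleftrightarrow> s) \<Longrightarrow>
       \<exists>c'. valid (E2 - D) c' \<and> (\<forall>x\<in>E1 - D. c' x = c x)"
      using attach_sender[OF E1(2) _ _ ab(3), of s] by metis
    show ?case
      unfolding good_def
    proof (intro exI[of _ E2] conjI ballI allI impI)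
      show "E \<subseteq> E2" using E1(1) E2(1) by blast
      show "edge_graph E2" by (rule E2(2))
      show "x \<in> E" if "x \<in> E2" "x \<subseteq> \<Union>E" for x
        using E1(3)[of x] E2(3)[of x] that E1(1) by blast
      show "obeys (insert k K) {} c" if c: "valid E2 c" for c
        using E1(4)[OF valid_mono[OF c E2(1)]] E2(4)[OF c] k by (auto simp: obeys_def)
      show "\<exists>c'. valid (E2 - D) c' \<and> (\<forall>x\<in>E - D. c' x = c x)"
        if D: "D \<subseteq> E" and c: "valid (E - D) c" and r: "obeys (insert k K) D c" for D c
      proof -
        have "obeys K D c" using r by (auto simp: obeys_def)
        then obtain c1 where c1: "valid (E1 - D) c1" "\<forall>x\<in>E - D. c1 x = c x" using E1(5)[OF D c] by blast
        have "c1 a = c1 b \<longleftrightarrow> s" if "a \<notin> D" "b \<notin> D"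
          using r that ab c1(2) k by (simp add: obeys_def)
        then obtain c2 where "valid (E2 - D) c2" "\<forall>x\<in>E1 - D. c2 x = c1 x"
          using E2(5)[OF order_trans[OF D E1(1)] c1(1)] by blast
        then show ?thesis using c1(2) E1(1) by (intro exI[of _ c2]) auto
      qed
    qed
  qed
  then obtain E' where "good K E'" by blast
  then show thesis by (intro that[of E']) (auto simp: good_def)
qed

section \<open>Making all edges of a graph critical\<close>

lemma valid_disjoint:
  fixes E1 E2 :: "nat set set"
  assumes "edge_graph E1" "edge_graph E2" "\<Union>E1 \<inter> \<Union>E2 = {}" "valid E1 c1" "valid E2 c2"
  shows "valid (E1 \<union> E2) (\<lambda>e. if e \<in> E1 then c1 e else c2 e)"
proof (rule valid_glue[OF _ assms(4,5)])
  fix \<phi> :: "'a \<Rightarrow> nat" assume "copy \<phi> (E1 \<union> E2)"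
  then show "copy \<phi> E1 \<or> copy \<phi> E2"
    using copy_in_glued[where U = "{}" and I = "{} :: unit set" and T = "\<lambda>_. {}", OF assms(1,2)] assms(3)
    by simp
next
  fix e assume e: "e \<in> E1" "e \<in> E2"
  then have "e = {}" using assms(3) by blast
  moreover have "card e = 2" using e(1) assms(1) by (auto simp: edge_graph_def)
  ultimately show "c1 e = c2 e" by simp
qed

lemma valid_matching:
  assumes "\<And>x y. x \<in> N \<Longrightarrow> y \<in> N \<Longrightarrow> x \<noteq> y \<Longrightarrow> x \<inter> y = {}" "d ` N \<subseteq> {1..q}"
  shows "valid N d"
proof -
  have False if cp: "copy \<phi> N" for \<phi>
  proof -
    obtain p where p: "p \<in> HV" using card_HV by fastforce
    obtain x y where xy: "x \<noteq> y" "{p, x} \<in> HE" "{p, y} \<in> HE" by (rule two_neighbours[OF p])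
    have im: "\<phi> ` {p, x} \<in> N" "\<phi> ` {p, y} \<in> N" using cp xy unfolding copy_def by blast+
    have "\<phi> ` {p, x} \<noteq> \<phi> ` {p, y}"
    proof
      assume "\<phi> ` {p, x} = \<phi> ` {p, y}"
      moreover have "inj_on \<phi> HV" using cp by (simp add: copy_def)
      ultimately have "{p, x} = {p, y}" using HE_edges xy by (metis inj_on_image_eq_iff)
      then show False using xy(1) by (simp add: doubleton_eq_iff)
    qed
    then have "\<phi> ` {p, x} \<inter> \<phi> ` {p, y} = {}" by (rule assms(1)[OF im])
    then show False by simp
  qed
  then show ?thesis using assms(2) unfolding valid_def by blast
qed

text \<open>A graph with exactly as many edges as \<open>H\<close> is used up by any copy, so as a
  clause it forbids nothing but a constant colouring of all its edges.\<close>

lemma copy_of_full_size: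
  assumes "copy \<phi> N" "finite N" "card N = card HE"
  shows "(`) \<phi> ` HE = N"
proof (rule card_subset_eq[OF assms(2)])
  show "(`) \<phi> ` HE \<subseteq> N" using assms(1) by (auto simp: copy_def)
  have "inj_on \<phi> HV" using assms(1) by (simp add: copy_def)
  then have "inj_on ((`) \<phi>) HE" using HE_edges by (intro inj_onI) (metis inj_on_image_eq_iff)
  then show "card ((`) \<phi> ` HE) = card N" using assms(3) by (simp add: card_image)
qed

text \<open>This is the pattern of every gadget: new edges \<open>N\<close> are placed apart from
  \<open>E\<close>, take any valid colouring of their own, and interact with \<open>E\<close>
  through the senders in \<open>K\<close> alone.\<close>

lemma extend_graph:
  fixes E N :: "nat set set"
  assumes E: "edge_graph E" and N: "edge_graph N" and EN: "\<Union>E \<inter> \<Union>N = {}" and K: "finite K"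
    "\<And>a b s. (a, b, s) \<in> K \<Longrightarrow> a \<in> E \<union> N \<and> b \<in> E \<union> N \<and> a \<inter> b = {}"
  obtains E' where "E \<subseteq> E'" "N \<subseteq> E'" "edge_graph E'"
    "\<And>x. x \<in> E' \<Longrightarrow> x \<subseteq> \<Union>E \<Longrightarrow> x \<in> E"
    "\<And>c. valid E' c \<Longrightarrow> obeys K {} c"
    "\<And>D c d. D \<subseteq> E \<Longrightarrow> valid (E - D) c \<Longrightarrow> valid N d \<Longrightarrow> obeys K D (\<lambda>x. if x \<in> N then d x else c x) \<Longrightarrow>
       \<exists>c'. valid (E' - D) c' \<and> (\<forall>x\<in>E - D. c' x = c x) \<and> (\<forall>x\<in>N. c' x = d x)"
proof -
  have disj: "E \<inter> N = {}"
  proof -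
    have "x \<noteq> {}" if "x \<in> N" for x using N that by (auto simp: edge_graph_def)
    then show ?thesis using EN by blast
  qed
  obtain E' where E': "E \<union> N \<subseteq> E'" "edge_graph E'" "\<And>x. x \<in> E' \<Longrightarrow> x \<subseteq> \<Union>(E \<union> N) \<Longrightarrow> x \<in> E \<union> N"
    "\<And>c. valid E' c \<Longrightarrow> obeys K {} c"
    and ext: "\<And>D c. D \<subseteq> E \<union> N \<Longrightarrow> valid (E \<union> N - D) c \<Longrightarrow> obeys K D c \<Longrightarrow>
       \<exists>c'. valid (E' - D) c' \<and> (\<forall>x\<in>E \<union> N - D. c' x = c x)"
    using attach_senders[OF edge_graph_Un[OF E N] K(1)] K(2) by metis
  show thesis
  proof (rule that[of E'])
    show "x \<in> E" if "x \<in> E'" "x \<subseteq> \<Union>E" for x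
    proof -
      have "x \<in> E \<union> N" using E'(3) that by auto
      moreover have "x \<notin> N"
      proof
        assume "x \<in> N"
        then have "x = {}" using that(2) EN by blast
        then show False using \<open>x \<in> N\<close> N by (auto simp: edge_graph_def)
      qed
      ultimately show ?thesis by blast
    qed
    fix D c d
    assume D: "D \<subseteq> E" and c: "valid (E - D) c" and d: "valid N d"
      and r: "obeys K D (\<lambda>x. if x \<in> N then d x else c x)"
    have "\<Union>N \<inter> \<Union>(E - D) = {}" using EN by blast
    then have "valid (N \<union> (E - D)) (\<lambda>x. if x \<in> N then d x else c x)"
      using valid_disjoint[OF N edge_graph_mono[OF E Diff_subset] _ d c] by blast
    moreover have "N \<union> (E - D) = E \<union> N - D" using D disj by blast
    moreover have "D \<subseteq> E \<union> N" using D by blast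
    ultimately obtain c' where c': "valid (E' - D) c'" "\<forall>x\<in>E \<union> N - D. c' x = (if x \<in> N then d x else c x)"
      using ext[OF _ _ r] by metis
    have "c' x = d x" if "x \<in> N" for x
    proof -
      have "x \<in> E \<union> N - D" using that disj D by blast
      then show ?thesis using c'(2) that by simp
    qed
    then show "\<exists>c'. valid (E' - D) c' \<and> (\<forall>x\<in>E - D. c' x = c x) \<and> (\<forall>x\<in>N. c' x = d x)"
      using disj c' by (intro exI[of _ c']) auto
  qed (use E' in auto)
qed

text \<open>Witnesses for criticality are kept in a normal form, with \<open>c0\<close> on what is
  left of \<open>FE\<close> and colour \<open>i\<close> on the reference edge \<open>r i\<close>, so
  that each gadget can extend a witness without knowing how it arose.\<close>

definition follows ::
  "nat set set \<Rightarrow> (nat set \<Rightarrow> nat) \<Rightarrow> (nat \<Rightarrow> nat set) \<Rightarrow> nat set set \<Rightarrow> nat set \<Rightarrow> (nat set \<Rightarrow> nat) \<Rightarrow> bool"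
where
  "follows FE c0 r E e c \<longleftrightarrow>
     valid (E - {e}) c \<and> (\<forall>x\<in>FE - {e}. c x = c0 x) \<and> (\<forall>i\<in>{1..q}. c (r i) = i)"

text \<open>The edge \<open>r i\<close> stands for the colour \<open>i\<close>, and \<open>t\<close> carries the truth value of ``all edges in
  \<open>dn\<close> are present'', with \<open>\<tau>\<close> as the colour for truth: \<open>t\<close> is forced to have colour \<open>\<tau>\<close>, but not
  any more once an edge of \<open>dn\<close> is deleted.\<close>

definition stage ::
  "nat set set \<Rightarrow> (nat set \<Rightarrow> nat) \<Rightarrow> (nat \<Rightarrow> nat set) \<Rightarrow> nat set set \<Rightarrow> nat set \<Rightarrow> nat \<Rightarrow> nat set set \<Rightarrow> bool"
where
  "stage FE c0 r E t \<tau> dn \<longleftrightarrow>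
     edge_graph E \<and> FE \<subseteq> E \<and> (\<forall>x\<in>E. x \<subseteq> \<Union>FE \<longrightarrow> x \<in> FE) \<and>
     (\<forall>i\<in>{1..q}. r i \<in> E \<and> r i \<inter> \<Union>FE = {} \<and> t \<inter> r i = {}) \<and>
     t \<in> E \<and> t \<inter> \<Union>FE = {} \<and> \<tau> \<in> {1..q} \<and> dn \<subseteq> FE \<and>
     (\<forall>c. valid E c \<longrightarrow> inj_on (\<lambda>i. c (r i)) {1..q}) \<and>
     (\<forall>c. valid E c \<longrightarrow> (\<forall>i\<in>{1..q}. c (r i) = i) \<longrightarrow> c t = \<tau> \<and> (\<forall>x\<in>FE. c x = c0 x)) \<and>
     (\<forall>e\<in>FE - dn. \<exists>c. follows FE c0 r E e c \<and> c t = \<tau>) \<and>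
     (\<forall>e\<in>dn. \<exists>c. follows FE c0 r E e c \<and> c t \<noteq> \<tau>)"

lemma fresh_edge:
  fixes E :: "nat set set"
  assumes "edge_graph E"
  obtains s :: "nat set" where "card s = 2" "\<Union>E \<inter> s = {}"
proof -
  define M where "M = Suc (Max (insert 0 (\<Union>E)))"
  have "x < M" if "x \<in> \<Union>E" for x
    using that finite_Union_edge_graph[OF assms] by (simp add: M_def less_Suc_eq_le)
  then have "\<Union>E \<inter> {M, Suc M} = {}" by auto (metis Suc_lessD less_irrefl)+
  then show thesis using that[of "{M, Suc M}"] by simp
qed

lemma edge_neq_deleted:
  assumes "e \<in> FE" "edge_graph E" "x \<in> E" "x \<inter> \<Union>FE = {}"
  shows "x \<noteq> e"
proof
  assume "x = e"
  then have "x = {}" using assms(1,4) by blast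
  then show False using assms(2,3) by (auto simp: edge_graph_def)
qed

text \<open>A new edge \<open>s\<close> must differ from \<open>t\<close> and from all reference
  edges except those of \<tau> and \<delta>. If \<open>t\<close> has colour \<tau>, then
  \<open>s\<close> is left with \<delta>; otherwise \<open>s\<close> may take \<tau>, which now
  means falsity.\<close>

lemma change_truth_colour:
  assumes st: "stage FE c0 r E t \<tau> dn" and \<delta>: "\<delta> \<in> {1..q}" "\<delta> \<noteq> \<tau>"
  obtains E' s where "stage FE c0 r E' s \<delta> dn"
proof -
  have E: "edge_graph E" "FE \<subseteq> E" "\<forall>x\<in>E. x \<subseteq> \<Union>FE \<longrightarrow> x \<in> FE"
    and r: "\<And>i. i \<in> {1..q} \<Longrightarrow> r i \<in> E \<and> r i \<inter> \<Union>FE = {}"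
    and t: "t \<in> E" "t \<inter> \<Union>FE = {}" and \<tau>: "\<tau> \<in> {1..q}" and dn: "dn \<subseteq> FE"
    and inj: "\<And>c. valid E c \<Longrightarrow> inj_on (\<lambda>i. c (r i)) {1..q}"
    and forced: "\<And>c. valid E c \<Longrightarrow> (\<forall>i\<in>{1..q}. c (r i) = i) \<Longrightarrow> c t = \<tau> \<and> (\<forall>x\<in>FE. c x = c0 x)"
    and todo: "\<And>e. e \<in> FE - dn \<Longrightarrow> \<exists>c. follows FE c0 r E e c \<and> c t = \<tau>"
    and freed: "\<And>e. e \<in> dn \<Longrightarrow> \<exists>c. follows FE c0 r E e c \<and> c t \<noteq> \<tau>"
    using st unfolding stage_def by auto
  obtain s :: "nat set" where s: "card s = 2" "\<Union>E \<inter> s = {}" by (rule fresh_edge[OF E(1)])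
  define K where "K = insert (s, t, False) ((\<lambda>i. (s, r i, False)) ` ({1..q} - {\<tau>, \<delta>}))"
  have sE: "s \<inter> x = {}" "s \<noteq> x" if "x \<in> E" for x
  proof -
    show "s \<inter> x = {}" using s(2) that by blast
    then show "s \<noteq> x" using s(1) by auto
  qed
  obtain E' where E': "E \<subseteq> E'" "{s} \<subseteq> E'" "edge_graph E'" "\<And>x. x \<in> E' \<Longrightarrow> x \<subseteq> \<Union>E \<Longrightarrow> x \<in> E"
    "\<And>c. valid E' c \<Longrightarrow> obeys K {} c"
    and ext: "\<And>D c d. D \<subseteq> E \<Longrightarrow> valid (E - D) c \<Longrightarrow> valid {s} d \<Longrightarrow>
       obeys K D (\<lambda>x. if x \<in> {s} then d x else c x) \<Longrightarrow>
       \<exists>c'. valid (E' - D) c' \<and> (\<forall>x\<in>E - D. c' x = c x) \<and> (\<forall>x\<in>{s}. c' x = d x)"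
  proof (rule extend_graph[OF E(1), of "{s}" K])
    show "edge_graph {s}" using s(1) by (simp add: edge_graph_def)
    show "a \<in> E \<union> {s} \<and> b \<in> E \<union> {s} \<and> a \<inter> b = {}" if "(a, b, p) \<in> K" for a b p
    proof -
      from that have "a = s" "b \<in> E" using t(1) r by (auto simp: K_def)
      then show ?thesis using sE(1) by blast
    qed
  qed (use s(2) in \<open>auto simp: K_def\<close>)
  have lift: "\<exists>c'. follows FE c0 r E' e c' \<and> c' s = C"
    if e: "e \<in> FE" and c: "follows FE c0 r E e c" and C: "C \<in> {\<tau>, \<delta>}" "c t \<noteq> C" for e c C
  proof -
    have ne: "t \<noteq> e" "\<And>i. i \<in> {1..q} \<Longrightarrow> r i \<noteq> e"
      using edge_neq_deleted[OF e E(1)] t r by blast+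
    have v: "valid (E - {e}) c" and cr: "\<And>i. i \<in> {1..q} \<Longrightarrow> c (r i) = i"
      and cF: "\<And>x. x \<in> FE - {e} \<Longrightarrow> c x = c0 x"
      using c by (auto simp: follows_def)
    have "valid {s} (\<lambda>_. C)" by (rule valid_matching) (use C(1) \<tau> \<delta>(1) in auto)
    moreover have "obeys K {e} (\<lambda>x. if x \<in> {s} then C else c x)"
      unfolding obeys_def
    proof (intro allI impI)
      fix a b p assume k: "(a, b, p) \<in> K"
      then consider "a = s" "b = t" "p = False"
        | i where "a = s" "b = r i" "p = False" "i \<in> {1..q} - {\<tau>, \<delta>}"
        unfolding K_def by blast
      then show "((if a \<in> {s} then C else c a) = (if b \<in> {s} then C else c b)) = p"
      proof cases
        case 1 then show ?thesis using C(2) sE(2)[OF t(1)] by auto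
      next
        case 2 then show ?thesis using C(1) cr r sE(2)[of "r i"] by auto
      qed
    qed
    ultimately obtain c' where c': "valid (E' - {e}) c'" "\<forall>x\<in>E - {e}. c' x = c x" "c' s = C"
      using ext[OF _ v, of "\<lambda>_. C"] e E(2) by auto
    have "follows FE c0 r E' e c'"
      unfolding follows_def
    proof (intro conjI ballI)
      show "valid (E' - {e}) c'" by (rule c'(1))
      show "c' x = c0 x" if "x \<in> FE - {e}" for x
      proof -
        have "x \<in> E - {e}" using that E(2) by blast
        then show ?thesis using c'(2) cF[OF that] by simp
      qed
      show "c' (r i) = i" if "i \<in> {1..q}" for i
      proof -
        have "r i \<in> E - {e}" using r[OF that] ne(2)[OF that] by blast
        then show ?thesis using c'(2) cr[OF that] by simp
      qed
    qed
    then show ?thesis using c'(3) by blast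
  qed
  have "stage FE c0 r E' s \<delta> dn"
    unfolding stage_def
  proof (intro conjI ballI allI impI)
    show "edge_graph E'" by (rule E'(3))
    show "FE \<subseteq> E'" using E(2) E'(1) by blast
    show "x \<in> FE" if "x \<in> E'" "x \<subseteq> \<Union>FE" for x
    proof -
      have "x \<subseteq> \<Union>E" using that(2) E(2) by blast
      then show ?thesis using E'(4)[OF that(1)] E(3) that(2) by blast
    qed
    show "r i \<in> E'" "r i \<inter> \<Union>FE = {}" "s \<inter> r i = {}" if "i \<in> {1..q}" for i
      using r[OF that] E'(1) sE(1) by auto
    show "s \<in> E'" using E'(2) by simp
    show "s \<inter> \<Union>FE = {}" using s(2) E(2) by blast
    show "\<delta> \<in> {1..q}" by (rule \<delta>(1))
    show "dn \<subseteq> FE" by (rule dn)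
    show "inj_on (\<lambda>i. c (r i)) {1..q}" if "valid E' c" for c
      using inj valid_mono[OF that E'(1)] by blast
    show "c s = \<delta>" if c: "valid E' c" and cr: "\<forall>i\<in>{1..q}. c (r i) = i" for c
    proof -
      have ct: "c t = \<tau>" using forced[OF valid_mono[OF c E'(1)] cr] by blast
      have ob: "obeys K {} c" by (rule E'(5)[OF c])
      have "c s \<noteq> c t" using ob unfolding obeys_def K_def by blast
      moreover have "c s \<noteq> i" if "i \<in> {1..q} - {\<tau>, \<delta>}" for i
      proof -
        have "(s, r i, False) \<in> K" using that by (auto simp: K_def)
        then have "c s \<noteq> c (r i)" using ob unfolding obeys_def by blast
        then show ?thesis using cr that by simp
      qed
      moreover have "c s \<in> {1..q}" using valid_range[OF c] E'(2) by blast
      ultimately show ?thesis using ct by blast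
    qed
    show "c x = c0 x" if c: "valid E' c" and cr: "\<forall>i\<in>{1..q}. c (r i) = i" and "x \<in> FE" for c x
      using forced[OF valid_mono[OF c E'(1)] cr] that(3) by blast
    show "\<exists>c. follows FE c0 r E' e c \<and> c s = \<delta>" if "e \<in> FE - dn" for e
      using todo[OF that] lift[of e _ \<delta>] that \<delta>(2) by auto
    show "\<exists>c. follows FE c0 r E' e c \<and> c s \<noteq> \<delta>" if "e \<in> dn" for e
    proof -
      obtain c where "follows FE c0 r E e c" "c t \<noteq> \<tau>" using freed[OF \<open>e \<in> dn\<close>] by blast
      then obtain c' where "follows FE c0 r E' e c'" "c' s = \<tau>"
        using lift[of e c \<tau>] \<open>e \<in> dn\<close> dn by blast
      then show ?thesis using \<delta>(2) by blast
    qed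
  qed
  then show thesis by (rule that)
qed

text \<open>A disjoint copy of \<open>H\<close> serves as a clause: two of its edges repeat the colours of \<open>t\<close> and
  \<open>e0\<close>, all others that of \<open>s\<close>, and they must not all be equal.\<close>

lemma conjoin_edge:
  assumes st: "stage FE c0 r E t \<tau> dn" and \<delta>: "\<delta> \<in> {1..q}" "\<delta> \<noteq> \<tau>"
    and e0: "e0 \<in> FE" "e0 \<notin> dn" "c0 e0 = \<tau>"
  obtains E' s where "stage FE c0 r E' s \<delta> (insert e0 dn)"
proof -
  have E: "edge_graph E" "FE \<subseteq> E" "\<forall>x\<in>E. x \<subseteq> \<Union>FE \<longrightarrow> x \<in> FE"
    and r: "\<And>i. i \<in> {1..q} \<Longrightarrow> r i \<in> E \<and> r i \<inter> \<Union>FE = {}"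
    and t: "t \<in> E" "t \<inter> \<Union>FE = {}" and \<tau>: "\<tau> \<in> {1..q}" and dn: "dn \<subseteq> FE"
    and inj: "\<And>c. valid E c \<Longrightarrow> inj_on (\<lambda>i. c (r i)) {1..q}"
    and forced: "\<And>c. valid E c \<Longrightarrow> (\<forall>i\<in>{1..q}. c (r i) = i) \<Longrightarrow> c t = \<tau> \<and> (\<forall>x\<in>FE. c x = c0 x)"
    and todo: "\<And>e. e \<in> FE - dn \<Longrightarrow> \<exists>c. follows FE c0 r E e c \<and> c t = \<tau>"
    and freed: "\<And>e. e \<in> dn \<Longrightarrow> \<exists>c. follows FE c0 r E e c \<and> c t \<noteq> \<tau>"
    using st unfolding stage_def by auto
  obtain s :: "nat set" where s: "card s = 2" "\<Union>E \<inter> s = {}" by (rule fresh_edge[OF E(1)])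
  have HEg: "edge_graph HE" using finite_HE HE_edges by (simp add: edge_graph_def)
  have finEs: "finite (\<Union>E \<union> s)"
    using finite_Union_edge_graph[OF E(1)] s(1) by (simp add: card_ge_0_finite)
  obtain f :: "'a \<Rightarrow> nat" where f: "inj_on f (\<Union>HE)" "f ` (\<Union>HE - set []) \<inter> (\<Union>E \<union> s) = {}"
    using fresh_extension[OF finite_Union_edge_graph[OF HEg] finEs, of "[]" "[]"] by auto
  define Q where "Q = (`) f ` HE"
  have Q: "edge_graph Q" "\<Union>Q \<inter> (\<Union>E \<union> s) = {}"
    using edge_graph_image[OF HEg f(1)] f(2) by (auto simp: Q_def)
  have "inj_on ((`) f) HE"
    using f(1) by (intro inj_onI) (meson Union_upper inj_on_image_eq_iff)
  then have cardQ: "card Q = card HE" by (simp add: Q_def card_image)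
  have finQ: "finite Q" using finite_HE by (simp add: Q_def)
  have copyQ: "copy f Q" using f(1) by (simp add: copy_def Q_def HV_eq[symmetric])
  have "3 \<le> card Q" using cardQ card_HE_ge_3 by simp
  then obtain Q3 where "Q3 \<subseteq> Q" "card Q3 = 3" by (meson obtain_subset_with_card_n)
  then obtain h1 h2 h3 where h123: "h1 \<in> Q" "h2 \<in> Q" "h3 \<in> Q" "h1 \<noteq> h2" "h1 \<noteq> h3" "h2 \<noteq> h3"
    by (auto simp: card_3_iff)
  define N where "N = insert s Q"
  have gs: "edge_graph {s}" using s(1) by (simp add: edge_graph_def)
  have gN: "edge_graph N" using edge_graph_Un[OF gs Q(1)] by (simp add: N_def)
  have EN: "\<Union>E \<inter> \<Union>N = {}" using s(2) Q(2) by (auto simp: N_def)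
  have disj: "x \<inter> y = {}" "x \<noteq> y" if "x \<in> E" "y \<in> N" for x y
  proof -
    show "x \<inter> y = {}" using EN that by blast
    moreover have "card y = 2" using gN that(2) by (simp add: edge_graph_def)
    ultimately show "x \<noteq> y" by auto
  qed
  have sQ: "s \<inter> x = {}" "s \<noteq> x" if "x \<in> Q" for x
  proof -
    show "s \<inter> x = {}" using Q(2) that by blast
    then show "s \<noteq> x" using s(1) by auto
  qed
  have e0E: "e0 \<in> E" using e0(1) E(2) by blast
  \<comment> \<open>The negative senders to reference edges confine \<open>s\<close> to \<tau> and
    \<delta>, so that excluding \<tau> by the clause forces \<delta>.\<close>
  define K where "K = {(h1, t, True), (h2, e0, True)} \<union> (\<lambda>x. (x, s, True)) ` (Q - {h1, h2}) \<union>
     (\<lambda>i. (s, r i, False)) ` ({1..q} - {\<tau>, \<delta>})"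
  have finK: "finite K" using finQ by (simp add: K_def)
  have Kok: "a \<in> E \<union> N \<and> b \<in> E \<union> N \<and> a \<inter> b = {}" if "(a, b, p) \<in> K" for a b p
  proof -
    from that consider "a \<in> N" "b \<in> E" | "a \<in> Q" "b = s"
      using h123(1,2) t(1) e0E r by (auto simp: K_def N_def)
    then show ?thesis
    proof cases
      case 1 then show ?thesis using disj(1)[of b a] by blast
    next
      case 2 then show ?thesis using sQ(1)[of a] by (auto simp: N_def)
    qed
  qed
  obtain E' where E': "E \<subseteq> E'" "N \<subseteq> E'" "edge_graph E'" "\<And>x. x \<in> E' \<Longrightarrow> x \<subseteq> \<Union>E \<Longrightarrow> x \<in> E"
    "\<And>c. valid E' c \<Longrightarrow> obeys K {} c"
    and ext: "\<And>D c d. D \<subseteq> E \<Longrightarrow> valid (E - D) c \<Longrightarrow> valid N d \<Longrightarrow>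
       obeys K D (\<lambda>x. if x \<in> N then d x else c x) \<Longrightarrow>
       \<exists>c'. valid (E' - D) c' \<and> (\<forall>x\<in>E - D. c' x = c x) \<and> (\<forall>x\<in>N. c' x = d x)"
    by (rule extend_graph[OF E(1) gN EN finK Kok]) blast+
  \<comment> \<open>\<open>A\<close> and \<open>B\<close> colour the inputs \<open>h1\<close> and
    \<open>h2\<close>; \<open>C\<close> colours \<open>s\<close> and the rest of \<open>Q\<close>.
    \<open>B\<close> is tied to the colour \<tau> of \<open>e0\<close> only while \<open>e0\<close>
    is present, and the last condition makes the clause non-constant.\<close>
  have lift: "\<exists>c'. follows FE c0 r E' e c' \<and> c' s = C"
    if e: "e \<in> FE" and c: "follows FE c0 r E e c"
      and abc: "A = c t" "e = e0 \<or> B = \<tau>" "C \<in> {\<tau>, \<delta>}" "B \<in> {\<tau>, \<delta>}" "\<not> (A = C \<and> B = C)" for e c A B C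
  proof -
    have ne: "t \<noteq> e" "\<And>i. i \<in> {1..q} \<Longrightarrow> r i \<noteq> e"
      using edge_neq_deleted[OF e E(1)] t r by blast+
    have v: "valid (E - {e}) c" and cr: "\<And>i. i \<in> {1..q} \<Longrightarrow> c (r i) = i"
      and cF: "\<And>x. x \<in> FE - {e} \<Longrightarrow> c x = c0 x"
      using c by (auto simp: follows_def)
    have rng: "A \<in> {1..q}" "B \<in> {1..q}" "C \<in> {1..q}"
      using valid_range[OF v, of t] t(1) ne(1) abc \<tau> \<delta>(1) by auto
    define d where "d x = (if x = h1 then A else if x = h2 then B else C)" for x
    have dh: "d h1 = A" "d h2 = B" "d h3 = C" "d s = C"
      using h123 sQ(2) by (auto simp: d_def)
    have dr: "d ` X \<subseteq> {1..q}" for X using rng by (auto simp: d_def)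
    have "valid Q d"
    proof -
      have False if cp: "copy \<phi> Q" and const: "\<forall>e\<in>HE. d (\<phi> ` e) = i" for \<phi> :: "'a \<Rightarrow> nat" and i
      proof -
        have "\<forall>x\<in>Q. d x = i"
          using const copy_of_full_size[OF cp finQ cardQ] by blast
        then show False using h123(1-3) dh abc(5) by metis
      qed
      then show ?thesis using dr unfolding valid_def by blast
    qed
    moreover have "valid {s} d" by (rule valid_matching) (use dr[of "{s}"] in auto)
    moreover have "\<Union>{s} \<inter> \<Union>Q = {}" using Q(2) by auto
    ultimately have "valid ({s} \<union> Q) (\<lambda>x. if x \<in> {s} then d x else d x)"
      using valid_disjoint[OF gs Q(1)] by blast
    then have vN: "valid N d" by (simp add: N_def)
    have "obeys K {e} (\<lambda>x. if x \<in> N then d x else c x)"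
      unfolding obeys_def
    proof (intro allI impI)
      fix a b p assume k: "(a, b, p) \<in> K" and ab: "a \<notin> {e}" "b \<notin> {e}"
      from k consider "a = h1" "b = t" "p = True" | "a = h2" "b = e0" "p = True"
        | "a \<in> Q - {h1, h2}" "b = s" "p = True"
        | i where "a = s" "b = r i" "p = False" "i \<in> {1..q} - {\<tau>, \<delta>}"
        unfolding K_def by blast
      then show "((if a \<in> N then d a else c a) = (if b \<in> N then d b else c b)) = p"
      proof cases
        case 1
        then show ?thesis using disj(2)[OF t(1)] h123(1) dh abc(1) by (auto simp: N_def)
      next
        case 2
        then have "e \<noteq> e0" using ab(2) by auto
        then have "B = c e0" using abc(2) cF[of e0] e0 by auto
        then show ?thesis using 2 disj(2)[OF e0E] h123(2) dh by (auto simp: N_def)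
      next
        case 3
        then have "d a = C" by (auto simp: d_def)
        then show ?thesis using 3 dh(4) by (simp add: N_def)
      next
        case 4
        then have "r i \<notin> N" "c (r i) = i" using disj(2) r cr by blast+
        moreover have "s \<in> N" by (simp add: N_def)
        ultimately show ?thesis using 4 dh(4) abc(3) by auto
      qed
    qed
    then obtain c' where c': "valid (E' - {e}) c'" "\<forall>x\<in>E - {e}. c' x = c x" "\<forall>x\<in>N. c' x = d x"
      using ext[OF _ v vN] e E(2) by auto
    have "follows FE c0 r E' e c'"
      unfolding follows_def
    proof (intro conjI ballI)
      show "valid (E' - {e}) c'" by (rule c'(1))
      show "c' x = c0 x" if "x \<in> FE - {e}" for x
      proof -
        have "x \<in> E - {e}" using that E(2) by blast
        then show ?thesis using c'(2) cF[OF that] by simp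
      qed
      show "c' (r i) = i" if "i \<in> {1..q}" for i
      proof -
        have "r i \<in> E - {e}" using r[OF that] ne(2)[OF that] by blast
        then show ?thesis using c'(2) cr[OF that] by simp
      qed
    qed
    moreover have "c' s = C" using c'(3) dh(4) by (simp add: N_def)
    ultimately show ?thesis by blast
  qed
  have "stage FE c0 r E' s \<delta> (insert e0 dn)"
    unfolding stage_def
  proof (intro conjI ballI allI impI)
    show "edge_graph E'" by (rule E'(3))
    show "FE \<subseteq> E'" using E(2) E'(1) by blast
    show "x \<in> FE" if "x \<in> E'" "x \<subseteq> \<Union>FE" for x
    proof -
      have "x \<subseteq> \<Union>E" using that(2) E(2) by blast
      then show ?thesis using E'(4)[OF that(1)] E(3) that(2) by blast
    qed
    show "r i \<in> E'" "r i \<inter> \<Union>FE = {}" "s \<inter> r i = {}" if "i \<in> {1..q}" for i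
      using r[OF that] E'(1) disj(1)[of "r i" s] by (auto simp: N_def)
    show sE': "s \<in> E'" using E'(2) by (simp add: N_def)
    show "s \<inter> \<Union>FE = {}" using s(2) E(2) by blast
    show "\<delta> \<in> {1..q}" by (rule \<delta>(1))
    show "insert e0 dn \<subseteq> FE" using dn e0(1) by simp
    show "inj_on (\<lambda>i. c (r i)) {1..q}" if "valid E' c" for c
      using inj valid_mono[OF that E'(1)] by blast
    show "c x = c0 x" if c: "valid E' c" and cr: "\<forall>i\<in>{1..q}. c (r i) = i" and "x \<in> FE" for c x
      using forced[OF valid_mono[OF c E'(1)] cr] that(3) by blast
    show "c s = \<delta>" if c: "valid E' c" and cr: "\<forall>i\<in>{1..q}. c (r i) = i" for c
    proof -
      have ct: "c t = \<tau>" "c e0 = \<tau>" using forced[OF valid_mono[OF c E'(1)] cr] e0 by auto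
      have ob: "\<And>a b p. (a, b, p) \<in> K \<Longrightarrow> c a = c b \<longleftrightarrow> p"
        using E'(5)[OF c] unfolding obeys_def by blast
      have h: "c h1 = \<tau>" "c h2 = \<tau>"
        using ob[of h1 t True] ob[of h2 e0 True] ct by (auto simp: K_def)
      have "c s \<noteq> \<tau>"
      proof
        assume cs: "c s = \<tau>"
        have "c x = \<tau>" if "x \<in> Q" for x
        proof (cases "x \<in> {h1, h2}")
          case False
          then have "(x, s, True) \<in> K" using that by (auto simp: K_def)
          then show ?thesis using ob cs by blast
        qed (use h in auto)
        then have "\<forall>e\<in>HE. c (f ` e) = \<tau>" by (simp add: Q_def)
        moreover have "copy f E'" using copy_mono[OF copyQ, of E'] E'(2) by (simp add: N_def)
        ultimately show False using c unfolding valid_def by blast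
      qed
      moreover have "c s \<noteq> i" if "i \<in> {1..q} - {\<tau>, \<delta>}" for i
      proof -
        have "(s, r i, False) \<in> K" using that by (auto simp: K_def)
        then have "c s \<noteq> c (r i)" using ob by blast
        then show ?thesis using cr that by simp
      qed
      moreover have "c s \<in> {1..q}" using valid_range[OF c sE'] .
      ultimately show ?thesis by blast
    qed
    show "\<exists>c. follows FE c0 r E' e c \<and> c s = \<delta>" if "e \<in> FE - insert e0 dn" for e
    proof -
      from that obtain c where "follows FE c0 r E e c" "c t = \<tau>" using todo[of e] by blast
      then show ?thesis using lift[of e c \<tau> \<tau> \<delta>] that \<delta>(2) by auto
    qed
    show "\<exists>c. follows FE c0 r E' e c \<and> c s \<noteq> \<delta>" if e: "e \<in> insert e0 dn" for e
    proof (cases "e = e0")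
      case True
      obtain c where "follows FE c0 r E e c" "c t = \<tau>" using todo[of e] e0 True by blast
      \<comment> \<open>Without \<open>e0\<close> the input \<open>h2\<close> is free; with colour
        \<delta> there, the clause is satisfied even when \<open>s\<close> has colour
        \<tau>.\<close>
      then show ?thesis using lift[of e c \<tau> \<delta> \<tau>] True e0(1) \<delta>(2) by auto
    next
      case False
      then have ed: "e \<in> dn" using e by blast
      then obtain c where "follows FE c0 r E e c" "c t \<noteq> \<tau>" using freed by blast
      then show ?thesis using lift[of e c "c t" \<tau> \<tau>] ed dn \<delta>(2) by auto
    qed
  qed
  then show thesis by (rule that)
qed

text \<open>Negative senders keep the reference edges pairwise different, and positive ones tie each
  edge of \<open>FE\<close> to the reference edge of its colour under \<open>c0\<close>. The empty
  conjunction is true, so its carrier is an extra edge \<open>r 0\<close> tied to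
  \<open>r 1\<close>.\<close>

lemma initial_stage:
  fixes FE :: "nat set set"
  assumes FE: "edge_graph FE" and c0: "valid FE c0"
  obtains r E t where "stage FE c0 r E t 1 {}"
proof -
  define M where "M = Suc (Max (insert 0 (\<Union>FE)))"
  have M: "x < M" if "x \<in> \<Union>FE" for x
    using that finite_Union_edge_graph[OF FE] by (simp add: M_def less_Suc_eq_le)
  define r where "r i = {M + 2 * i, M + 2 * i + 1}" for i :: nat
  have rdisj: "r i \<inter> r j = {}" if "i \<noteq> j" for i j using that unfolding r_def by auto
  have rinj: "r i = r j \<longleftrightarrow> i = j" for i j
  proof
    assume "r i = r j"
    then show "i = j" using rdisj[of i j] by (cases "i = j") (auto simp: r_def)
  qed simp
  define N where "N = r ` {0..q}"
  have gN: "edge_graph N" by (auto simp: N_def r_def edge_graph_def)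
  have rFE: "r i \<inter> \<Union>FE = {}" for i using M unfolding r_def by fastforce
  have EN: "\<Union>FE \<inter> \<Union>N = {}" using rFE by (auto simp: N_def)
  have FEN: "x \<notin> N" if "x \<in> FE" for x
  proof
    assume "x \<in> N"
    then have "x \<inter> x = {}" using rFE that by (auto simp: N_def)
    then show False using FE that by (auto simp: edge_graph_def)
  qed
  have rN: "r i \<in> N" if "i \<le> q" for i using that by (simp add: N_def)
  have c0r: "c0 x \<in> {1..q}" if "x \<in> FE" for x using valid_range[OF c0 that] .
  define K where "K = insert (r 0, r 1, True) ((\<lambda>x. (x, r (c0 x), True)) ` FE \<union>
     (\<lambda>(i, j). (r i, r j, False)) ` {(i, j). i \<in> {1..q} \<and> j \<in> {1..q} \<and> i \<noteq> j})"
  have finK: "finite K"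
  proof -
    have "finite {(i, j). i \<in> {1..q} \<and> j \<in> {1..q} \<and> i \<noteq> j}"
      by (rule finite_subset[of _ "{1..q} \<times> {1..q}"]) auto
    then show ?thesis using FE by (simp add: K_def edge_graph_def)
  qed
  have Kok: "a \<in> FE \<union> N \<and> b \<in> FE \<union> N \<and> a \<inter> b = {}" if "(a, b, p) \<in> K" for a b p
  proof -
    from that consider "a = r 0" "b = r 1" | "a \<in> FE" "b = r (c0 a)"
      | i j where "a = r i" "b = r j" "i \<in> {1..q}" "j \<in> {1..q}" "i \<noteq> j"
      unfolding K_def by auto
    then show ?thesis
    proof cases
      case 1 then show ?thesis using rN[of 0] rN[of 1] rdisj[of 0 1] q_ge_2 by auto
    next
      case 2 then show ?thesis using rN[of "c0 a"] c0r[of a] rFE[of "c0 a"] by auto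
    next
      case 3 then show ?thesis using rN[of i] rN[of j] rdisj[of i j] by auto
    qed
  qed
  obtain E where E: "FE \<subseteq> E" "N \<subseteq> E" "edge_graph E" "\<And>x. x \<in> E \<Longrightarrow> x \<subseteq> \<Union>FE \<Longrightarrow> x \<in> FE"
    "\<And>c. valid E c \<Longrightarrow> obeys K {} c"
    and ext: "\<And>D c d. D \<subseteq> FE \<Longrightarrow> valid (FE - D) c \<Longrightarrow> valid N d \<Longrightarrow>
       obeys K D (\<lambda>x. if x \<in> N then d x else c x) \<Longrightarrow>
       \<exists>c'. valid (E - D) c' \<and> (\<forall>x\<in>FE - D. c' x = c x) \<and> (\<forall>x\<in>N. c' x = d x)"
    by (rule extend_graph[OF FE gN EN finK Kok]) blast+
  \<comment> \<open>\<open>r i\<close> gets colour \<open>i\<close>, and \<open>max 1\<close> gives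
    \<open>r 0\<close> the colour of \<open>r 1\<close>.\<close>
  define d where "d x = max 1 (inv r x)" for x
  have dr: "d (r i) = max 1 i" for i
  proof -
    have "inj r" using rinj by (simp add: inj_def)
    then show ?thesis by (simp add: d_def)
  qed
  have vN: "valid N d"
  proof (rule valid_matching)
    show "x \<inter> y = {}" if "x \<in> N" "y \<in> N" "x \<noteq> y" for x y
    proof -
      from that obtain i j where "x = r i" "y = r j" "i \<noteq> j" by (auto simp: N_def)
      then show ?thesis using rdisj by blast
    qed
    show "d ` N \<subseteq> {1..q}" using dr q_ge_2 by (auto simp: N_def)
  qed
  have "stage FE c0 r E (r 0) 1 {}"
    unfolding stage_def
  proof (intro conjI ballI allI impI)
    show "edge_graph E" by (rule E(3))
    show "FE \<subseteq> E" by (rule E(1))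
    show "x \<in> FE" if "x \<in> E" "x \<subseteq> \<Union>FE" for x using E(4) that .
    show "r i \<in> E" "r i \<inter> \<Union>FE = {}" "r 0 \<inter> r i = {}" if "i \<in> {1..q}" for i
      using that rN[of i] E(2) rFE rdisj[of 0 i] by auto
    show "r 0 \<in> E" using rN[of 0] E(2) by auto
    show "r 0 \<inter> \<Union>FE = {}" by (rule rFE)
    show "1 \<in> {1..q}" using q_ge_2 by simp
    show "inj_on (\<lambda>i. c (r i)) {1..q}" if c: "valid E c" for c
    proof (rule inj_onI)
      fix i j assume ij: "i \<in> {1..q}" "j \<in> {1..q}" "c (r i) = c (r j)"
      show "i = j"
      proof (rule ccontr)
        assume "i \<noteq> j"
        then have "(r i, r j, False) \<in> K" using ij(1,2) by (auto simp: K_def)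
        then show False using E(5)[OF c] ij(3) unfolding obeys_def by blast
      qed
    qed
    show "c (r 0) = 1" if c: "valid E c" and cr: "\<forall>i\<in>{1..q}. c (r i) = i" for c
    proof -
      have "c (r 0) = c (r 1)" using E(5)[OF c] unfolding obeys_def K_def by blast
      then show ?thesis using cr q_ge_2 by simp
    qed
    show "c x = c0 x" if c: "valid E c" and cr: "\<forall>i\<in>{1..q}. c (r i) = i" and x: "x \<in> FE" for c x
    proof -
      have "(x, r (c0 x), True) \<in> K" using x by (simp add: K_def)
      then have "c x = c (r (c0 x))" using E(5)[OF c] unfolding obeys_def by blast
      then show ?thesis using cr c0r[OF x] by simp
    qed
    show "\<exists>c. follows FE c0 r E e c \<and> c (r 0) = 1" if e: "e \<in> FE - {}" for e
    proof -
      have v: "valid (FE - {e}) c0" using c0 by (rule valid_mono) blast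
      have "obeys K {e} (\<lambda>x. if x \<in> N then d x else c0 x)"
        unfolding obeys_def
      proof (intro allI impI)
        fix a b p assume k: "(a, b, p) \<in> K"
        then consider "a = r 0" "b = r 1" "p = True" | "a \<in> FE" "b = r (c0 a)" "p = True"
          | i j where "a = r i" "b = r j" "i \<in> {1..q}" "j \<in> {1..q}" "i \<noteq> j" "p = False"
          unfolding K_def by auto
        then show "((if a \<in> N then d a else c0 a) = (if b \<in> N then d b else c0 b)) = p"
        proof cases
          case 1 then show ?thesis using rN[of 0] rN[of 1] q_ge_2 dr by simp
        next
          case 2 then show ?thesis using FEN[of a] rN[of "c0 a"] c0r[of a] dr by simp
        next
          case 3 then show ?thesis using rN[of i] rN[of j] dr by simp
        qed
      qed
      then obtain c where "valid (E - {e}) c" "\<forall>x\<in>FE - {e}. c x = c0 x" "\<forall>x\<in>N. c x = d x"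
        using ext[OF _ v vN] e by auto
      then have "follows FE c0 r E e c \<and> c (r 0) = 1"
        unfolding follows_def using rN dr by auto
      then show ?thesis by blast
    qed
  qed auto
  then show thesis by (rule that)
qed

text \<open>While \<open>FE\<close> is complete, \<open>t\<close> must agree with
  \<open>r \<tau>\<close> up to a permutation of colours, and a negative sender between them forbids
  this. Once an edge of \<open>FE\<close> is gone, some witness has \<open>t\<close> off \<tau> and
  extends over that sender.\<close>

lemma critical_extension:
  fixes FE :: "nat set set"
  assumes FE: "edge_graph FE" and col: "colourable FE"
  obtains G where "edge_graph G" "FE \<subseteq> G" "\<And>x. x \<in> G \<Longrightarrow> x \<subseteq> \<Union>FE \<Longrightarrow> x \<in> FE" "\<not> colourable G"
    "\<And>e. e \<in> FE \<Longrightarrow> colourable (G - {e})"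
proof -
  obtain c0 where c0: "valid FE c0" using col by (auto simp: colourable_def)
  obtain r E0 t0 where st0: "stage FE c0 r E0 t0 1 {}" by (rule initial_stage[OF FE c0])
  have stages: "\<exists>E t \<tau>. stage FE c0 r E t \<tau> dn" if "finite dn" "dn \<subseteq> FE" for dn
    using that
  proof (induction dn rule: finite_induct)
    case empty
    then show ?case using st0 by blast
  next
    case (insert e dn)
    then obtain E t \<tau> where st: "stage FE c0 r E t \<tau> dn" by auto
    have e: "e \<in> FE" "c0 e \<in> {1..q}" using insert.prems valid_range[OF c0] by auto
    \<comment> \<open>The clause for \<open>e\<close> becomes constant through \<open>t\<close> and
      \<open>e\<close> having the same colour, so truth must first be encoded by
      \<open>c0 e\<close>.\<close>
    obtain E1 t1 where st1: "stage FE c0 r E1 t1 (c0 e) dn"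
      using st change_truth_colour[OF st e(2)] by metis
    obtain \<delta> where "\<delta> \<in> {1..q}" "\<delta> \<noteq> c0 e" by (rule other_colour)
    then show ?case using conjoin_edge[OF st1 _ _ e(1) insert.hyps(2)] by metis
  qed
  have "finite FE" using FE by (simp add: edge_graph_def)
  then obtain E t \<tau> where st: "stage FE c0 r E t \<tau> FE"
    using stages by blast
  have E: "edge_graph E" "FE \<subseteq> E" "\<And>x. x \<in> E \<Longrightarrow> x \<subseteq> \<Union>FE \<Longrightarrow> x \<in> FE"
    and r: "\<And>i. i \<in> {1..q} \<Longrightarrow> r i \<in> E \<and> t \<inter> r i = {}"
    and t: "t \<in> E" and \<tau>: "\<tau> \<in> {1..q}"
    and inj: "\<And>c. valid E c \<Longrightarrow> inj_on (\<lambda>i. c (r i)) {1..q}"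
    and forced: "\<And>c. valid E c \<Longrightarrow> (\<forall>i\<in>{1..q}. c (r i) = i) \<Longrightarrow> c t = \<tau>"
    and freed: "\<And>e. e \<in> FE \<Longrightarrow> \<exists>c. follows FE c0 r E e c \<and> c t \<noteq> \<tau>"
    using st unfolding stage_def by auto
  obtain G where G: "E \<subseteq> G" "edge_graph G" "\<And>x. x \<in> G \<Longrightarrow> x \<subseteq> \<Union>E \<Longrightarrow> x \<in> E"
    "\<And>c. valid G c \<Longrightarrow> c t = c (r \<tau>) \<longleftrightarrow> False"
    and ext: "\<And>D c. D \<subseteq> E \<Longrightarrow> valid (E - D) c \<Longrightarrow> (t \<notin> D \<Longrightarrow> r \<tau> \<notin> D \<Longrightarrow> c t = c (r \<tau>) \<longleftrightarrow> False) \<Longrightarrow>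
       \<exists>c'. valid (G - D) c' \<and> (\<forall>x\<in>E - D. c' x = c x)"
    using attach_sender[OF E(1) t, of "r \<tau>" False] r[OF \<tau>] by metis
  have "\<not> valid G c" for c
  proof
    assume c: "valid G c"
    have i: "inj_on (\<lambda>i. c (r i)) {1..q}" using inj[OF valid_mono[OF c G(1)]] .
    have sub: "(\<lambda>i. c (r i)) ` {1..q} \<subseteq> {1..q}"
      using valid_range[OF c] r G(1) by blast
    then have eq: "(\<lambda>i. c (r i)) ` {1..q} = {1..q}"
      using i by (intro card_subset_eq) (auto simp: card_image)
    \<comment> \<open>The reference edges show all \<open>q\<close> colours, so the colouring can be
      normalised to give \<open>r i\<close> colour \<open>i\<close>.\<close>
    define \<pi> where "\<pi> = inv_into {1..q} (\<lambda>i. c (r i))"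
    have "inj_on \<pi> {1..q}" unfolding \<pi>_def by (rule inj_on_inv_into) (use eq in auto)
    moreover have "\<pi> ` {1..q} \<subseteq> {1..q}"
    proof (rule image_subsetI)
      fix x assume "x \<in> {1..q}"
      then show "\<pi> x \<in> {1..q}" unfolding \<pi>_def using eq by (intro inv_into_into) simp
    qed
    ultimately have v: "valid G (\<pi> \<circ> c)" by (rule valid_permute[OF c])
    have "(\<pi> \<circ> c) (r j) = j" if "j \<in> {1..q}" for j
      using inv_into_f_f[OF i that] by (simp add: \<pi>_def)
    moreover from this have "(\<pi> \<circ> c) t = \<tau>" by (intro forced[OF valid_mono[OF v G(1)]]) blast
    ultimately show False using G(4)[OF v] \<tau> by metis
  qed
  then have "\<not> colourable G" by (simp add: colourable_def)
  moreover have "x \<in> FE" if "x \<in> G" "x \<subseteq> \<Union>FE" for x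
  proof -
    have "x \<subseteq> \<Union>E" using that(2) E(2) by blast
    then show ?thesis using G(3)[OF that(1)] E(3) that(2) by blast
  qed
  moreover have "colourable (G - {e})" if "e \<in> FE" for e
  proof -
    obtain c where c: "follows FE c0 r E e c" "c t \<noteq> \<tau>" using freed[OF \<open>e \<in> FE\<close>] by blast
    then have "c (r \<tau>) = \<tau>" "valid (E - {e}) c" using \<tau> by (auto simp: follows_def)
    then show ?thesis using ext[of "{e}" c] that E(2) c(2) unfolding colourable_def by auto
  qed
  moreover have "FE \<subseteq> G" using E(2) G(1) by blast
  ultimately show thesis using that G(2) by blast
qed

text \<open>An edge with an end on no other edge lies in no copy of \<open>H\<close>, whose vertices
  all have degree at least two; its colour is arbitrary.\<close>

lemma colourable_pendant:
  assumes "colourable E1"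
    and "\<And>e. e \<in> E2 \<Longrightarrow> \<exists>w\<in>e. \<forall>x\<in>E1 \<union> E2. w \<in> x \<longrightarrow> x = e"
  shows "colourable (E1 \<union> E2)"
proof -
  obtain c where c: "valid E1 c" using assms(1) by (auto simp: colourable_def)
  let ?c = "\<lambda>e. if e \<in> E1 then c e else 1"
  have "copy \<phi> E1" if cp: "copy \<phi> (E1 \<union> E2)" for \<phi>
  proof -
    have inj: "inj_on \<phi> HV" and im: "\<And>e. e \<in> HE \<Longrightarrow> \<phi> ` e \<in> E1 \<union> E2"
      using cp unfolding copy_def by blast+
    have "\<phi> ` e \<in> E1" if e: "e \<in> HE" for e
    proof (rule ccontr)
      assume "\<phi> ` e \<notin> E1"
      then have "\<phi> ` e \<in> E2" using im[OF e] by blast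
      then have "\<exists>w\<in>\<phi> ` e. \<forall>x\<in>E1 \<union> E2. w \<in> x \<longrightarrow> x = \<phi> ` e" by (rule assms(2))
      then obtain p where p: "p \<in> e" "\<And>x. x \<in> E1 \<union> E2 \<Longrightarrow> \<phi> p \<in> x \<Longrightarrow> x = \<phi> ` e" by auto
      then have "p \<in> HV" using HE_edges[OF e] by blast
      then obtain x y where xy: "x \<noteq> y" "{p, x} \<in> HE" "{p, y} \<in> HE" by (rule two_neighbours)
      have "\<phi> ` {p, x} = \<phi> ` e" by (rule p(2)[OF im[OF xy(2)]]) simp
      moreover have "\<phi> ` {p, y} = \<phi> ` e" by (rule p(2)[OF im[OF xy(3)]]) simp
      ultimately have "{p, x} = {p, y}" using inj HE_edges xy by (metis inj_on_image_eq_iff)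
      then show False using xy(1) by (simp add: doubleton_eq_iff)
    qed
    then show ?thesis using inj by (simp add: copy_def)
  qed
  moreover have "valid E1 ?c" by (rule valid_cong[OF c]) simp
  moreover have "?c ` (E1 \<union> E2) \<subseteq> {1..q}" using valid_range[OF c] q_ge_2 by auto
  ultimately have "valid (E1 \<union> E2) ?c" unfolding valid_def by blast
  then show ?thesis unfolding colourable_def by blast
qed

text \<open>Every edge of \<open>?F\<close> is critical in \<open>G\<close>, hence present in each
  uncolourable subgraph. Inside \<open>V\<close> nothing is added: \<open>G\<close> induces only
  edges of \<open>?F\<close> there, and each edge of \<open>P\<close> and \<open>R\<close> has an
  end outside \<open>V\<close>.\<close>

lemma minimal_extension:
  fixes V :: "nat set" and FE :: "nat set set"
  assumes V: "finite V" and FE: "edge_graph FE" "\<Union>FE \<subseteq> V" "colourable FE"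
  obtains M where "edge_graph M" "V \<subseteq> \<Union>M" "n \<le> card (\<Union>M)" "\<And>x. x \<subseteq> V \<Longrightarrow> x \<in> M \<longleftrightarrow> x \<in> FE"
    "\<not> colourable M" "\<And>D. D \<subset> M \<Longrightarrow> colourable D"
proof -
  \<comment> \<open>\<open>V\<close> lies below \<open>K\<close>, the pendant ends lie between
    \<open>K\<close> and \<open>2 * K\<close>, and the matching starts at
    \<open>2 * K\<close>.\<close>
  define K where "K = Suc (Max (insert 0 V))"
  have K: "x < K" if "x \<in> V" for x using that V by (simp add: K_def less_Suc_eq_le)
  define P where "P = (\<lambda>v. {v, K + v}) ` V"
  define R where "R = (\<lambda>i. {2 * K + 2 * i, 2 * K + 2 * i + 1}) ` {..<n}"
  let ?F = "FE \<union> (P \<union> R)"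
  have "0 < K" by (simp add: K_def)
  then have P: "edge_graph P" using V by (auto simp: P_def edge_graph_def)
  have R: "edge_graph R" by (auto simp: R_def edge_graph_def)
  have gF: "edge_graph ?F" using FE(1) P R by (intro edge_graph_Un)
  have FEK: "w < K" if "x \<in> FE" "w \<in> x" for x w using that FE(2) K by blast
  have col: "colourable ?F"
  proof (rule colourable_pendant[OF FE(3)])
    fix e assume "e \<in> P \<union> R"
    then show "\<exists>w\<in>e. \<forall>x\<in>?F. w \<in> x \<longrightarrow> x = e"
    proof
      assume "e \<in> P"
      then obtain v where v: "v \<in> V" "e = {v, K + v}" by (auto simp: P_def)
      have "x = e" if "x \<in> ?F" "K + v \<in> x" for x
        using that FEK[of x "K + v"] K[OF v(1)] v(2) K by (fastforce simp: P_def R_def)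
      then show ?thesis using v(2) by blast
    next
      assume "e \<in> R"
      then obtain i where i: "e = {2 * K + 2 * i, 2 * K + 2 * i + 1}" by (auto simp: R_def)
      have "x = e" if x: "x \<in> ?F" "2 * K + 2 * i \<in> x" for x
      proof -
        have "x \<notin> FE" using FEK[of x "2 * K + 2 * i"] x(2) by auto
        moreover have "x \<notin> P" using x(2) K by (fastforce simp: P_def)
        ultimately obtain j where j: "x = {2 * K + 2 * j, 2 * K + 2 * j + 1}" using x(1) by (auto simp: R_def)
        then have "2 * K + 2 * i = 2 * K + 2 * j \<or> 2 * K + 2 * i = 2 * K + 2 * j + 1" using x(2) by blast
        then have "i = j" by presburger
        then show ?thesis using i j by simp
      qed
      then show ?thesis using i by blast
    qed
  qed
  obtain G where G: "edge_graph G" "?F \<subseteq> G" "\<And>x. x \<in> G \<Longrightarrow> x \<subseteq> \<Union>?F \<Longrightarrow> x \<in> ?F" "\<not> colourable G"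
    "\<And>e. e \<in> ?F \<Longrightarrow> colourable (G - {e})"
    by (rule critical_extension[OF gF col]) blast
  have "finite G" using G(1) by (simp add: edge_graph_def)
  then obtain M where M: "M \<subseteq> G" "\<not> colourable M" "\<And>D. D \<subset> M \<Longrightarrow> colourable D"
    by (rule minimal_uncolourable[OF _ G(4)]) blast
  have FM: "?F \<subseteq> M"
  proof
    fix e assume "e \<in> ?F"
    then have "colourable (G - {e})" by (rule G(5))
    then show "e \<in> M" using M(1,2) colourable_mono by blast
  qed
  have gM: "edge_graph M" using G(1) M(1) by (rule edge_graph_mono)
  have VF: "V \<subseteq> \<Union>P" by (auto simp: P_def)
  show thesis
  proof (rule that[of M])
    show "V \<subseteq> \<Union>M" using VF FM by blast
    have "(\<lambda>i. 2 * K + 2 * i) ` {..<n} \<subseteq> \<Union>R" by (auto simp: R_def)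
    also have "\<dots> \<subseteq> \<Union>M" using FM by blast
    finally have "card ((\<lambda>i. 2 * K + 2 * i) ` {..<n}) \<le> card (\<Union>M)"
      using finite_Union_edge_graph[OF gM] by (rule card_mono[rotated])
    then show "n \<le> card (\<Union>M)" by (simp add: card_image inj_on_def)
    show "x \<in> M \<longleftrightarrow> x \<in> FE" if x: "x \<subseteq> V" for x
    proof
      assume xM: "x \<in> M"
      have "x \<subseteq> \<Union>?F" using x VF by blast
      then have "x \<in> ?F" using G(3) M(1) xM by blast
      moreover have "x \<notin> P" using x K by (fastforce simp: P_def)
      moreover have "x \<notin> R" using x K by (fastforce simp: R_def)
      ultimately show "x \<in> FE" by blast
    qed (use FM in blast)
  qed (use gM M in auto)
qed

end

section \<open>Graphs as pairs of vertices and edges\<close>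

lemma ramsey_for_iff_not_colourable:
  fixes G :: "'v sgraph" and H :: "'a sgraph"
  assumes H: "two_cut_free (verts H) (edges H) q" and G: "simple_graph G"
  shows "ramsey_for q H G \<longleftrightarrow> \<not> two_cut_free.colourable (verts H) (edges H) q (edges G)"
proof -
  interpret two_cut_free "verts H" "edges H" q by (rule H)
  have copy_of_mono: "\<exists>\<phi>. copy \<phi> (edges G) \<and> (\<exists>i. \<forall>e\<in>edges H. c (\<phi> ` e) = i)"
    if mc: "monochromatic_copy q H G c H'" for c H'
  proof -
    obtain f i where f: "bij_betw f (verts H') (verts H)"
      "\<forall>u\<in>verts H'. \<forall>v\<in>verts H'. {u, v} \<in> edges H' \<longleftrightarrow> {f u, f v} \<in> edges H"
      and i: "\<forall>e\<in>edges H'. c e = i" and sub: "edges H' \<subseteq> edges G"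
      using mc unfolding monochromatic_copy_def graph_iso_def subgraph_def by blast
    define \<phi> where "\<phi> = inv_into (verts H') f"
    have im: "\<phi> ` e \<in> edges H'" if e: "e \<in> edges H" for e
    proof -
      obtain a b where ab: "e = {a, b}" using HE_edges[OF e] by (meson card_2_iff)
      have "a \<in> f ` verts H'" "b \<in> f ` verts H'"
        using HE_edges[OF e] ab f(1) by (auto simp: bij_betw_def)
      then have "f (\<phi> a) = a" "f (\<phi> b) = b" "\<phi> a \<in> verts H'" "\<phi> b \<in> verts H'"
        unfolding \<phi>_def by (auto intro: f_inv_into_f inv_into_into)
      then show ?thesis using f(2) e ab by simp
    qed
    have "inj_on \<phi> (verts H)"
      unfolding \<phi>_def using f(1) by (auto simp: bij_betw_def intro: inj_on_inv_into)
    then show ?thesis using im i sub by (intro exI[of _ \<phi>]) (auto simp: copy_def)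
  qed
  have mono_of_copy: "\<exists>H'. monochromatic_copy q H G c H'"
    if c: "colouring q G c" and cp: "copy \<phi> (edges G)" and i: "\<forall>e\<in>edges H. c (\<phi> ` e) = i" for c \<phi> i
  proof -
    define H' where "H' = SGraph (\<phi> ` verts H) ((`) \<phi> ` edges H)"
    have inj: "inj_on \<phi> (verts H)" and sub: "(`) \<phi> ` edges H \<subseteq> edges G"
      using cp by (auto simp: copy_def)
    have "\<phi> ` verts H \<subseteq> verts G"
      using copy_vertices[OF cp] G by (auto simp: simple_graph_def)
    moreover have "simple_graph H'"
    proof -
      have "card (\<phi> ` e) = 2" if "e \<in> edges H" for e
        using sub that G by (auto simp: simple_graph_def)
      then show ?thesis using finite_HV HE_edges by (auto simp: simple_graph_def H'_def)
    qed
    ultimately have "subgraph H' G" using sub G by (simp add: subgraph_def H'_def)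
    moreover have "graph_iso H' H"
      unfolding graph_iso_def
    proof (intro exI conjI ballI)
      show "bij_betw (inv_into (verts H) \<phi>) (verts H') (verts H)"
        using inj by (auto simp: H'_def bij_betw_inv_into inj_on_imp_bij_betw)
      fix u v assume uv: "u \<in> verts H'" "v \<in> verts H'"
      then obtain a b where ab: "a \<in> verts H" "b \<in> verts H" "u = \<phi> a" "v = \<phi> b" by (auto simp: H'_def)
      have "{\<phi> a, \<phi> b} \<in> (`) \<phi> ` edges H \<longleftrightarrow> {a, b} \<in> edges H"
      proof
        assume "{\<phi> a, \<phi> b} \<in> (`) \<phi> ` edges H"
        then obtain e where e: "e \<in> edges H" "\<phi> ` {a, b} = \<phi> ` e" by auto
        then have "{a, b} = e"
          using inj_on_image_eq_iff[OF inj, of "{a, b}" e] HE_edges[OF e(1)] ab(1,2) by simp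
        then show "{a, b} \<in> edges H" using e by simp
      next
        assume "{a, b} \<in> edges H"
        then have "\<phi> ` {a, b} \<in> (`) \<phi> ` edges H" by (rule imageI)
        then show "{\<phi> a, \<phi> b} \<in> (`) \<phi> ` edges H" by simp
      qed
      then show "{u, v} \<in> edges H' \<longleftrightarrow> {inv_into (verts H) \<phi> u, inv_into (verts H) \<phi> v} \<in> edges H"
        using ab inj by (simp add: H'_def)
    qed
    moreover have "i \<in> {1..q}"
    proof -
      obtain e where "e \<in> edges H" using HE_nonempty by blast
      then have "\<phi> ` e \<in> edges G" "c (\<phi> ` e) = i" using sub i by auto
      then show ?thesis using c by (auto simp: colouring_def)
    qed
    moreover have "\<forall>e\<in>edges H'. c e = i" using i by (simp add: H'_def)
    ultimately show ?thesis unfolding monochromatic_copy_def by blast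
  qed
  show ?thesis
  proof
    assume R: "ramsey_for q H G"
    have "\<not> valid (edges G) c" for c
    proof
      assume v: "valid (edges G) c"
      then have "colouring q G c" by (auto simp: valid_def colouring_def)
      then obtain H' where "monochromatic_copy q H G c H'" using R by (auto simp: ramsey_for_def)
      then obtain \<phi> i where "copy \<phi> (edges G)" "\<forall>e\<in>edges H. c (\<phi> ` e) = i"
        using copy_of_mono by blast
      then show False using v unfolding valid_def by blast
    qed
    then show "\<not> colourable (edges G)" by (simp add: colourable_def)
  next
    assume nc: "\<not> colourable (edges G)"
    show "ramsey_for q H G"
      unfolding ramsey_for_def
    proof (intro allI impI)
      fix c assume c: "colouring q G c"
      then have "c ` edges G \<subseteq> {1..q}" by (auto simp: colouring_def)
      then obtain \<phi> i where "copy \<phi> (edges G)" "\<forall>e\<in>edges H. c (\<phi> ` e) = i"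
        using nc unfolding colourable_def valid_def by blast
      then show "\<exists>H'. monochromatic_copy q H G c H'" by (rule mono_of_copy[OF c])
    qed
  qed
qed

lemma two_cut_free_of_connected:
  fixes H :: "'a sgraph"
  assumes H: "simple_graph H" and c: "k_connected 3 H \<or> graph_iso H (complete_graph 3)" and q: "2 \<le> q"
  shows "two_cut_free (verts H) (edges H) q"
proof
  show "finite (verts H)" using H by (simp add: simple_graph_def)
  show "e \<subseteq> verts H \<and> card e = 2" if "e \<in> edges H" for e
    using H that by (simp add: simple_graph_def)
  show "2 \<le> q" by (rule q)
  show "3 \<le> card (verts H)"
    using c
  proof
    assume "graph_iso H (complete_graph 3)"
    then obtain f where "bij_betw f (verts H) {..<3 :: nat}"
      by (auto simp: graph_iso_def complete_graph_def)
    then show ?thesis using bij_betw_same_card by fastforce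
  qed (simp add: k_connected_def)
  show "X \<subseteq> Y \<or> Y \<subseteq> X"
    if XY: "X \<union> Y = verts H" "\<forall>e\<in>edges H. e \<subseteq> X \<or> e \<subseteq> Y" "card (X \<inter> Y) \<le> 2" for X Y
  proof (rule ccontr)
    assume "\<not> (X \<subseteq> Y \<or> Y \<subseteq> X)"
    then obtain x y where xy: "x \<in> X" "x \<notin> Y" "y \<in> Y" "y \<notin> X" by blast
    show False
      using c
    proof
      assume "k_connected 3 H"
      then have "connected_graph (induced_on H (verts H - (X \<inter> Y)))"
        using XY unfolding k_connected_def by (metis Int_lower1 Un_upper1 less_Suc_eq_le numeral_3_eq_3 numeral_2_eq_2 order_trans)
      moreover have "x \<in> verts H - (X \<inter> Y)" "y \<in> verts H - (X \<inter> Y)" using xy XY(1) by auto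
      ultimately have "(\<lambda>a b. {a, b} \<in> edges (induced_on H (verts H - (X \<inter> Y))))\<^sup>*\<^sup>* x y"
        by (simp add: connected_graph_def induced_on_def)
      \<comment> \<open>A walk that avoids \<open>X \<inter> Y\<close> cannot leave
        \<open>X - Y\<close>, since each edge lies within one side.\<close>
      then have "y \<in> X - Y"
      proof (induction rule: rtranclp_induct)
        case base
        show ?case using xy by simp
      next
        case (step a b)
        then have "{a, b} \<in> edges H" "b \<notin> X \<inter> Y" by (auto simp: induced_on_def)
        then have "{a, b} \<subseteq> X \<or> {a, b} \<subseteq> Y" using bspec[OF XY(2)] by blast
        then show ?case using step.IH \<open>b \<notin> X \<inter> Y\<close> by simp
      qed
      then show False using xy by simp
    next
      assume "graph_iso H (complete_graph 3)"
      then obtain f where f: "bij_betw f (verts H) {..<3 :: nat}"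
        "\<forall>u\<in>verts H. \<forall>v\<in>verts H. {u, v} \<in> edges H \<longleftrightarrow> {f u, f v} \<in> edges (complete_graph 3)"
        by (auto simp: graph_iso_def complete_graph_def)
      have v: "x \<in> verts H" "y \<in> verts H" "x \<noteq> y" using xy XY(1) by auto
      then have "f x < 3" "f y < 3" "f x \<noteq> f y"
        using f(1) by (auto simp: bij_betw_def inj_on_def)
      then have "{f x, f y} \<in> edges (complete_graph 3)" by (simp add: complete_graph_def)
      then have "{x, y} \<in> edges H" using f(2) v by blast
      then show False using XY(2) xy by blast
    qed
  qed
qed

theorem theorem1p2:
  fixes H :: "'a sgraph" and F :: "'b sgraph" and q :: nat
  assumes "simple_graph H"
    and "k_connected 3 H \<or> graph_iso H (complete_graph 3)"
    and "q \<ge> 2"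
    and "simple_graph F"
    and "\<not> ramsey_for q H F"
  shows "\<exists>\<G> :: nat sgraph set.
           infinite \<G> \<and>
           pairwise (\<lambda>G G'. \<not> graph_iso G G') \<G> \<and>
           (\<forall>G \<in> \<G>. G \<in> ramsey_minimal_graphs q H \<and>
                     (\<exists>F'. induced_subgraph F' G \<and> graph_iso F F'))"
proof -
  have tcf: "two_cut_free (verts H) (edges H) q" using assms(1-3) by (rule two_cut_free_of_connected)
  interpret two_cut_free "verts H" "edges H" q by (rule tcf)
  have finF: "finite (verts F)" and edF: "\<And>e. e \<in> edges F \<Longrightarrow> e \<subseteq> verts F \<and> card e = 2"
    using assms(4) by (auto simp: simple_graph_def)
  obtain f :: "'b \<Rightarrow> nat" where f: "inj_on f (verts F)"
    using finite_imp_inj_to_nat_seg[OF finF] by blast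
  let ?V = "f ` verts F" and ?FE = "(`) f ` edges F"
  have gF: "edge_graph (edges F)"
  proof -
    have "finite (edges F)" by (rule finite_subset[of _ "Pow (verts F)"]) (use edF finF in auto)
    then show ?thesis using edF by (simp add: edge_graph_def)
  qed
  have inj: "inj_on f (\<Union>(edges F))" using f by (rule inj_on_subset) (use edF in blast)
  have "colourable (edges F)"
    using assms(4,5) ramsey_for_iff_not_colourable[OF tcf] by blast
  then have col: "colourable ?FE"
    unfolding colourable_def using valid_push[OF inj] by metis
  have gFE: "edge_graph ?FE" using gF inj by (rule edge_graph_image)
  have FEV: "\<Union>?FE \<subseteq> ?V" using edF by auto
  define good where "good G \<longleftrightarrow> G \<in> ramsey_minimal_graphs q H \<and>
      (\<exists>F'. induced_subgraph F' G \<and> graph_iso F F')" for G :: "nat sgraph"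
  have large: "\<exists>G. good G \<and> n \<le> card (verts G)" for n
  proof -
    obtain M where M: "edge_graph M" "?V \<subseteq> \<Union>M" "n \<le> card (\<Union>M)"
      "\<And>x. x \<subseteq> ?V \<Longrightarrow> x \<in> M \<longleftrightarrow> x \<in> ?FE" "\<not> colourable M" "\<And>D. D \<subset> M \<Longrightarrow> colourable D"
      by (rule minimal_extension[OF finite_imageI[OF finF] gFE FEV col]) blast
    define G where "G = SGraph (\<Union>M) M"
    have sG: "simple_graph G"
      using M(1) finite_Union_edge_graph[OF M(1)] by (auto simp: simple_graph_def G_def edge_graph_def)
    have "\<not> ramsey_for q H G'" if ps: "proper_subgraph G' G" for G'
    proof -
      have sG': "simple_graph G'" and sub: "verts G' \<subseteq> \<Union>M" "edges G' \<subseteq> M" and "G' \<noteq> G"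
        using ps by (auto simp: proper_subgraph_def subgraph_def G_def)
      \<comment> \<open>\<open>G\<close> has no isolated vertices, so a proper subgraph must lack an
        edge, not merely vertices.\<close>
      have "edges G' \<noteq> M"
      proof
        assume eq: "edges G' = M"
        then have "\<Union>M \<subseteq> verts G'" using sG' by (auto simp: simple_graph_def)
        then have "G' = G" using eq sub by (cases G') (simp add: G_def)
        then show False using \<open>G' \<noteq> G\<close> by simp
      qed
      then have "colourable (edges G')" using M(6) sub by blast
      then show ?thesis using ramsey_for_iff_not_colourable[OF tcf sG'] by blast
    qed
    moreover have "ramsey_for q H G"
      using ramsey_for_iff_not_colourable[OF tcf sG] M(5) by (simp add: G_def)
    ultimately have min: "G \<in> ramsey_minimal_graphs q H"
      using sG by (simp add: ramsey_minimal_graphs_def)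
    have "induced_subgraph (induced_on G ?V) G"
      using M(2) by (auto simp: induced_subgraph_def G_def)
    moreover have "graph_iso F (induced_on G ?V)"
      unfolding graph_iso_def
    proof (intro exI[of _ f] conjI ballI)
      show "bij_betw f (verts F) (verts (induced_on G ?V))"
        using f by (simp add: induced_on_def inj_on_imp_bij_betw)
      fix u v assume uv: "u \<in> verts F" "v \<in> verts F"
      have "{f u, f v} \<in> M \<longleftrightarrow> {f u, f v} \<in> ?FE" by (rule M(4)) (use uv in auto)
      also have "\<dots> \<longleftrightarrow> {u, v} \<in> edges F"
      proof
        assume "{f u, f v} \<in> ?FE"
        then obtain e where e: "e \<in> edges F" "f ` {u, v} = f ` e" by auto
        then have "{u, v} = e"
          using inj_on_image_eq_iff[OF f, of "{u, v}" e] edF[OF e(1)] uv by simp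
        then show "{u, v} \<in> edges F" using e by simp
      next
        assume "{u, v} \<in> edges F"
        then have "f ` {u, v} \<in> ?FE" by (rule imageI)
        then show "{f u, f v} \<in> ?FE" by simp
      qed
      finally show "{u, v} \<in> edges F \<longleftrightarrow> {f u, f v} \<in> edges (induced_on G ?V)"
        using uv by (auto simp: induced_on_def G_def)
    qed
    ultimately have "good G" using min by (auto simp: good_def)
    then show ?thesis using M(3) by (auto simp: G_def)
  qed
  \<comment> \<open>Infinitely many orders occur. One graph is taken for each, and different orders
    rule out isomorphism.\<close>
  define S where "S = {card (verts G) |G. good G}"
  have infS: "infinite S"
  proof
    assume fin: "finite S"
    obtain G where G: "good G" "Suc (Max S) \<le> card (verts G)" using large by blast
    then have "card (verts G) \<in> S" by (auto simp: S_def)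
    then have "card (verts G) \<le> Max S" using fin by simp
    then show False using G(2) by simp
  qed
  define pick where "pick k = (SOME G. good G \<and> card (verts G) = k)" for k
  have pick: "good (pick k) \<and> card (verts (pick k)) = k" if "k \<in> S" for k
  proof -
    have "\<exists>G. good G \<and> card (verts G) = k" using that by (auto simp: S_def)
    then show ?thesis unfolding pick_def by (rule someI_ex)
  qed
  have "inj_on pick S" using pick by (metis inj_onI)
  then have "infinite (pick ` S)" using infS finite_imageD by blast
  moreover have "pairwise (\<lambda>G G'. \<not> graph_iso G G') (pick ` S)"
  proof (rule pairwiseI)
    fix G G' assume GG: "G \<in> pick ` S" "G' \<in> pick ` S" "G \<noteq> G'"
    then have "card (verts G) \<noteq> card (verts G')" using pick by auto
    then show "\<not> graph_iso G G'"
      unfolding graph_iso_def using bij_betw_same_card by blast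
  qed
  moreover have "\<forall>G\<in>pick ` S. G \<in> ramsey_minimal_graphs q H \<and> (\<exists>F'. induced_subgraph F' G \<and> graph_iso F F')"
    using pick by (auto simp: good_def)
  ultimately show ?thesis by blast
qed

end
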